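(* Let $B\subseteq\mathbb R^d_\xi$ be a connected open set, let $\mathrm{ch}\,B$ denote its convex hull, and let $T\in\mathcal D'^{*}(\mathbb R^d_x)$ be such that $e^{-x\xi}T(x)\in\mathcal S'^{*}(\mathbb R^d_x)$ for every $\xi\in B$. Then $e^{-x\xi}T(x)\in\mathcal S'^{*}(\mathbb R^d_x)$ for every $\xi\in\mathrm{ch}\,B$, and there is a function $f$, analytic in $\zeta=\xi+i\eta$ on $\mathrm{ch}\,B+i\mathbb R^d$, such that for each fixed $\xi\in\mathrm{ch}\,B$ the tempered ultradistribution $\mathcal F_{x\to\eta}\big(e^{-x\xi}T(x)\big)$ equals the function $\eta\mapsto f(\xi+i\eta)$. Moreover, in the Beurling case $*=(M_p)$: for every compact $K\subset\mathrm{ch}\,B$ there exist $k>0$ and $C>0$, and in the Roumieu case $*=\{M_p\}$: for every compact $K\subset\mathrm{ch}\,B$ and every $k>0$ there exists $C>0$, such that $$|f(\xi+i\eta)|\le C e^{M(k|\eta|)}\quad\text{for all }\xi\in K,\ \eta\in\mathbb R^d.$$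
   Context: $M_p$ ($p\in\mathbb N$) is a sequence of positive numbers with $M_0=1$ satisfying (M.1) $M_p^2\le M_{p-1}M_{p+1}$, $p\ge1$; (M.2) $M_p\le c_0H^p\min_{0\le q\le p}M_{p-q}M_q$ for some $c_0,H\ge1$; (M.3) $\sum_{p=q+1}^\infty M_{p-1}/M_p\le c_0 q M_q/M_{q+1}$, $q\ge1$. For $\alpha\in\mathbb N^d$, $M_\alpha=M_{|\alpha|}$. The associated function is $M(\rho)=\sup_{p\in\mathbb N}\log_+(\rho^p/M_p)$, $\rho>0$. The symbol $*$ stands for either $(M_p)$ (Beurling) or $\{M_p\}$ (Roumieu). $\mathcal D'^{*}(\mathbb R^d)$ denotes Komatsu's space of ultradistributions of Beurling resp. Roumieu type (dual of $\mathcal D^{(M_p)}$ resp. $\mathcal D^{\{M_p\}}$, the spaces of compactly supported smooth $\varphi$ with $\sup_{\alpha,x}|D^\alpha\varphi(x)|/(h^{|\alpha|}M_\alpha)<\infty$ for every $h>0$ resp. for some $h>0$). For $m>0$ let $\sigma_{m,\infty}(\varphi)=\sup_{\alpha,\beta\in\mathbb N^d}\sup_x m^{|\alpha|+|\beta|}\langle x\rangle^{|\beta|}|D^\alpha\varphi(x)|/(M_\alpha M_\beta)$, $\langle x\rangle=(1+|x|^2)^{1/2}$, and $\mathcal S^{M_p,m}_\infty$ the Banach space of smooth $\varphi$ with $\sigma_{m,\infty}(\varphi)<\infty$; $\mathcal S^{(M_p)}=\varprojlim_{m\to\infty}\mathcal S^{M_p,m}_\infty$, $\mathcal S^{\{M_p\}}=\varinjlim_{m\to0}\mathcal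 S^{M_p,m}_\infty$, and $\mathcal S'^{*}$ is the strong dual (tempered ultradistributions). The Fourier transform $\mathcal F f(\eta)=\int e^{-ix\eta}f(x)\,dx$ is an automorphism of $\mathcal S'^{*}$. *)

theory Defs
  imports "HOL-Analysis.Analysis"
begin

datatype utype = Beurling | Roumieu

definition weight_seq :: "(nat \<Rightarrow> real) \<Rightarrow> real \<Rightarrow> real \<Rightarrow> bool" where
  "weight_seq M c0 H \<longleftrightarrow>
     M 0 = 1 \<and> (\<forall>p. M p > 0) \<and> c0 \<ge> 1 \<and> H \<ge> 1 \<and>
     (\<forall>p\<ge>1. (M p)^2 \<le> M (p - 1) * M (p + 1)) \<and>
     (\<forall>p. \<forall>q\<le>p. M p \<le> c0 * H ^ p * M (p - q) * M q) \<and>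
     (\<forall>q\<ge>1. summable (\<lambda>k. M (q + k) / M (q + k + 1)) \<and>
             (\<Sum>k. M (q + k) / M (q + k + 1)) \<le> c0 * real q * M q / M (q + 1))"

definition assoc_fun :: "(nat \<Rightarrow> real) \<Rightarrow> real \<Rightarrow> real" where
  "assoc_fun M \<rho> = (SUP p. max 0 (ln (\<rho> ^ p / M p)))"

text \<open>Partial derivative in the j-th coordinate direction, and iterated partial
  derivatives along a list of directions (the length of the list is the order |alpha|).\<close>
definition pdir :: "'n::finite \<Rightarrow> (real^'n \<Rightarrow> complex) \<Rightarrow> real^'n \<Rightarrow> complex" where
  "pdir j f x = vector_derivative (\<lambda>t. f (x + t *\<^sub>R axis j 1)) (at 0)"

fun Dl :: "'n::finite list \<Rightarrow> (real^'n \<Rightarrow> complex) \<Rightarrow> real^'n \<Rightarrow> complex" where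
  "Dl [] f = f"
| "Dl (j # js) f = pdir j (Dl js f)"

definition smooth_fun :: "(real^'n::finite \<Rightarrow> complex) \<Rightarrow> bool" where
  "smooth_fun f \<longleftrightarrow> (\<forall>js. continuous_on UNIV (Dl js f) \<and>
      (\<forall>j x. ((\<lambda>t. Dl js f (x + t *\<^sub>R axis j 1)) has_vector_derivative Dl (j # js) f x) (at 0)))"

definition Dbound :: "(nat \<Rightarrow> real) \<Rightarrow> real \<Rightarrow> real \<Rightarrow> (real^'n::finite \<Rightarrow> complex) \<Rightarrow> bool" where
  "Dbound M h A \<phi> \<longleftrightarrow> (\<forall>js x. cmod (Dl js \<phi> x) \<le> A * h ^ length js * M (length js))"

definition Dtest :: "utype \<Rightarrow> (nat \<Rightarrow> real) \<Rightarrow> (real^'n::finite \<Rightarrow> complex) set" where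
  "Dtest s M = {\<phi>. smooth_fun \<phi> \<and> compact (closure {x. \<phi> x \<noteq> 0}) \<and>
     (case s of
        Beurling \<Rightarrow> (\<forall>h>0. \<exists>A. Dbound M h A \<phi>)
      | Roumieu \<Rightarrow> (\<exists>h>0. \<exists>A. Dbound M h A \<phi>))}"

definition lin_on :: "('a \<Rightarrow> complex) set \<Rightarrow> (('a \<Rightarrow> complex) \<Rightarrow> complex) \<Rightarrow> bool" where
  "lin_on V T \<longleftrightarrow> (\<forall>\<phi>\<in>V. \<forall>\<psi>\<in>V. \<forall>a b. T (\<lambda>x. a * \<phi> x + b * \<psi> x) = a * T \<phi> + b * T \<psi>)"

text \<open>Ultradistributions: continuous linear functionals on D^*. Continuity is expressed by the
  standard seminorm estimates: Beurling: for each compact K there are h, C with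
  |T phi| <= C sup |D^alpha phi|/(h^|alpha| M_alpha) (supp phi in K);
  Roumieu: the same for every h > 0 (with C depending on K and h).\<close>
definition ultradist :: "utype \<Rightarrow> (nat \<Rightarrow> real) \<Rightarrow> ((real^'n::finite \<Rightarrow> complex) \<Rightarrow> complex) \<Rightarrow> bool" where
  "ultradist s M T \<longleftrightarrow> lin_on (Dtest s M) T \<and>
     (\<forall>K. compact K \<longrightarrow>
        (let est = (\<lambda>h C. \<forall>\<phi>\<in>Dtest s M. {x. \<phi> x \<noteq> 0} \<subseteq> K \<longrightarrow>
                       (\<forall>A. Dbound M h A \<phi> \<longrightarrow> cmod (T \<phi>) \<le> C * A))
         in case s of
              Beurling \<Rightarrow> (\<exists>h>0. \<exists>C. est h C)
            | Roumieu \<Rightarrow> (\<forall>h>0. \<exists>C. est h C)))"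

definition Sbound :: "(nat \<Rightarrow> real) \<Rightarrow> real \<Rightarrow> real \<Rightarrow> (real^'n::finite \<Rightarrow> complex) \<Rightarrow> bool" where
  "Sbound M m A \<phi> \<longleftrightarrow> (\<forall>js q x.
      m ^ (length js + q) * (sqrt (1 + (norm x)\<^sup>2)) ^ q * cmod (Dl js \<phi> x)
        \<le> A * M (length js) * M q)"

definition Stest :: "utype \<Rightarrow> (nat \<Rightarrow> real) \<Rightarrow> (real^'n::finite \<Rightarrow> complex) set" where
  "Stest s M = {\<phi>. smooth_fun \<phi> \<and>
     (case s of
        Beurling \<Rightarrow> (\<forall>m>0. \<exists>A. Sbound M m A \<phi>)
      | Roumieu \<Rightarrow> (\<exists>m>0. \<exists>A. Sbound M m A \<phi>))}"

text \<open>Tempered ultradistributions: continuous linear functionals on S^*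
  (Beurling: projective limit, so bounded by one seminorm sigma_m;
   Roumieu: inductive limit, so bounded on every Banach space S^{M_p,m}_infty).\<close>
definition tempered :: "utype \<Rightarrow> (nat \<Rightarrow> real) \<Rightarrow> ((real^'n::finite \<Rightarrow> complex) \<Rightarrow> complex) \<Rightarrow> bool" where
  "tempered s M S \<longleftrightarrow> lin_on (Stest s M) S \<and>
     (let est = (\<lambda>m C. \<forall>\<phi>\<in>Stest s M.
                    (\<forall>A. Sbound M m A \<phi> \<longrightarrow> cmod (S \<phi>) \<le> C * A))
      in case s of
           Beurling \<Rightarrow> (\<exists>m>0. \<exists>C. est m C)
         | Roumieu \<Rightarrow> (\<forall>m>0. \<exists>C. est m C))"

text \<open>S represents e^{-x xi} T(x) as a tempered ultradistribution: S is tempered and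
  agrees with phi |-> T(e^{-x xi} phi) on D^* (which is dense in S^*).\<close>
definition represents_exp_mult ::
  "utype \<Rightarrow> (nat \<Rightarrow> real) \<Rightarrow> ((real^'n::finite \<Rightarrow> complex) \<Rightarrow> complex) \<Rightarrow> real^'n
    \<Rightarrow> ((real^'n \<Rightarrow> complex) \<Rightarrow> complex) \<Rightarrow> bool" where
  "represents_exp_mult s M T \<xi> S \<longleftrightarrow> tempered s M S \<and>
     (\<forall>\<phi>\<in>Dtest s M. S \<phi> = T (\<lambda>x. exp (- complex_of_real (x \<bullet> \<xi>)) * \<phi> x))"

definition fourier :: "(real^'n::finite \<Rightarrow> complex) \<Rightarrow> real^'n \<Rightarrow> complex" where
  "fourier \<psi> x = (LINT \<eta>|lborel. exp (- \<i> * complex_of_real (x \<bullet> \<eta>)) * \<psi> \<eta>)"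

definition cpt :: "real^'n::finite \<Rightarrow> real^'n \<Rightarrow> complex^'n" where
  "cpt \<xi> \<eta> = (\<chi> j. Complex (\<xi> $ j) (\<eta> $ j))"

text \<open>Holomorphy in several complex variables: complex (Frechet) differentiability,
  i.e. the real derivative is complex linear.\<close>
definition holo_on :: "(complex^'n::finite \<Rightarrow> complex) \<Rightarrow> (complex^'n) set \<Rightarrow> bool" where
  "holo_on f U \<longleftrightarrow> (\<forall>z\<in>U. \<exists>L. (f has_derivative L) (at z) \<and>
                         (\<forall>v. L (\<chi> j. \<i> * v $ j) = \<i> * L v))"

end

theory Submission
  imports Defs "HOL-Probability.Sinc_Integral"
begin

text \<open>Let $\xi_0$ be a point of the convex hull of $B$. Since $B$ is open, some closed ball of radius $2e$
  around $\xi_0$ lies in the convex hull of a finite set $F\subseteq B$. Put $w(x)=\sum_{i\in F}e^{-xi}$ and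
  $\varphi_z(x)=e^{-xz}/w(x)$. The derivatives of $\varphi_z$ satisfy factorial bounds relative to
  $|\varphi_z|$, and $|\varphi_z(x)|\le e^{-e|x|}$ if $|\mathrm{Re}\,z-\xi_0|\le e$; so $\varphi_z$ lies in
  $\mathcal S^*$. Let $S_F=\sum_{i\in F}e^{-xi}T$, a tempered ultradistribution. As $e^{-xz}=w\varphi_z$, one has
  $e^{-x\xi}T=\varphi_\xi S_F$, which is tempered, and $f(z)=S_F(\varphi_z)=\lim_n T(\kappa_n e^{-xz})$ for
  cut-off functions $\kappa_n$, so that $f$ does not depend on $F$. Holomorphy is Taylor expansion of
  $e^{-xz}$ in $z$; the growth bound comes from $|\eta|^p\le k^{-p}M_p e^{M(k|\eta|)}$, applied to the
  derivatives of $e^{-ix\eta}$; and the identity for the Fourier transform is the interchange of $S_F$ with an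
  integral over $\eta$, obtained by cutting a large ball into small pieces.\<close>

section \<open>Iterated partial derivatives\<close>

text \<open>Two obstacles shape the development. Functionals are bare maps with seminorm estimates,
  so \<open>SF\<close> cannot simply be applied to a vector-valued integral: holomorphy and the
  exchange with integrals rest on estimates over indexed families with one constant
  (\<open>tempered_family\<close>). And every estimate has to serve the Beurling and the Roumieu
  case. A constant factor lost in the scale h is harmless in both, so each operation may replace h
  by c h; such factors come from (M.2), where extra powers of the bracket cost H, and from the
  Leibniz rule, where scales add. (M.3) enters through the summability of M_(p-1)/M_p, in two ways:
  it allows cut-offs with bounds at every h, and it yields n! L^n \<le> C M_n for every L. The
  latter is why e^(-xz)/w(x), whose derivatives grow like factorials, multiplies both kinds of test
  spaces. The radius 2e leaves a reserve e after Re z has moved by e, and this reserve is the rate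
  of decay; half of it is spent on factors that grow like e^(e|x|/2), among them the Taylor
  remainder in z.\<close>

definition has_pdir :: "'n::finite \<Rightarrow> (real^'n \<Rightarrow> complex) \<Rightarrow> (real^'n \<Rightarrow> complex) \<Rightarrow> bool" where
  "has_pdir j f g \<longleftrightarrow> (\<forall>x. ((\<lambda>t. f (x + t *\<^sub>R axis j 1)) has_vector_derivative g x) (at 0))"

text \<open>\<open>pdir\<close> is a choice made by \<open>vector_derivative\<close> and says
  nothing where no derivative exists; calculus is therefore done with the relation
  \<open>has_pdir\<close> and transferred by this fact.\<close>

lemma has_pdir_imp_pdir: "has_pdir j f g \<Longrightarrow> pdir j f = g"
  unfolding has_pdir_def pdir_def by (auto intro!: ext vector_derivative_at)

lemma has_pdir_mult:
  assumes "has_pdir j f f'" "has_pdir j g g'"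
  shows "has_pdir j (\<lambda>x. f x * g x) (\<lambda>x. f x * g' x + f' x * g x)"
  unfolding has_pdir_def
proof
  fix x
  show "((\<lambda>t. f (x + t *\<^sub>R axis j 1) * g (x + t *\<^sub>R axis j 1)) has_vector_derivative
      f x * g' x + f' x * g x) (at 0)"
    using has_vector_derivative_mult[of "\<lambda>t. f (x + t *\<^sub>R axis j 1)" "f' x" 0 UNIV
        "\<lambda>t. g (x + t *\<^sub>R axis j 1)" "g' x"] assms
    unfolding has_pdir_def by simp
qed

lemma has_pdir_add:
  "has_pdir j f f' \<Longrightarrow> has_pdir j g g' \<Longrightarrow> has_pdir j (\<lambda>x. f x + g x) (\<lambda>x. f' x + g' x)"
  unfolding has_pdir_def by (auto intro: has_vector_derivative_add)

lemma has_pdir_const: "has_pdir j (\<lambda>x. c) (\<lambda>x. 0)"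
  unfolding has_pdir_def by auto

lemma has_pdir_cmult: "has_pdir j f f' \<Longrightarrow> has_pdir j (\<lambda>x. c * f x) (\<lambda>x. c * f' x)"
  using has_pdir_mult[OF has_pdir_const[of j c], of f f'] by simp

lemma has_pdir_inverse:
  assumes "has_pdir j f f'" "\<And>x. f x \<noteq> 0"
  shows "has_pdir j (\<lambda>x. inverse (f x)) (\<lambda>x. - f' x * (inverse (f x) * inverse (f x)))"
  unfolding has_pdir_def
proof
  fix x
  have a: "((\<lambda>t. f (x + t *\<^sub>R axis j 1)) has_derivative (\<lambda>h. h *\<^sub>R f' x)) (at 0)"
    using assms(1) unfolding has_pdir_def has_vector_derivative_def by blast
  have "((\<lambda>t. inverse (f (x + t *\<^sub>R axis j 1))) has_derivative
      (\<lambda>h. - (inverse (f x) * (h *\<^sub>R f' x) * inverse (f x)))) (at 0)"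
    using Deriv.has_derivative_inverse[OF _ a] assms(2) by force
  moreover have "(\<lambda>h. - (inverse (f x) * (h *\<^sub>R f' x) * inverse (f x)))
      = (\<lambda>h. h *\<^sub>R (- f' x * (inverse (f x) * inverse (f x))))"
    by (simp add: fun_eq_iff scaleR_conv_of_real)
  ultimately show "((\<lambda>t. inverse (f (x + t *\<^sub>R axis j 1))) has_vector_derivative
      - f' x * (inverse (f x) * inverse (f x))) (at 0)"
    unfolding has_vector_derivative_def by metis
qed

lemma Dl_append: "Dl (xs @ ys) f = Dl xs (Dl ys f)"
  by (induct xs) auto

text \<open>The head of the list is the outermost derivative, so the last entry is the one applied
  first. Splitting it off reduces a claim about \<open>f\<close> to one about
  \<open>pdir j f\<close>, which is why many estimates go by \<open>rev_induct\<close>.\<close>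

lemma Dl_snoc: "Dl (js @ [j]) f = Dl js (pdir j f)"
  by (simp add: Dl_append)

lemma smooth_fun_has_pdir: "smooth_fun f \<Longrightarrow> has_pdir j (Dl js f) (Dl (j # js) f)"
  unfolding smooth_fun_def has_pdir_def by blast

lemma smooth_fun_has_pdir0: "smooth_fun f \<Longrightarrow> has_pdir j f (pdir j f)"
  using smooth_fun_has_pdir[of f j "[]"] by simp

lemma smooth_fun_continuous: "smooth_fun f \<Longrightarrow> continuous_on UNIV f"
  unfolding smooth_fun_def by (metis Dl.simps(1))

lemma smooth_fun_Dl: "smooth_fun f \<Longrightarrow> smooth_fun (Dl js f)"
  unfolding smooth_fun_def by (metis Dl_append append_Cons)

lemma smooth_fun_pdir: "smooth_fun f \<Longrightarrow> smooth_fun (pdir j f)"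
  using smooth_fun_Dl[of f "[j]"] by simp

text \<open>Smooth functions are the largest class of continuous functions closed under partial
  derivatives. For families such as the multiples of one exponential, exhibiting the family replaces
  any computation of higher derivatives.\<close>

lemma smooth_coinduct:
  assumes "f \<in> C" and cont: "\<And>f. f \<in> C \<Longrightarrow> continuous_on UNIV f"
    and step: "\<And>f j. f \<in> C \<Longrightarrow> \<exists>g\<in>C. has_pdir j f g"
  shows "smooth_fun f"
proof -
  have C: "Dl js f \<in> C" for js
  proof (induct js)
    case (Cons j js)
    then show ?case using step[OF Cons, of j] has_pdir_imp_pdir by force
  qed (use assms in simp)
  have "has_pdir j (Dl js f) (Dl (j # js) f)" for j js
    using step[OF C[of js], of j] has_pdir_imp_pdir[of j "Dl js f"] by force
  then show ?thesis
    unfolding smooth_fun_def using cont[OF C] unfolding has_pdir_def by blast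
qed

text \<open>Finite differentiability, as a ladder for products and inverses: their derivatives
  contain the undifferentiated functions again, so closure follows by induction on the order rather
  than from an explicit class.\<close>

primrec smooth_upto :: "nat \<Rightarrow> (real^'n::finite \<Rightarrow> complex) \<Rightarrow> bool" where
  "smooth_upto 0 f \<longleftrightarrow> continuous_on UNIV f"
| "smooth_upto (Suc n) f \<longleftrightarrow> continuous_on UNIV f \<and> (\<forall>j. \<exists>g. smooth_upto n g \<and> has_pdir j f g)"

lemma smooth_fun_iff_upto: "smooth_fun f \<longleftrightarrow> (\<forall>n. smooth_upto n f)"
proof
  assume "smooth_fun f"
  then have "smooth_upto n f" for n
  proof (induct n arbitrary: f)
    case (Suc n)
    then show ?case
      using smooth_fun_continuous smooth_fun_pdir smooth_fun_has_pdir0 by (metis smooth_upto.simps(2))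
  qed (simp add: smooth_fun_continuous)
  then show "\<forall>n. smooth_upto n f" by blast
next
  assume *: "\<forall>n. smooth_upto n f"
  show "smooth_fun f"
  proof (rule smooth_coinduct[of _ "{f. \<forall>n. smooth_upto n f}"])
    fix g :: "real^'n \<Rightarrow> complex" and j
    assume g: "g \<in> {f. \<forall>n. smooth_upto n f}"
    then show "continuous_on UNIV g" by (metis mem_Collect_eq smooth_upto.simps(1))
    have "\<exists>h. smooth_upto n h \<and> has_pdir j g h" for n
      using g by (metis mem_Collect_eq smooth_upto.simps(2))
    then have "smooth_upto n (pdir j g) \<and> has_pdir j g (pdir j g)" for n
      using has_pdir_imp_pdir by metis
    then show "\<exists>h\<in>{f. \<forall>n. smooth_upto n f}. has_pdir j g h" by blast
  qed (use * in simp)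
qed

lemma smooth_upto_SucD: "smooth_upto (Suc n) f \<Longrightarrow> smooth_upto n f"
proof (induct n arbitrary: f)
  case (Suc n)
  then show ?case by (metis smooth_upto.simps(2))
qed simp

lemma smooth_upto_add: "smooth_upto n f \<Longrightarrow> smooth_upto n g \<Longrightarrow> smooth_upto n (\<lambda>x. f x + g x)"
proof (induct n arbitrary: f g)
  case (Suc n)
  show ?case unfolding smooth_upto.simps
  proof (intro conjI allI)
    fix j
    obtain f' g' where "smooth_upto n f'" "has_pdir j f f'" "smooth_upto n g'" "has_pdir j g g'"
      using Suc.prems unfolding smooth_upto.simps by meson
    then show "\<exists>h. smooth_upto n h \<and> has_pdir j (\<lambda>x. f x + g x) h"
      using Suc.hyps[of f' g'] has_pdir_add by blast
  qed (use Suc.prems in \<open>auto intro: continuous_on_add\<close>)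
qed (auto intro: continuous_on_add)

lemma smooth_upto_mult: "smooth_upto n f \<Longrightarrow> smooth_upto n g \<Longrightarrow> smooth_upto n (\<lambda>x. f x * g x)"
proof (induct n arbitrary: f g)
  case (Suc n)
  show ?case unfolding smooth_upto.simps
  proof (intro conjI allI)
    fix j
    obtain f' g' where *: "smooth_upto n f'" "has_pdir j f f'" "smooth_upto n g'" "has_pdir j g g'"
      using Suc.prems unfolding smooth_upto.simps by meson
    have "smooth_upto n (\<lambda>x. f x * g' x + f' x * g x)"
      using * Suc.hyps smooth_upto_SucD Suc.prems by (intro smooth_upto_add) auto
    then show "\<exists>h. smooth_upto n h \<and> has_pdir j (\<lambda>x. f x * g x) h"
      using has_pdir_mult[OF *(2,4)] by blast
  qed (use Suc.prems in \<open>auto intro: continuous_on_mult\<close>)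
qed (auto intro: continuous_on_mult)

lemma smooth_const: "smooth_fun (\<lambda>x. c)"
  by (rule smooth_coinduct[of _ "{\<lambda>x. c |c. True}"]) (auto intro: has_pdir_const)

text \<open>Since (1/f)' = -f' (1/f)^2, the next order of 1/f needs only the previous order of 1/f
  and of f'.\<close>

lemma smooth_upto_inverse:
  assumes "\<And>x. f x \<noteq> 0"
  shows "smooth_upto n f \<Longrightarrow> smooth_upto n (\<lambda>x. inverse (f x))"
proof (induct n)
  case 0
  then show ?case using assms by (auto intro: continuous_on_inverse)
next
  case (Suc n)
  show ?case unfolding smooth_upto.simps
  proof (intro conjI allI)
    fix j
    obtain f' where *: "smooth_upto n f'" "has_pdir j f f'"
      using Suc.prems unfolding smooth_upto.simps by meson
    have c: "smooth_upto n (\<lambda>x. -1)" using smooth_const smooth_fun_iff_upto by blast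
    have "smooth_upto n (\<lambda>x. (- 1 * f' x) * (inverse (f x) * inverse (f x)))"
      using * Suc smooth_upto_SucD c by (intro smooth_upto_mult) auto
    then show "\<exists>h. smooth_upto n h \<and> has_pdir j (\<lambda>x. inverse (f x)) h"
      using has_pdir_inverse[OF *(2) assms] by auto
  qed (use Suc.prems assms in \<open>auto intro: continuous_on_inverse\<close>)
qed

lemma smooth_add: "smooth_fun f \<Longrightarrow> smooth_fun g \<Longrightarrow> smooth_fun (\<lambda>x. f x + g x)"
  by (simp add: smooth_fun_iff_upto smooth_upto_add del: smooth_upto.simps)

lemma smooth_mult: "smooth_fun f \<Longrightarrow> smooth_fun g \<Longrightarrow> smooth_fun (\<lambda>x. f x * g x)"
  by (simp add: smooth_fun_iff_upto smooth_upto_mult del: smooth_upto.simps)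

lemma smooth_inverse: "smooth_fun f \<Longrightarrow> (\<And>x. f x \<noteq> 0) \<Longrightarrow> smooth_fun (\<lambda>x. inverse (f x))"
  by (simp add: smooth_fun_iff_upto smooth_upto_inverse del: smooth_upto.simps)

lemma smooth_cmult: "smooth_fun f \<Longrightarrow> smooth_fun (\<lambda>x. c * f x)"
  by (rule smooth_mult[OF smooth_const])

lemma smooth_diff: "smooth_fun f \<Longrightarrow> smooth_fun g \<Longrightarrow> smooth_fun (\<lambda>x. f x - g x)"
  using smooth_add[of f "\<lambda>x. -1 * g x"] smooth_cmult[of g "-1"] by simp

lemma smooth_sum: "(\<And>i. i \<in> I \<Longrightarrow> smooth_fun (f i)) \<Longrightarrow> smooth_fun (\<lambda>x. \<Sum>i\<in>I. f i x)"
  by (induct I rule: infinite_finite_induct) (auto intro: smooth_const smooth_add)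

lemma smooth_prod: "(\<And>i. i \<in> I \<Longrightarrow> smooth_fun (f i)) \<Longrightarrow> smooth_fun (\<lambda>x. \<Prod>i\<in>I. f i x)"
  by (induct I rule: infinite_finite_induct) (auto intro: smooth_const smooth_mult)

lemma smooth_power: "smooth_fun f \<Longrightarrow> smooth_fun (\<lambda>x. f x ^ r)"
  by (induct r) (auto intro: smooth_const smooth_mult)

lemma has_pdir_coord: "has_pdir j (\<lambda>x. complex_of_real (x $ k)) (\<lambda>x. if k = j then 1 else 0)"
  unfolding has_pdir_def
proof
  fix x
  show "((\<lambda>t. complex_of_real ((x + t *\<^sub>R axis j 1) $ k)) has_vector_derivative (if k = j then 1 else 0)) (at 0)"
    by (auto simp: axis_def intro!: derivative_eq_intros)
qed

lemma smooth_coord: "smooth_fun (\<lambda>x. complex_of_real (x $ k))"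
proof (rule smooth_coinduct[of _ "insert (\<lambda>x. complex_of_real (x $ k)) {\<lambda>x. c |c. True}"])
  fix f and j :: 'a assume f: "f \<in> insert (\<lambda>x. complex_of_real (x $ k)) {\<lambda>x. c |c. True}"
  then show "continuous_on UNIV f" by (auto intro!: continuous_intros)
  show "\<exists>g\<in>insert (\<lambda>x. complex_of_real (x $ k)) {\<lambda>x. c |c. True}. has_pdir j f g"
    using f has_pdir_coord[of j k] has_pdir_const[of j] by auto
qed auto

section \<open>Linearity and locality of iterated derivatives\<close>

lemma Dl_add:
  assumes "smooth_fun f" "smooth_fun g"
  shows "Dl js (\<lambda>x. f x + g x) = (\<lambda>x. Dl js f x + Dl js g x)"
proof (induct js)
  case (Cons j js)
  then show ?case
    using has_pdir_imp_pdir[OF has_pdir_add[OF smooth_fun_has_pdir[OF assms(1), of j js]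
          smooth_fun_has_pdir[OF assms(2), of j js]]] by simp
qed simp

lemma Dl_cmult:
  assumes "smooth_fun f"
  shows "Dl js (\<lambda>x. c * f x) = (\<lambda>x. c * Dl js f x)"
proof (induct js)
  case (Cons j js)
  then show ?case
    using has_pdir_imp_pdir[OF has_pdir_cmult[OF smooth_fun_has_pdir[OF assms(1), of j js]]] by simp
qed simp

lemma Dl_sum:
  assumes "\<And>i. i \<in> I \<Longrightarrow> smooth_fun (f i)"
  shows "Dl js (\<lambda>x. \<Sum>i\<in>I. f i x) = (\<lambda>x. \<Sum>i\<in>I. Dl js (f i) x)"
  using assms
proof (induct I rule: infinite_finite_induct)
  case (infinite A)
  then show ?case using Dl_cmult[OF smooth_const, of js 0 0] by simp
next
  case empty
  then show ?case using Dl_cmult[OF smooth_const, of js 0 0] by simp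
next
  case (insert a F)
  then show ?case using Dl_add[of "f a" "\<lambda>x. \<Sum>i\<in>F. f i x" js] smooth_sum[of F f] by simp
qed

lemma Dl_diff:
  assumes "smooth_fun f" "smooth_fun g"
  shows "Dl js (\<lambda>x. f x - g x) = (\<lambda>x. Dl js f x - Dl js g x)"
  using Dl_add[OF assms(1) smooth_cmult[OF assms(2), of "-1"], of js] Dl_cmult[OF assms(2), of js "-1"]
  by simp

lemma Dl_cong_open:
  assumes "open U" "\<And>x. x \<in> U \<Longrightarrow> f x = g x" "x \<in> U"
  shows "Dl js f x = Dl js g x"
  using assms(3)
proof (induct js arbitrary: x)
  case (Cons j js)
  have "((\<lambda>t::real. x + t *\<^sub>R axis j 1) \<longlongrightarrow> x + 0 *\<^sub>R axis j 1) (nhds 0)"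
    by (intro tendsto_intros) (auto simp: filterlim_def)
  then have "\<forall>\<^sub>F t in nhds (0::real). x + t *\<^sub>R axis j 1 \<in> U"
    using topological_tendstoD[OF _ assms(1)] Cons.prems by force
  then have "\<forall>\<^sub>F t in nhds (0::real). t \<in> UNIV \<longrightarrow> Dl js f (x + t *\<^sub>R axis j 1) = Dl js g (x + t *\<^sub>R axis j 1)"
    by eventually_elim (use Cons in auto)
  then show ?case
    by (auto simp: pdir_def intro: vector_derivative_cong_eq)
qed (use assms in auto)

text \<open>Serves constants on the whole space as well as functions that vanish near a point, in
  particular off their closed support.\<close>

lemma Dl_const_open:
  fixes f :: "real^'n::finite \<Rightarrow> complex"
  assumes "open U" "\<And>x. x \<in> U \<Longrightarrow> f x = c" "x \<in> U"
  shows "Dl js f x = (if js = [] then c else 0)"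
proof -
  have "Dl js (\<lambda>x::real^'n. c) = (if js = [] then \<lambda>x. c else (\<lambda>x. 0))"
  proof (induct js)
    case (Cons a js)
    have "pdir a (\<lambda>x::real^'n. c) = (\<lambda>x. 0)" "pdir a (\<lambda>x::real^'n. 0::complex) = (\<lambda>x. 0)"
      using has_pdir_imp_pdir[OF has_pdir_const] by blast+
    then show ?case using Cons by simp
  qed simp
  then show ?thesis using Dl_cong_open[OF assms(1), of f "\<lambda>x. c" x js] assms by (auto split: if_splits)
qed

section \<open>Pointwise bounds on derivatives\<close>

text \<open>The point \<open>x\<close> is a parameter so that the amplitude \<open>a\<close> may
  depend on it: exponential decay or growth is carried through the Leibniz rule inside
  \<open>a\<close>, while \<open>h\<close> remains uniform.\<close>

definition pbound :: "(nat \<Rightarrow> real) \<Rightarrow> (real^'n::finite \<Rightarrow> complex) \<Rightarrow> real^'n \<Rightarrow> real \<Rightarrow> real \<Rightarrow> bool" where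
  "pbound M f x a h \<longleftrightarrow> (\<forall>js. cmod (Dl js f x) \<le> a * h ^ length js * M (length js))"

lemma Dbound_iff_pbound: "Dbound M h A \<phi> \<longleftrightarrow> (\<forall>x. pbound M \<phi> x A h)"
  unfolding Dbound_def pbound_def by blast

text \<open>Using log-convexity in the form $M_pM_q\le M_{p+q}$ and shifting the weight index along with
  the derivatives avoids binomial sums in the Leibniz rule.\<close>

lemma pbound_mult_shift:
  fixes f g :: "real^'n::finite \<Rightarrow> complex"
  assumes M: "\<And>p q. M p * M q \<le> M (p + q)" "\<And>p. M p \<ge> 0" and hk: "h \<ge> 0" "k \<ge> 0"
    and "smooth_fun f" "smooth_fun g" "a \<ge> 0" "b \<ge> 0"
    and "\<And>js. cmod (Dl js f x) \<le> a * h ^ length js * M (length js + p)"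
    and "\<And>js. cmod (Dl js g x) \<le> b * k ^ length js * M (length js + q)"
  shows "cmod (Dl js (\<lambda>x. f x * g x) x) \<le> (a * b) * (h + k) ^ length js * M (length js + p + q)"
  using assms(5-)
proof (induct js arbitrary: f g a b p q rule: rev_induct)
  case Nil
  have "cmod (f x * g x) \<le> (a * M p) * (b * M q)"
    unfolding norm_mult using Nil(5)[of "[]"] Nil(6)[of "[]"] Nil(3,4) M(2)
    by (intro mult_mono) auto
  also have "\<dots> = (a * b) * (M p * M q)" by simp
  also have "\<dots> \<le> (a * b) * M (p + q)" using M Nil by (intro mult_left_mono) auto
  finally show ?case by simp
next
  case (snoc j js)
  note sf = snoc.prems(1) and sg = snoc.prems(2)
  let ?n = "length js"
  have e: "pdir j (\<lambda>x. f x * g x) = (\<lambda>x. f x * pdir j g x + pdir j f x * g x)"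
    using has_pdir_imp_pdir[OF has_pdir_mult] smooth_fun_has_pdir0 sf sg by blast
  have 1: "cmod (Dl js (\<lambda>x. f x * pdir j g x) x) \<le> (a * (b * k)) * (h + k) ^ ?n * M (?n + p + Suc q)"
  proof (rule snoc.hyps[OF sf smooth_fun_pdir[OF sg]])
    fix ks :: "'n list"
    show "cmod (Dl ks (pdir j g) x) \<le> b * k * k ^ length ks * M (length ks + Suc q)"
      using snoc.prems(6)[of "ks @ [j]"] by (simp add: Dl_snoc mult.assoc)
  qed (use snoc.prems hk in auto)
  have 2: "cmod (Dl js (\<lambda>x. pdir j f x * g x) x) \<le> ((a * h) * b) * (h + k) ^ ?n * M (?n + Suc p + q)"
  proof (rule snoc.hyps[OF smooth_fun_pdir[OF sf] sg])
    fix ks :: "'n list"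
    show "cmod (Dl ks (pdir j f) x) \<le> a * h * h ^ length ks * M (length ks + Suc p)"
      using snoc.prems(5)[of "ks @ [j]"] by (simp add: Dl_snoc mult.assoc)
  qed (use snoc.prems hk in auto)
  have "Dl (js @ [j]) (\<lambda>x. f x * g x) x = Dl js (\<lambda>x. f x * pdir j g x) x + Dl js (\<lambda>x. pdir j f x * g x) x"
    unfolding Dl_snoc e using sf sg smooth_fun_pdir smooth_mult by (subst Dl_add) blast+
  then have "cmod (Dl (js @ [j]) (\<lambda>x. f x * g x) x) \<le>
      (a * (b * k)) * (h + k) ^ ?n * M (?n + p + Suc q) + ((a * h) * b) * (h + k) ^ ?n * M (?n + Suc p + q)"
    using 1 2 norm_triangle_ineq[of "Dl js (\<lambda>x. f x * pdir j g x) x" "Dl js (\<lambda>x. pdir j f x * g x) x"] by simp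
  also have "\<dots> = (a * b) * (h + k) ^ length (js @ [j]) * M (length (js @ [j]) + p + q)"
    by (simp add: algebra_simps)
  finally show ?case .
qed

lemma pbound_0: "pbound M f x a h \<Longrightarrow> M 0 = 1 \<Longrightarrow> cmod (f x) \<le> a"
  unfolding pbound_def by (metis Dl.simps(1) list.size(3) mult.right_neutral power_0)

lemma pbound_nonneg: "pbound M f x a h \<Longrightarrow> M 0 = 1 \<Longrightarrow> a \<ge> 0"
  by (meson norm_ge_zero order_trans pbound_0)

lemma pbound_mono:
  fixes f :: "real^'n::finite \<Rightarrow> complex"
  assumes "pbound M f x a h" "a \<le> b" "0 \<le> h" "h \<le> k" "0 \<le> a" "\<And>p. M p \<ge> 0"
  shows "pbound M f x b k"
  unfolding pbound_def
proof
  fix js :: "'n list"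
  have "a * h ^ length js * M (length js) \<le> b * k ^ length js * M (length js)"
    using assms by (intro mult_mono power_mono mult_nonneg_nonneg) auto
  then show "cmod (Dl js f x) \<le> b * k ^ length js * M (length js)"
    using assms(1) unfolding pbound_def by (meson order_trans)
qed

lemma pbound_add:
  fixes f g :: "real^'n::finite \<Rightarrow> complex"
  assumes "smooth_fun f" "smooth_fun g" "pbound M f x a h" "pbound M g x b h"
  shows "pbound M (\<lambda>x. f x + g x) x (a + b) h"
  unfolding pbound_def Dl_add[OF assms(1,2)]
proof
  fix js :: "'n list"
  show "cmod (Dl js f x + Dl js g x) \<le> (a + b) * h ^ length js * M (length js)"
    using norm_triangle_ineq[of "Dl js f x" "Dl js g x"] assms(3,4)[unfolded pbound_def, rule_format, of js]
    by (simp add: algebra_simps)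
qed

lemma pbound_cmult:
  fixes f :: "real^'n::finite \<Rightarrow> complex"
  assumes "smooth_fun f" "pbound M f x a h"
  shows "pbound M (\<lambda>x. c * f x) x (cmod c * a) h"
  unfolding pbound_def Dl_cmult[OF assms(1)] norm_mult
proof
  fix js :: "'n list"
  show "cmod c * cmod (Dl js f x) \<le> cmod c * a * h ^ length js * M (length js)"
    using mult_left_mono[OF assms(2)[unfolded pbound_def, rule_format, of js] norm_ge_zero[of c]]
    by (simp add: algebra_simps)
qed

section \<open>Weight sequences\<close>

text \<open>Olivier's argument: by monotonicity \<open>r k\<close> is at most each of the roughly
  k/2 terms with indices between \<open>k div 2\<close> and k, and the sum over that block tends to
  0.\<close>

lemma decseq_summable_imp:
  fixes r :: "nat \<Rightarrow> real"
  assumes "decseq r" "\<And>k. r k \<ge> 0" "summable r"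
  shows "(\<lambda>k. (real k + 1) * r k) \<longlonglongrightarrow> 0"
proof -
  have le: "(real k + 1) * r k \<le> 2 * (sum r {..<Suc k} - sum r {..<k div 2})" for k
  proof -
    have "sum r {..<Suc k} - sum r {..<k div 2} = sum r {k div 2..<Suc k}"
      using sum_diff_nat_ivl[of 0 "k div 2" "Suc k" r] by (simp add: atLeast0LessThan)
    moreover have "(\<Sum>i\<in>{k div 2..<Suc k}. r k) \<le> sum r {k div 2..<Suc k}"
      using assms(1) by (intro sum_mono) (auto simp: decseq_def)
    moreover have "(\<Sum>i\<in>{k div 2..<Suc k}. r k) = real (Suc k - k div 2) * r k" by simp
    moreover have "(real k + 1) / 2 * r k \<le> real (Suc k - k div 2) * r k"
    proof (intro mult_right_mono assms(2))
      have "k + 1 \<le> 2 * (Suc k - k div 2)" by linarith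
      then have "real (k + 1) \<le> real (2 * (Suc k - k div 2))" by (rule of_nat_mono)
      then show "(real k + 1) / 2 \<le> real (Suc k - k div 2)" by simp
    qed
    ultimately have "(real k + 1) / 2 * r k \<le> sum r {..<Suc k} - sum r {..<k div 2}" by linarith
    then show ?thesis by (simp add: field_simps)
  qed
  have l1: "(\<lambda>k. sum r {..<Suc k}) \<longlonglongrightarrow> suminf r"
    using summable_LIMSEQ[OF assms(3)] by (rule LIMSEQ_Suc)
  have "filterlim (\<lambda>k::nat. k div 2) at_top at_top"
    unfolding filterlim_at_top
  proof
    fix Z :: nat
    show "\<forall>\<^sub>F k in sequentially. Z \<le> k div 2"
      using eventually_ge_at_top[of "2 * Z"] by eventually_elim linarith
  qed
  then have l2: "(\<lambda>k. sum r {..<k div 2}) \<longlonglongrightarrow> suminf r"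
    using filterlim_compose[OF summable_LIMSEQ[OF assms(3)]] by blast
  have "(\<lambda>k. 2 * (sum r {..<Suc k} - sum r {..<k div 2})) \<longlonglongrightarrow> 2 * (suminf r - suminf r)"
    by (intro tendsto_intros l1 l2)
  then have l3: "(\<lambda>k. 2 * (sum r {..<Suc k} - sum r {..<k div 2})) \<longlonglongrightarrow> 0" by simp
  show ?thesis
    by (rule tendsto_sandwich[OF _ _ tendsto_const l3]) (use assms(2) le in auto)
qed

text \<open>From some index on the factors are at most 1, so the products can no longer grow. In
  \<open>fact_le\<close> and \<open>exists_cutoff_1d\<close> this turns a null sequence of factors
  into a bound relative to \<open>M\<close>.\<close>

lemma prod_bounded_of_tendsto_0:
  fixes b :: "nat \<Rightarrow> real"
  assumes "\<And>k. b k \<ge> 0" "b \<longlonglongrightarrow> 0"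
  shows "\<exists>C>0. \<forall>n. (\<Prod>k<n. b k) \<le> C"
proof -
  obtain N where N: "\<And>n. n \<ge> N \<Longrightarrow> b n \<le> 1"
    using order_tendstoD(2)[OF assms(2), of 1] unfolding eventually_sequentially by (auto intro: less_imp_le)
  define P where "P n = (\<Prod>k<n. b k)" for n
  define C where "C = Max (P ` {..N}) + 1"
  have P0: "P n \<ge> 0" for n unfolding P_def using assms(1) by (intro prod_nonneg) auto
  have C: "P n \<le> C" for n
  proof (induct n)
    case 0
    have "P 0 \<le> Max (P ` {..N})" by (intro Max_ge) auto
    then show ?case unfolding C_def by linarith
  next
    case (Suc n)
    show ?case
    proof (cases "Suc n \<le> N")
      case True
      then have "P (Suc n) \<le> Max (P ` {..N})" by (intro Max_ge) auto
      then show ?thesis unfolding C_def by simp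
    next
      case False
      have "P (Suc n) = P n * b n" unfolding P_def by simp
      also have "\<dots> \<le> P n * 1" using N[of n] False P0[of n] by (intro mult_left_mono) auto
      finally show ?thesis using Suc by simp
    qed
  qed
  have "P 0 \<le> Max (P ` {..N})" by (intro Max_ge) auto
  then have "C > 0" using P0[of 0] unfolding C_def by linarith
  with C show ?thesis unfolding P_def by blast
qed

definition jb :: "'a::real_normed_vector \<Rightarrow> real" where "jb x = sqrt (1 + (norm x)\<^sup>2)"

lemma jb_ge_1: "jb x \<ge> 1" unfolding jb_def by simp

lemma jb_pos [simp]: "jb x > 0" using jb_ge_1[of x] by linarith

lemma norm_le_jb: "norm x \<le> jb x"
  unfolding jb_def by (rule real_le_rsqrt) simp

lemma jb_le: "jb x \<le> 1 + norm x"
  unfolding jb_def by (rule real_le_lsqrt) (auto simp: power2_eq_square algebra_simps)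

lemma power_div_fact_le_exp:
  fixes y :: real assumes "y \<ge> 0"
  shows "y ^ q / fact q \<le> exp y"
proof -
  have "sum (\<lambda>n. y ^ n /\<^sub>R fact n) {q} \<le> (\<Sum>n. y ^ n /\<^sub>R fact n)"
    using assms by (intro sum_le_suminf summable_exp_generic) auto
  then show ?thesis unfolding exp_def by (simp add: field_simps)
qed

text \<open>The seminorms of $\mathcal S^*$ and $\mathcal D^*$ are indexed by $h=1/m$ so that both are increasing
  in $A$ and $h$.  A condition on test functions is required for all or for some $h$
  (\<open>class_quant\<close>), a continuity estimate for some or for all $h$ (\<open>dual_quant\<close>).\<close>

definition SB :: "(nat \<Rightarrow> real) \<Rightarrow> real \<Rightarrow> real \<Rightarrow> (real^'n::finite \<Rightarrow> complex) \<Rightarrow> bool" where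
  "SB M h A \<phi> \<longleftrightarrow> (\<forall>js q x. jb x ^ q * cmod (Dl js \<phi> x) \<le> A * h ^ (length js + q) * M (length js) * M q)"

lemma Sbound_iff_SB: "h > 0 \<Longrightarrow> Sbound M (1 / h) A \<phi> \<longleftrightarrow> SB M h A \<phi>"
  unfolding Sbound_def SB_def jb_def by (simp add: power_one_over field_simps)

definition class_quant :: "utype \<Rightarrow> (real \<Rightarrow> bool) \<Rightarrow> bool" where
  "class_quant s P \<longleftrightarrow> (case s of Beurling \<Rightarrow> \<forall>h>0. P h | Roumieu \<Rightarrow> \<exists>h>0. P h)"

definition dual_quant :: "utype \<Rightarrow> (real \<Rightarrow> bool) \<Rightarrow> bool" where
  "dual_quant s P \<longleftrightarrow> (case s of Beurling \<Rightarrow> \<exists>h>0. P h | Roumieu \<Rightarrow> \<forall>h>0. P h)"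

text \<open>One of the two quantifiers is universal in either case, so a test function and a
  functional always meet at a common h. This pairing spares the continuity estimates a distinction
  of cases.\<close>

lemma class_dual_quant: "class_quant s P \<Longrightarrow> dual_quant s Q \<Longrightarrow> \<exists>h>0. P h \<and> Q h"
  by (cases s) (auto simp: class_quant_def dual_quant_def)

lemma class_quant_all: "(\<And>h. h > 0 \<Longrightarrow> P h) \<Longrightarrow> class_quant s P"
  by (cases s) (auto simp: class_quant_def intro: exI[of _ 1])

text \<open>Multiplication by c is a bijection of the positive reals; a constant factor lost in the
  scale is invisible to either quantifier.\<close>

lemma class_quant_scale:
  assumes "class_quant s P" "c > 0" "\<And>h. h > 0 \<Longrightarrow> P h \<Longrightarrow> Q (c * h)"
  shows "class_quant s Q"
proof (cases s)
  case Beurling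
  have "Q h" if "h > 0" for h
    using assms(1,2) assms(3)[of "h / c"] that Beurling unfolding class_quant_def by auto
  then show ?thesis using Beurling unfolding class_quant_def by simp
next
  case Roumieu
  then show ?thesis using assms unfolding class_quant_def by (auto intro: mult_pos_pos)
qed

lemma dual_quant_scale:
  assumes "dual_quant s Q" "c > 0" "\<And>h. h > 0 \<Longrightarrow> Q (c * h) \<Longrightarrow> P h"
  shows "dual_quant s P"
proof (cases s)
  case Beurling
  then obtain h where "h > 0" "Q h" using assms(1) unfolding dual_quant_def by auto
  then have "h / c > 0" "P (h / c)" using assms(2) assms(3)[of "h / c"] by auto
  then show ?thesis using Beurling unfolding dual_quant_def by auto
next
  case Roumieu
  then show ?thesis using assms unfolding dual_quant_def by (auto intro: mult_pos_pos)
qed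

text \<open>Monotonicity merges two existential witnesses, here by their maximum; the dual version
  takes the minimum because continuity estimates persist for smaller h.\<close>

lemma class_quant_conj:
  assumes "class_quant s P" "class_quant s Q"
    "\<And>h k. 0 < h \<Longrightarrow> h \<le> k \<Longrightarrow> P h \<Longrightarrow> P k" "\<And>h k. 0 < h \<Longrightarrow> h \<le> k \<Longrightarrow> Q h \<Longrightarrow> Q k"
  shows "class_quant s (\<lambda>h. P h \<and> Q h)"
proof (cases s)
  case Roumieu
  then obtain h k where "h > 0" "P h" "k > 0" "Q k" using assms(1,2) unfolding class_quant_def by auto
  then have "max h k > 0" "P (max h k)" "Q (max h k)"
    using assms(3)[of h "max h k"] assms(4)[of k "max h k"] by auto
  then show ?thesis using Roumieu unfolding class_quant_def by auto
qed (use assms in \<open>auto simp: class_quant_def\<close>)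

lemma dual_quant_conj:
  assumes "dual_quant s P" "dual_quant s Q"
    "\<And>h k. 0 < h \<Longrightarrow> h \<le> k \<Longrightarrow> P k \<Longrightarrow> P h" "\<And>h k. 0 < h \<Longrightarrow> h \<le> k \<Longrightarrow> Q k \<Longrightarrow> Q h"
  shows "dual_quant s (\<lambda>h. P h \<and> Q h)"
proof (cases s)
  case Beurling
  then obtain h k where "h > 0" "P h" "k > 0" "Q k" using assms(1,2) unfolding dual_quant_def by auto
  then have "min h k > 0" "P (min h k)" "Q (min h k)"
    using assms(3)[of "min h k" h] assms(4)[of "min h k" k] by auto
  then show ?thesis using Beurling unfolding dual_quant_def by (auto intro!: exI[of _ "min h k"])
qed (use assms in \<open>auto simp: dual_quant_def\<close>)

lemma all_pos_inverse: "(\<forall>m>0. P (m::real)) \<longleftrightarrow> (\<forall>h>0. P (1 / h))"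
proof safe
  fix m :: real assume "\<forall>h>0. P (1 / h)" "m > 0"
  then show "P m" by (metis divide_divide_eq_right div_by_1 mult_1 zero_less_divide_1_iff)
qed auto

lemma ex_pos_inverse: "(\<exists>m>0. P (m::real)) \<longleftrightarrow> (\<exists>h>0. P (1 / h))"
  using all_pos_inverse[of "\<lambda>m. \<not> P m"] by blast

lemma Stest_iff:
  "\<phi> \<in> Stest s M \<longleftrightarrow> smooth_fun \<phi> \<and> class_quant s (\<lambda>h. \<exists>A. SB M h A \<phi>)"
  unfolding Stest_def class_quant_def
  by (subst all_pos_inverse, subst ex_pos_inverse) (cases s; simp add: Sbound_iff_SB cong: conj_cong)

lemma Dtest_iff:
  "\<phi> \<in> Dtest s M \<longleftrightarrow> smooth_fun \<phi> \<and> compact (closure {x. \<phi> x \<noteq> 0}) \<and> class_quant s (\<lambda>h. \<exists>A. Dbound M h A \<phi>)"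
  unfolding Dtest_def class_quant_def by simp

text \<open>The constant is hidden so that the estimate becomes a predicate of the scale alone,
  which is what \<open>dual_quant\<close> quantifies.\<close>

definition est :: "utype \<Rightarrow> (nat \<Rightarrow> real) \<Rightarrow> ((real^'n::finite \<Rightarrow> complex) \<Rightarrow> complex) \<Rightarrow> real \<Rightarrow> bool" where
  "est s M S h \<longleftrightarrow> (\<exists>C. \<forall>\<phi>\<in>Stest s M. \<forall>A. SB M h A \<phi> \<longrightarrow> cmod (S \<phi>) \<le> C * A)"

lemma tempered_iff:
  "tempered s M S \<longleftrightarrow> lin_on (Stest s M) S \<and> dual_quant s (est s M S)"
  unfolding tempered_def dual_quant_def est_def Let_def
  by (subst all_pos_inverse, subst ex_pos_inverse) (cases s; simp add: Sbound_iff_SB cong: conj_cong)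

text \<open>The quantifier order matters: one scale h has to serve all indices at once; then the
  constants of the functional and of the family multiply to a single one, independent of i.\<close>

lemma tempered_family:
  assumes "tempered s M S" "\<And>i. i \<in> I \<Longrightarrow> \<phi> i \<in> Stest s M"
    "class_quant s (\<lambda>h. \<exists>C. \<forall>i\<in>I. SB M h (C * A i) (\<phi> i))"
  shows "\<exists>C. \<forall>i\<in>I. cmod (S (\<phi> i)) \<le> C * A i"
proof -
  obtain h where "est s M S h" "\<exists>C. \<forall>i\<in>I. SB M h (C * A i) (\<phi> i)"
    using class_dual_quant[OF assms(3)] assms(1) unfolding tempered_iff by blast
  then obtain C C' where C: "\<forall>\<phi>\<in>Stest s M. \<forall>A. SB M h A \<phi> \<longrightarrow> cmod (S \<phi>) \<le> C * A"
      and C': "\<forall>i\<in>I. SB M h (C' * A i) (\<phi> i)" unfolding est_def by auto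
  have "cmod (S (\<phi> i)) \<le> C * C' * A i" if "i \<in> I" for i
    using C[rule_format, OF assms(2)[OF that], of "C' * A i"] C' that by (simp add: mult.assoc)
  then show ?thesis by blast
qed

section \<open>Consequences of (M.1), (M.2) and (M.3)\<close>

locale weights =
  fixes M :: "nat \<Rightarrow> real" and c0 H :: real
  assumes weight_seq: "weight_seq M c0 H"
begin

lemma M0 [simp]: "M 0 = 1" and M_pos [simp]: "M p > 0" and c0: "c0 \<ge> 1" and H: "H \<ge> 1"
  using weight_seq unfolding weight_seq_def by blast+

lemma M_nonneg [simp]: "M p \<ge> 0"
  using M_pos[of p] by linarith

lemma M_neq_0 [simp]: "M p \<noteq> 0"
  using M_pos[of p] by linarith

lemma M_add_le: "M (p + q) \<le> c0 * H ^ (p + q) * M p * M q"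
  using weight_seq unfolding weight_seq_def by (metis add_diff_cancel_right' le_add2)

lemma M_ratio_decseq: "decseq (\<lambda>p. M p / M (Suc p))"
proof (rule decseq_SucI)
  fix p
  have "(M (Suc p))^2 \<le> M p * M (Suc (Suc p))"
    using weight_seq unfolding weight_seq_def by (metis Suc_eq_plus1 diff_Suc_1 le_add2)
  then show "M (Suc p) / M (Suc (Suc p)) \<le> M p / M (Suc p)"
    using M_pos[of "Suc p"] M_pos[of "Suc (Suc p)"] by (simp add: field_simps power2_eq_square)
qed

text \<open>The case q = 1 of (M.3); the missing first term does not affect summability. This is the
  Denjoy-Carleman condition behind the existence of cut-offs.\<close>

lemma M_ratio_summable: "summable (\<lambda>p. M p / M (Suc p))"
proof -
  have "summable (\<lambda>k. M (1 + k) / M (1 + k + 1))"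
    using weight_seq unfolding weight_seq_def by blast
  then show ?thesis using summable_Suc_iff[of "\<lambda>p. M p / M (Suc p)"] by simp
qed

text \<open>By (M.1) the ratios M_(q+1)/M_q increase with q, so passing from q to q + 1 multiplies
  the right-hand side at least as much as the left-hand side; both agree at q = 0 because
  \<open>M 0 = 1\<close>.\<close>

lemma M_mult_le: "M p * M q \<le> M (p + q)"
proof (induct q)
  case (Suc q)
  have "M (p + q) / M (Suc (p + q)) \<le> M q / M (Suc q)"
    using M_ratio_decseq unfolding decseq_def by simp
  then have 1: "M (p + q) * M (Suc q) \<le> M q * M (Suc (p + q))"
    using M_pos[of "Suc q"] M_pos[of "Suc (p + q)"] by (simp add: field_simps)
  have 2: "M p * M q * M (Suc q) \<le> M (p + q) * M (Suc q)"
    using Suc M_pos[of "Suc q"] by (intro mult_right_mono) auto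
  have "M q * (M p * M (Suc q)) = M p * M q * M (Suc q)" by simp
  then have "M q * (M p * M (Suc q)) \<le> M q * M (Suc (p + q))" using 1 2 by linarith
  then show ?case using M_pos[of q] by simp
qed simp

text \<open>The quotient n! L^n / M_n is the product of the factors L (k+1) M_k / M_(k+1), which
  tend to 0 because the ratios are decreasing and summable. Thus derivative bounds of analytic type
  hold at every scale of \<open>M\<close>.\<close>

lemma fact_le:
  assumes "L \<ge> 0"
  shows "\<exists>C>0. \<forall>n. fact n * L ^ n \<le> C * M n"
proof -
  define b where "b k = L * ((real k + 1) * (M k / M (Suc k)))" for k
  have "b \<longlonglongrightarrow> L * 0" unfolding b_def
    by (intro tendsto_intros decseq_summable_imp M_ratio_decseq M_ratio_summable) auto
  moreover have "b k \<ge> 0" for k unfolding b_def using assms by auto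
  ultimately obtain C where C: "C > 0" "\<And>n. (\<Prod>k<n. b k) \<le> C" using prod_bounded_of_tendsto_0[of b] by auto
  have "(\<Prod>k<n. b k) = fact n * L ^ n / M n" for n
  proof (induct n)
    case (Suc n)
    then show ?case using M_pos[of n] by (simp add: b_def field_simps)
  qed simp
  then have "fact n * L ^ n \<le> C * M n" for n
    using mult_right_mono[OF C(2)[of n], of "M n"] by simp
  with C(1) show ?thesis by blast
qed

lemma power_le: assumes "L \<ge> 0" shows "\<exists>C>0. \<forall>n. L ^ n \<le> C * M n"
proof -
  obtain C where C: "C > 0" "\<And>n. fact n * L ^ n \<le> C * M n" using fact_le[OF assms] by blast
  have "L ^ n \<le> fact n * L ^ n" for n :: nat
    using mult_right_mono[OF fact_ge_1[of n, where 'a=real] zero_le_power[OF assms, of n]] by simp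
  then show ?thesis using C by (meson order_trans)
qed

lemma pbound_mult:
  assumes "smooth_fun f" "smooth_fun g" "pbound M f x a h" "pbound M g x b k" "h \<ge> 0" "k \<ge> 0"
  shows "pbound M (\<lambda>x. f x * g x) x (a * b) (h + k)"
  unfolding pbound_def
  using pbound_mult_shift[of M h k f g a b x 0 0] assms M_mult_le pbound_nonneg[OF assms(3) M0]
    pbound_nonneg[OF assms(4) M0]
  unfolding pbound_def by simp

section \<open>Calculus of the seminorms of the space S\<close>

lemma SB_nonneg: "SB M h A \<phi> \<Longrightarrow> A \<ge> 0"
  unfolding SB_def
  by (metis (no_types, opaque_lifting) Dl.simps(1) M0 add_0 list.size(3) mult.commute mult_1 norm_ge_zero order_trans power_0)

lemma SB_mono:
  assumes "SB M h A \<phi>" "A \<le> B" "0 \<le> h" "h \<le> k"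
  shows "SB M k B \<phi>"
  unfolding SB_def
proof (intro allI)
  fix js :: "'a list" and q x
  have "A * h ^ (length js + q) * M (length js) * M q \<le> B * k ^ (length js + q) * M (length js) * M q"
    using assms SB_nonneg[OF assms(1)] by (intro mult_mono power_mono mult_nonneg_nonneg) auto
  then show "jb x ^ q * cmod (Dl js \<phi> x) \<le> B * k ^ (length js + q) * M (length js) * M q"
    using assms(1) unfolding SB_def by (meson order_trans)
qed

text \<open>For each q the seminorm condition is a pointwise bound with amplitude A h^q M_q / <x>^q;
  the Leibniz rule can then be applied for one q at a time.\<close>

lemma SB_iff_pbound:
  "SB M h A \<phi> \<longleftrightarrow> (\<forall>q x. pbound M \<phi> x (A * h ^ q * M q / jb x ^ q) h)"
  unfolding SB_def pbound_def by (auto simp: field_simps power_add)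

lemma SB_add:
  assumes "smooth_fun f" "smooth_fun g" "SB M h A f" "SB M h B g"
  shows "SB M h (A + B) (\<lambda>x. f x + g x)"
  using pbound_add[OF assms(1,2)] assms(3,4) unfolding SB_iff_pbound
  by (simp add: distrib_right add_divide_distrib)

lemma SB_cmult:
  assumes "smooth_fun f" "SB M h A f"
  shows "SB M h (cmod c * A) (\<lambda>x. c * f x)"
  unfolding SB_iff_pbound
proof (intro allI)
  fix q x
  show "pbound M (\<lambda>x. c * f x) x (cmod c * A * h ^ q * M q / jb x ^ q) h"
    using pbound_cmult[OF assms(1), of M x "A * h ^ q * M q / jb x ^ q" h c] assms(2)
    unfolding SB_iff_pbound by (simp add: mult.assoc)
qed

lemma SB_mult:
  assumes "smooth_fun f" "smooth_fun g" "\<And>x. pbound M g x C k" "SB M h A f" "h \<ge> 0" "k \<ge> 0"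
  shows "SB M (h + k) (C * A) (\<lambda>x. g x * f x)"
  unfolding SB_iff_pbound
proof (intro allI)
  fix q and x :: "real^'a"
  have C: "C \<ge> 0" using pbound_nonneg[OF assms(3)] by simp
  have A: "A \<ge> 0" using SB_nonneg[OF assms(4)] .
  have "pbound M f x (A * h ^ q * M q / jb x ^ q) h" using assms(4) unfolding SB_iff_pbound by blast
  from pbound_mult[OF assms(2,1) assms(3) this] assms(5,6)
  have "pbound M (\<lambda>x. g x * f x) x (C * (A * h ^ q * M q / jb x ^ q)) (k + h)" by blast
  moreover have "C * (A * h ^ q * M q / jb x ^ q) \<le> C * (A * (h + k) ^ q * M q / jb x ^ q)"
    using assms C A by (intro mult_left_mono divide_right_mono mult_right_mono power_mono)
      (auto simp: less_imp_le)
  ultimately show "pbound M (\<lambda>x. g x * f x) x (C * A * (h + k) ^ q * M q / jb x ^ q) (h + k)"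
    using assms C A by (auto elim!: pbound_mono simp: add.commute mult.assoc less_imp_le)
qed

text \<open>Exponential decay beats every power of the bracket: <x>^q e^(-\<delta>|x|) is at most
  e^\<delta> q! / \<delta>^q, and the factorial is absorbed by M_q. The constant depends on \<delta>
  and h alone, so whole families are covered.\<close>

lemma SB_of_expdecay:
  assumes "\<delta> > 0" "h > 0"
  shows "\<exists>C>0. \<forall>A (f :: real^'n::finite \<Rightarrow> complex).
    (\<forall>x. pbound M f x (A * exp (- \<delta> * norm x)) h) \<longrightarrow> SB M h (C * A) f"
proof -
  \<comment> \<open>With L = 1/(\<delta> h) one has q! / \<delta>^q = h^q q! L^q, which is at most C
    h^q M_q: the scale h is kept.\<close>
  obtain C where C: "C > 0" "\<And>q. fact q * (1 / (\<delta> * h)) ^ q \<le> C * M q"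
    using fact_le[of "1 / (\<delta> * h)"] assms by auto
  have key: "jb x ^ q * exp (- \<delta> * norm x) \<le> exp \<delta> * C * h ^ q * M q" for q and x :: "real^'n"
  proof -
    have "(\<delta> * jb x) ^ q / fact q \<le> exp (\<delta> * jb x)"
      using assms by (intro power_div_fact_le_exp) (simp add: less_imp_le)
    also have "\<dots> \<le> exp (\<delta> + \<delta> * norm x)"
      using assms mult_left_mono[OF jb_le[of x], of \<delta>] by (simp add: distrib_left)
    finally have "jb x ^ q * \<delta> ^ q \<le> fact q * (exp \<delta> * exp (\<delta> * norm x))"
      by (simp add: field_simps power_mult_distrib exp_add)
    then have "jb x ^ q * exp (- \<delta> * norm x) \<le> exp \<delta> * h ^ q * (fact q * (1 / (\<delta> * h)) ^ q)"
      using assms by (simp add: field_simps exp_minus power_mult_distrib)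
    also have "\<dots> \<le> exp \<delta> * h ^ q * (C * M q)"
      using C(2) assms by (intro mult_left_mono) auto
    finally show ?thesis by (simp add: algebra_simps)
  qed
  have "SB M h ((exp \<delta> * C) * A) f" if f: "\<forall>x. pbound M f x (A * exp (- \<delta> * norm x)) h"
    for A and f :: "real^'n \<Rightarrow> complex"
    unfolding SB_iff_pbound
  proof (intro allI)
    fix q and x :: "real^'n"
    have "A * exp (- \<delta> * norm x) \<ge> 0" using pbound_nonneg[of M f x] f by auto
    then have A: "A \<ge> 0" by (simp add: zero_le_mult_iff)
    have "A * (exp (- \<delta> * norm x) * jb x ^ q) \<le> A * (exp \<delta> * C * h ^ q * M q)"
      using key[where x=x and q=q] A by (intro mult_left_mono) (simp_all add: mult.commute)
    then have "A * exp (- \<delta> * norm x) \<le> exp \<delta> * C * A * h ^ q * M q / jb x ^ q"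
      by (simp add: field_simps)
    then show "pbound M f x (exp \<delta> * C * A * h ^ q * M q / jb x ^ q) h"
      using f A assms pbound_mono[of M f x "A * exp (- \<delta> * norm x)" h _ h] by auto
  qed
  moreover have "exp \<delta> * C > 0" using C by simp
  ultimately show ?thesis by blast
qed

end

section \<open>Non-quasianalytic cut-off functions\<close>

text \<open>The cut-off is the limit of successive averages over intervals of lengths $a_0,a_1,\dots$ with
  $\sum a_k<\infty$, applied to a trapezoid.  Each derivative consumes one average and
  turns it into a difference quotient, so that the $k$-th derivative is bounded by
  $\prod_{i<k}2/a_i$.\<close>

lemma has_vector_derivative_quadratic:
  fixes f :: "real \<Rightarrow> 'a::real_normed_vector"
  assumes "\<And>h. \<bar>h\<bar> \<le> 1 \<Longrightarrow> norm (f (x + h) - f x - h *\<^sub>R D) \<le> C * h\<^sup>2"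
  shows "(f has_vector_derivative D) (at x)"
proof -
  have C: "C \<ge> 0" using order_trans[OF norm_ge_zero assms[of 1]] by simp
  have "((\<lambda>h. norm (f (x + h) - f x - h *\<^sub>R D) / norm h) \<longlongrightarrow> 0) (at 0)"
  proof (rule tendsto_sandwich)
    show "\<forall>\<^sub>F h in at 0. 0 \<le> norm (f (x + h) - f x - h *\<^sub>R D) / norm h" by simp
    have "\<forall>\<^sub>F h in at (0::real). \<bar>h\<bar> < 1"
      using eventually_at[of "\<lambda>h. \<bar>h\<bar> < 1" "0::real" UNIV] by (auto intro!: exI[of _ 1] simp: dist_real_def)
    then show "\<forall>\<^sub>F h in at 0. norm (f (x + h) - f x - h *\<^sub>R D) / norm h \<le> C * \<bar>h\<bar>"
    proof eventually_elim
      case (elim h)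
      have "norm (f (x + h) - f x - h *\<^sub>R D) / norm h \<le> C * h\<^sup>2 / \<bar>h\<bar>"
        using assms[of h] elim by (simp add: divide_right_mono)
      also have "\<dots> = C * \<bar>h\<bar>" by (cases "h = 0") (auto simp: power2_eq_square abs_if)
      finally show ?case .
    qed
    show "((\<lambda>h. C * \<bar>h\<bar>) \<longlongrightarrow> 0) (at (0::real))" by (auto intro!: tendsto_eq_intros)
  qed (rule tendsto_const)
  then show ?thesis
    unfolding has_vector_derivative_def has_derivative_at by (auto intro: bounded_linear_scaleR_left)
qed

text \<open>Averages keep both constants and difference quotients multiply both by 2/a. The
  Lipschitz constant controls the convergence of the averages and the remainders, the bound controls
  the derivatives themselves.\<close>

definition bounded_lipschitz :: "real \<Rightarrow> real \<Rightarrow> (real \<Rightarrow> real) \<Rightarrow> bool" where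
  "bounded_lipschitz b L u \<longleftrightarrow> (\<forall>x. \<bar>u x\<bar> \<le> b) \<and> (\<forall>x y. \<bar>u x - u y\<bar> \<le> L * \<bar>x - y\<bar>)"

lemma bounded_lipschitz_nonneg: "bounded_lipschitz b L u \<Longrightarrow> b \<ge> 0 \<and> L \<ge> 0"
  unfolding bounded_lipschitz_def by (metis abs_ge_zero abs_one diff_zero mult.right_neutral order_trans)

lemma bounded_lipschitz_continuous:
  assumes "bounded_lipschitz b L u" shows "continuous_on S (\<lambda>t. u (x - t))"
proof -
  have "L-lipschitz_on UNIV u"
    using assms bounded_lipschitz_nonneg[OF assms]
    unfolding bounded_lipschitz_def by (auto intro!: lipschitz_onI simp: dist_real_def)
  then have "continuous_on UNIV u" by (rule lipschitz_on_continuous_on)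
  then show ?thesis
    by (rule continuous_on_compose2) (auto intro!: continuous_intros)
qed

lemma bounded_lipschitz_integrable:
  "bounded_lipschitz b L u \<Longrightarrow> (\<lambda>t. u (x - t)) integrable_on {c..d}"
  by (intro integrable_continuous_real bounded_lipschitz_continuous)

lemma bounded_lipschitz_shift:
  "bounded_lipschitz b L u \<Longrightarrow> bounded_lipschitz b L (\<lambda>x. u (x + h))"
  unfolding bounded_lipschitz_def by (metis add_diff_cancel_right)

lemma bounded_lipschitz_lin:
  assumes "bounded_lipschitz b L u" "bounded_lipschitz b' L' v"
  shows "bounded_lipschitz (\<bar>c\<bar> * b + \<bar>d\<bar> * b') (\<bar>c\<bar> * L + \<bar>d\<bar> * L') (\<lambda>x. c * u x + d * v x)"
  unfolding bounded_lipschitz_def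
proof (intro conjI allI)
  fix x y
  have "\<bar>c * u x + d * v x\<bar> \<le> \<bar>c\<bar> * \<bar>u x\<bar> + \<bar>d\<bar> * \<bar>v x\<bar>"
    by (metis abs_mult abs_triangle_ineq)
  also have "\<dots> \<le> \<bar>c\<bar> * b + \<bar>d\<bar> * b'"
    using assms unfolding bounded_lipschitz_def by (intro add_mono mult_left_mono) auto
  finally show "\<bar>c * u x + d * v x\<bar> \<le> \<bar>c\<bar> * b + \<bar>d\<bar> * b'" .
  have "\<bar>c * u x + d * v x - (c * u y + d * v y)\<bar> = \<bar>c * (u x - u y) + d * (v x - v y)\<bar>"
    by (simp add: algebra_simps)
  also have "\<dots> \<le> \<bar>c\<bar> * \<bar>u x - u y\<bar> + \<bar>d\<bar> * \<bar>v x - v y\<bar>"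
    by (metis abs_mult abs_triangle_ineq)
  also have "\<dots> \<le> \<bar>c\<bar> * (L * \<bar>x - y\<bar>) + \<bar>d\<bar> * (L' * \<bar>x - y\<bar>)"
    using assms unfolding bounded_lipschitz_def by (intro add_mono mult_left_mono) auto
  finally show "\<bar>c * u x + d * v x - (c * u y + d * v y)\<bar> \<le> (\<bar>c\<bar> * L + \<bar>d\<bar> * L') * \<bar>x - y\<bar>"
    by (simp add: algebra_simps)
qed

text \<open>Convolution with the uniform density on \<open>{0..a}\<close>; the value at x looks back
  from x by at most a.\<close>

definition avg :: "real \<Rightarrow> (real \<Rightarrow> real) \<Rightarrow> real \<Rightarrow> real" where
  "avg a u x = integral {0..a} (\<lambda>t. u (x - t)) / a"

definition diffq :: "real \<Rightarrow> (real \<Rightarrow> real) \<Rightarrow> real \<Rightarrow> real" where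
  "diffq a u x = (u x - u (x - a)) / a"

lemma avg_lin:
  assumes "bounded_lipschitz b L u" "bounded_lipschitz b' L' v"
  shows "avg a (\<lambda>x. c * u x + d * v x) = (\<lambda>x. c * avg a u x + d * avg a v x)"
proof
  fix x
  have "integral {0..a} (\<lambda>t. c * u (x - t) + d * v (x - t))
      = c * integral {0..a} (\<lambda>t. u (x - t)) + d * integral {0..a} (\<lambda>t. v (x - t))"
    using assms by (subst integral_add) (auto intro!: bounded_lipschitz_integrable integrable_on_mult_right)
  then show "avg a (\<lambda>x. c * u x + d * v x) x = c * avg a u x + d * avg a v x"
    unfolding avg_def by (simp add: add_divide_distrib)
qed

lemma avg_shift: "avg a (\<lambda>x. u (x + h)) = (\<lambda>x. avg a u (x + h))"
  unfolding avg_def by (simp add: algebra_simps)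

lemma avg_abs_le:
  assumes "bounded_lipschitz b L u" "a > 0" "\<And>t. 0 \<le> t \<Longrightarrow> t \<le> a \<Longrightarrow> \<bar>u (x - t)\<bar> \<le> B"
  shows "\<bar>avg a u x\<bar> \<le> B"
proof -
  have "norm (integral {0..a} (\<lambda>t. u (x - t))) \<le> B * (a - 0)"
    using assms by (intro integral_bound bounded_lipschitz_continuous[OF assms(1)]) auto
  then show ?thesis using assms unfolding avg_def by (simp add: field_simps)
qed

lemma bounded_lipschitz_const: "bounded_lipschitz \<bar>c\<bar> 0 (\<lambda>x. c)"
  unfolding bounded_lipschitz_def by simp

lemma avg_const: "a > 0 \<Longrightarrow> avg a (\<lambda>x. c) = (\<lambda>x. c)"
  unfolding avg_def by auto

lemma avg_dist_le:
  assumes "bounded_lipschitz b L u" "a > 0" "\<And>t. 0 \<le> t \<Longrightarrow> t \<le> a \<Longrightarrow> \<bar>u (x - t) - c\<bar> \<le> B"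
  shows "\<bar>avg a u x - c\<bar> \<le> B"
proof -
  have "avg a (\<lambda>x. 1 * u x + (-1) * c) x = avg a u x - c"
    using avg_lin[OF assms(1) bounded_lipschitz_const[of c], of a 1 "-1"] avg_const[OF assms(2), of c] by simp
  moreover have "\<bar>avg a (\<lambda>x. 1 * u x + (-1) * c) x\<bar> \<le> B"
    using assms by (intro avg_abs_le[OF bounded_lipschitz_lin[OF assms(1) bounded_lipschitz_const]]) auto
  ultimately show ?thesis by simp
qed

lemma avg_bounded_lipschitz:
  assumes "bounded_lipschitz b L u" "a > 0"
  shows "bounded_lipschitz b L (avg a u)"
  unfolding bounded_lipschitz_def
proof (intro conjI allI)
  fix x y
  show "\<bar>avg a u x\<bar> \<le> b"
    using assms by (intro avg_abs_le[OF assms]) (auto simp: bounded_lipschitz_def)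
  have "avg a (\<lambda>z. 1 * u z + (-1) * u (z + (y - x))) x = avg a u x - avg a u y"
    using avg_lin[OF assms(1) bounded_lipschitz_shift[OF assms(1), of "y - x"], of a 1 "-1"]
    by (simp add: avg_shift)
  moreover have "\<bar>avg a (\<lambda>z. 1 * u z + (-1) * u (z + (y - x))) x\<bar> \<le> L * \<bar>x - y\<bar>"
  proof (rule avg_abs_le[OF bounded_lipschitz_lin[OF assms(1) bounded_lipschitz_shift[OF assms(1)]] assms(2)])
    fix t
    have "\<bar>u (x - t) - u (x - t + (y - x))\<bar> \<le> L * \<bar>(x - t) - (x - t + (y - x))\<bar>"
      using assms(1) unfolding bounded_lipschitz_def by blast
    then show "\<bar>1 * u (x - t) + - 1 * u (x - t + (y - x))\<bar> \<le> L * \<bar>x - y\<bar>" by simp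
  qed
  ultimately show "\<bar>avg a u x - avg a u y\<bar> \<le> L * \<bar>x - y\<bar>" by simp
qed

lemma avg_close:
  assumes "bounded_lipschitz b L u" "a > 0"
  shows "\<bar>avg a u x - u x\<bar> \<le> L * a"
proof (rule avg_dist_le[OF assms])
  fix t assume t: "0 \<le> t" "t \<le> a"
  have "\<bar>u (x - t) - u x\<bar> \<le> L * \<bar>x - t - x\<bar>" using assms(1) unfolding bounded_lipschitz_def by blast
  also have "\<dots> \<le> L * a" using t bounded_lipschitz_nonneg[OF assms(1)] by (intro mult_left_mono) auto
  finally show "\<bar>u (x - t) - u x\<bar> \<le> L * a" .
qed

text \<open>The windows of the averages at x and x + h differ by two end pieces of length h, on
  which \<open>u\<close> differs from its values at x and x - a by at most L h. This is the
  fundamental theorem of calculus with a remainder that Lipschitz continuity suffices for.\<close>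

lemma avg_increment:
  assumes u: "bounded_lipschitz b L u" and "a > 0" "h \<ge> 0"
  shows "\<bar>avg a u (x + h) - avg a u x - h * diffq a u x\<bar> \<le> 2 * L / a * h\<^sup>2"
proof -
  define g where "g t = u (x - t)" for t
  have int: "g integrable_on {c..d}" for c d
    unfolding g_def by (rule bounded_lipschitz_integrable[OF u])
  have "integral {0..a} (\<lambda>t. u (x + h - t)) = integral {-h..a-h} g"
    using integral_shift_Icc_real[where a=0 and b=a and f=g and c="-h"] unfolding g_def comp_def by (simp add: algebra_simps)
  moreover have "integral {-h..0} g + integral {0..a} g = integral {-h..a} g"
    by (rule Henstock_Kurzweil_Integration.integral_combine) (use assms int[of "-h" a] in simp_all)
  moreover have "integral {-h..a-h} g + integral {a-h..a} g = integral {-h..a} g"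
    by (rule Henstock_Kurzweil_Integration.integral_combine) (use assms int[of "-h" a] in simp_all)
  moreover have e1: "\<bar>integral {-h..0} g - h * u x\<bar> \<le> L * h * h"
  proof -
    have "norm (integral {-h..0} (\<lambda>t. g t - u x)) \<le> L * h * (0 - (-h))"
    proof (rule integral_bound)
      show "continuous_on {-h..0} (\<lambda>t. g t - u x)"
        unfolding g_def by (intro continuous_intros bounded_lipschitz_continuous[OF u])
      fix t assume t: "t \<in> {-h..0}"
      have "\<bar>u (x - t) - u x\<bar> \<le> L * \<bar>x - t - x\<bar>" using u unfolding bounded_lipschitz_def by blast
      also have "\<dots> \<le> L * h" using t bounded_lipschitz_nonneg[OF u] by (intro mult_left_mono) auto
      finally show "norm (g t - u x) \<le> L * h" unfolding g_def by simp
    qed (use assms in auto)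
    moreover have "integral {-h..0} (\<lambda>t. g t - u x) = integral {-h..0} g - h * u x"
      by (subst integral_diff) (use int assms in \<open>auto intro: integrable_const_ivl\<close>)
    ultimately show ?thesis by simp
  qed
  moreover have e2: "\<bar>integral {a-h..a} g - h * u (x - a)\<bar> \<le> L * h * h"
  proof -
    have "norm (integral {a-h..a} (\<lambda>t. g t - u (x - a))) \<le> L * h * (a - (a - h))"
    proof (rule integral_bound)
      show "continuous_on {a-h..a} (\<lambda>t. g t - u (x - a))"
        unfolding g_def by (intro continuous_intros bounded_lipschitz_continuous[OF u])
      fix t assume t: "t \<in> {a-h..a}"
      have "\<bar>u (x - t) - u (x - a)\<bar> \<le> L * \<bar>x - t - (x - a)\<bar>" using u unfolding bounded_lipschitz_def by blast
      also have "\<dots> \<le> L * h" using t bounded_lipschitz_nonneg[OF u] by (intro mult_left_mono) auto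
      finally show "norm (g t - u (x - a)) \<le> L * h" unfolding g_def by simp
    qed (use assms in auto)
    moreover have "integral {a-h..a} (\<lambda>t. g t - u (x - a)) = integral {a-h..a} g - h * u (x - a)"
      by (subst integral_diff) (use int assms in \<open>auto intro: integrable_const_ivl\<close>)
    ultimately show ?thesis by simp
  qed
  moreover have "2 * L * h\<^sup>2 = L * h * h + L * h * h" "h * (u x - u (x - a)) = h * u x - h * u (x - a)"
    by (simp_all add: power2_eq_square right_diff_distrib)
  ultimately have "\<bar>integral {0..a} (\<lambda>t. u (x + h - t)) - integral {0..a} g - h * (u x - u (x - a))\<bar> \<le> 2 * L * h\<^sup>2"
    by linarith
  then have "\<bar>integral {0..a} (\<lambda>t. u (x + h - t)) - integral {0..a} g - h * (u x - u (x - a))\<bar> / a \<le> 2 * L * h\<^sup>2 / a"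
    using assms by (intro divide_right_mono) auto
  moreover have "avg a u (x + h) - avg a u x - h * diffq a u x
     = (integral {0..a} (\<lambda>t. u (x + h - t)) - integral {0..a} g - h * (u x - u (x - a))) / a"
    unfolding avg_def diffq_def g_def by (simp add: diff_divide_distrib right_diff_distrib)
  ultimately show ?thesis using assms by (simp add: abs_divide)
qed

lemma diffq_bounded_lipschitz:
  assumes "bounded_lipschitz b L u" "a > 0"
  shows "bounded_lipschitz (2 / a * b) (2 / a * L) (diffq a u)"
proof -
  have "bounded_lipschitz (\<bar>1/a\<bar> * b + \<bar>-1/a\<bar> * b) (\<bar>1/a\<bar> * L + \<bar>-1/a\<bar> * L) (\<lambda>x. 1/a * u x + (-1/a) * u (x + -a))"
    using assms by (intro bounded_lipschitz_lin bounded_lipschitz_shift)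
  then show ?thesis using assms by (simp add: diffq_def[abs_def] diff_divide_distrib)
qed

text \<open>For negative h the estimate is applied at x + h with increment -h; moving the difference
  quotient back to x costs the same amount once more, hence 4 in place of 2.\<close>

lemma avg_increment':
  assumes u: "bounded_lipschitz b L u" and "a > 0"
  shows "\<bar>avg a u (x + h) - avg a u x - h * diffq a u x\<bar> \<le> 4 * L / a * h\<^sup>2"
proof (cases "h \<ge> 0")
  case True
  have "2 * L / a * h\<^sup>2 \<le> 4 * L / a * h\<^sup>2"
    using assms(2) bounded_lipschitz_nonneg[OF u] by (intro mult_right_mono divide_right_mono) auto
  then show ?thesis using avg_increment[OF assms True, of x] by linarith
next
  case False
  have 1: "\<bar>avg a u x - avg a u (x + h) - (-h) * diffq a u (x + h)\<bar> \<le> 2 * L / a * h\<^sup>2"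
    using avg_increment[OF assms, of "-h" "x + h"] False by simp
  have "\<bar>diffq a u (x + h) - diffq a u x\<bar> \<le> 2 / a * L * \<bar>x + h - x\<bar>"
    using diffq_bounded_lipschitz[OF assms] unfolding bounded_lipschitz_def by blast
  then have "\<bar>h\<bar> * \<bar>diffq a u (x + h) - diffq a u x\<bar> \<le> \<bar>h\<bar> * (2 / a * L * \<bar>h\<bar>)"
    by (intro mult_left_mono) auto
  also have "\<dots> = 2 * L / a * h\<^sup>2" by (simp add: power2_eq_square abs_if)
  finally have 2: "\<bar>h * diffq a u (x + h) - h * diffq a u x\<bar> \<le> 2 * L / a * h\<^sup>2"
    by (simp add: abs_mult[symmetric] right_diff_distrib)
  have "4 * L / a * h\<^sup>2 = 2 * L / a * h\<^sup>2 + 2 * L / a * h\<^sup>2" by simp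
  then show ?thesis using 1 2 by linarith
qed

section \<open>Infinite iteration of averages\<close>

primrec avg_iter :: "(nat \<Rightarrow> real) \<Rightarrow> nat \<Rightarrow> nat \<Rightarrow> (real \<Rightarrow> real) \<Rightarrow> real \<Rightarrow> real" where
  "avg_iter a n 0 u = u"
| "avg_iter a n (Suc K) u = avg (a (n + K)) (avg_iter a n K u)"

text \<open>An infinite convolution of uniform densities. The start n is a parameter because each
  differentiation uses up the first remaining average.\<close>

definition avg_lim :: "(nat \<Rightarrow> real) \<Rightarrow> nat \<Rightarrow> (real \<Rightarrow> real) \<Rightarrow> real \<Rightarrow> real" where
  "avg_lim a n u x = lim (\<lambda>K. avg_iter a n K u x)"

text \<open>\<open>avg_iter\<close> adds its averages on the outside; here the first one is split
  off on the inside, where differentiation acts.\<close>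

lemma avg_iter_Suc': "avg_iter a n (Suc K) u = avg_iter a (Suc n) K (avg (a n) u)"
  by (induct K) auto

context
  fixes a :: "nat \<Rightarrow> real"
  assumes a_pos: "\<And>k. a k > 0" and a_summable: "summable a"
begin

lemma avg_iter_bounded_lipschitz: "bounded_lipschitz b L u \<Longrightarrow> bounded_lipschitz b L (avg_iter a n K u)"
  by (induct K) (auto intro: avg_bounded_lipschitz a_pos)

lemma avg_iter_lin:
  assumes "bounded_lipschitz b L u" "bounded_lipschitz b' L' v"
  shows "avg_iter a n K (\<lambda>x. c * u x + d * v x) = (\<lambda>x. c * avg_iter a n K u x + d * avg_iter a n K v x)"
  by (induct K)
    (auto simp: avg_lin[OF avg_iter_bounded_lipschitz[OF assms(1)] avg_iter_bounded_lipschitz[OF assms(2)]])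

lemma avg_iter_shift: "avg_iter a n K (\<lambda>x. u (x + h)) = (\<lambda>x. avg_iter a n K u (x + h))"
  by (induct K) (auto simp: avg_shift)

text \<open>The K-th averaging moves the value by at most \<open>L * a (n + K)\<close>, so the
  telescoping series converges with \<open>a\<close>.\<close>

lemma avg_lim_tendsto:
  assumes u: "bounded_lipschitz b L u"
  shows "(\<lambda>K. avg_iter a n K u x) \<longlonglongrightarrow> avg_lim a n u x"
proof -
  define d where "d K = avg_iter a n (Suc K) u x - avg_iter a n K u x" for K
  have "summable d"
  proof (rule summable_comparison_test')
    show "summable (\<lambda>K. L * a (K + n))"
      by (intro summable_mult summable_ignore_initial_segment a_summable)
    show "norm (d K) \<le> L * a (K + n)" if "K \<ge> 0" for K
      using avg_close[OF avg_iter_bounded_lipschitz[OF u, of n K] a_pos[of "n + K"], of x]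
      by (simp add: d_def add.commute[of K n])
  qed
  moreover have "u x + sum d {..<K} = avg_iter a n K u x" for K
    by (induct K) (auto simp: d_def)
  ultimately have "(\<lambda>K. avg_iter a n K u x) \<longlonglongrightarrow> u x + suminf d"
    using tendsto_add[OF tendsto_const summable_LIMSEQ, of d "u x"] by simp
  then show ?thesis unfolding avg_lim_def by (metis limI)
qed

lemma avg_lim_abs_le:
  assumes u: "bounded_lipschitz b L u" shows "\<bar>avg_lim a n u x\<bar> \<le> b"
proof (rule Lim_bounded[OF tendsto_rabs[OF avg_lim_tendsto[OF u]]])
  show "\<forall>K\<ge>0. \<bar>avg_iter a n K u x\<bar> \<le> b"
    using avg_iter_bounded_lipschitz[OF u] unfolding bounded_lipschitz_def by blast
qed

lemma avg_lim_lin: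
  assumes "bounded_lipschitz b L u" "bounded_lipschitz b' L' v"
  shows "avg_lim a n (\<lambda>x. c * u x + d * v x) x = c * avg_lim a n u x + d * avg_lim a n v x"
proof -
  have "(\<lambda>K. avg_iter a n K (\<lambda>x. c * u x + d * v x) x) \<longlonglongrightarrow> c * avg_lim a n u x + d * avg_lim a n v x"
    unfolding avg_iter_lin[OF assms] using avg_lim_tendsto assms by (intro tendsto_intros) auto
  then show ?thesis using avg_lim_tendsto[OF bounded_lipschitz_lin[OF assms]] LIMSEQ_unique by blast
qed

lemma avg_lim_shift: "avg_lim a n (\<lambda>x. u (x + h)) x = avg_lim a n u (x + h)"
  unfolding avg_lim_def avg_iter_shift ..

lemma avg_lim_Suc:
  assumes u: "bounded_lipschitz b L u"
  shows "avg_lim a n u x = avg_lim a (Suc n) (avg (a n) u) x"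
proof -
  have "(\<lambda>K. avg_iter a n (Suc K) u x) \<longlonglongrightarrow> avg_lim a n u x"
    using avg_lim_tendsto[OF u] by (rule LIMSEQ_Suc)
  then have "(\<lambda>K. avg_iter a (Suc n) K (avg (a n) u) x) \<longlonglongrightarrow> avg_lim a n u x"
    unfolding avg_iter_Suc' .
  moreover have "(\<lambda>K. avg_iter a (Suc n) K (avg (a n) u) x) \<longlonglongrightarrow> avg_lim a (Suc n) (avg (a n) u) x"
    by (rule avg_lim_tendsto[OF avg_bounded_lipschitz[OF u a_pos]])
  ultimately show ?thesis by (rule LIMSEQ_unique)
qed

text \<open>Each average looks back by its own length, hence K of them by the sum of the
  lengths.\<close>

lemma avg_iter_local_const:
  assumes u: "bounded_lipschitz b L u"
    and "\<And>y. x - (\<Sum>i<K. a (n + i)) \<le> y \<Longrightarrow> y \<le> x \<Longrightarrow> u y = c"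
  shows "avg_iter a n K u x = c"
  using assms(2)
proof (induct K arbitrary: x)
  case (Suc K)
  have "\<bar>avg (a (n + K)) (avg_iter a n K u) x - c\<bar> \<le> 0"
  proof (rule avg_dist_le[OF avg_iter_bounded_lipschitz[OF u] a_pos])
    fix t assume t: "0 \<le> t" "t \<le> a (n + K)"
    have "avg_iter a n K u (x - t) = c"
      using t by (intro Suc.hyps Suc.prems) auto
    then show "\<bar>avg_iter a n K u (x - t) - c\<bar> \<le> 0" by simp
  qed
  then show ?case by simp
qed simp

lemma avg_lim_local_const:
  assumes u: "bounded_lipschitz b L u" and "\<And>y. x - suminf a \<le> y \<Longrightarrow> y \<le> x \<Longrightarrow> u y = c"
  shows "avg_lim a 0 u x = c"
proof -
  have "avg_iter a 0 K u x = c" for K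
  proof (rule avg_iter_local_const[OF u])
    fix y assume "x - (\<Sum>i<K. a (0 + i)) \<le> y" "y \<le> x"
    moreover have "(\<Sum>i<K. a i) \<le> suminf a"
      using a_summable a_pos by (intro sum_le_suminf) (auto simp: less_imp_le)
    ultimately show "u y = c" using assms(2) by simp
  qed
  then show ?thesis using avg_lim_tendsto[OF u, of 0 x] by (simp add: LIMSEQ_const_iff)
qed

text \<open>The limit operator is linear, translation invariant and does not increase sup norms, so
  the quadratic remainder of the first average passes through all the later ones.\<close>

lemma avg_lim_deriv:
  assumes u: "bounded_lipschitz b L u"
  shows "(avg_lim a n u has_vector_derivative avg_lim a (Suc n) (diffq (a n) u) x) (at x)"
proof (rule has_vector_derivative_quadratic)
  fix h :: real
  let ?v = "avg (a n) u" and ?d = "diffq (a n) u"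
  let ?w = "\<lambda>x. 1 * (1 * ?v (x + h) + (-1) * ?v x) + (-h) * ?d x"
  note v = avg_bounded_lipschitz[OF u a_pos[of n]]
  note vh = bounded_lipschitz_shift[OF v, of h]
  note d = diffq_bounded_lipschitz[OF u a_pos[of n]]
  note l = bounded_lipschitz_lin[OF vh v, of 1 "-1"]
  note w = bounded_lipschitz_lin[OF l d, of 1 "-h"]
  have "\<bar>?w x\<bar> \<le> 4 * L / a n * h\<^sup>2" for x
    using avg_increment'[OF u a_pos[of n], of x h] by simp
  \<comment> \<open>\<open>w\<close> bounds the remainder only by a sum of separate suprema; its
    bound is replaced by the quadratic one, with the Lipschitz constant left unspecified.\<close>
  then obtain L' where w': "bounded_lipschitz (4 * L / a n * h\<^sup>2) L' ?w"
    using w unfolding bounded_lipschitz_def by blast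
  have "avg_lim a (Suc n) ?w x
      = avg_lim a (Suc n) ?v (x + h) - avg_lim a (Suc n) ?v x - h * avg_lim a (Suc n) ?d x"
    unfolding avg_lim_lin[OF l d] avg_lim_lin[OF vh v] avg_lim_shift by simp
  then show "norm (avg_lim a n u (x + h) - avg_lim a n u x - h *\<^sub>R avg_lim a (Suc n) ?d x)
      \<le> 4 * L / a n * h\<^sup>2"
    using avg_lim_abs_le[OF w', of "Suc n" x] unfolding avg_lim_Suc[OF u] by simp
qed

primrec diffq_iter :: "nat \<Rightarrow> (real \<Rightarrow> real) \<Rightarrow> real \<Rightarrow> real" where
  "diffq_iter 0 u = u"
| "diffq_iter (Suc k) u = diffq (a k) (diffq_iter k u)"

lemma diffq_iter_bounded_lipschitz:
  assumes "bounded_lipschitz b L u"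
  shows "bounded_lipschitz ((\<Prod>i<k. 2 / a i) * b) ((\<Prod>i<k. 2 / a i) * L) (diffq_iter k u)"
proof (induct k)
  case (Suc k)
  show ?case using diffq_bounded_lipschitz[OF Suc a_pos[of k]] by (simp add: algebra_simps)
qed (use assms in simp)

lemma exists_iterated_average_cutoff:
  "\<exists>(\<theta> :: nat \<Rightarrow> real \<Rightarrow> real) R. (\<forall>k x. (\<theta> k has_vector_derivative \<theta> (Suc k) x) (at x)) \<and>
    (\<forall>x. \<bar>x\<bar> \<le> 1 \<longrightarrow> \<theta> 0 x = 1) \<and> (\<forall>x. \<bar>x\<bar> \<ge> R \<longrightarrow> \<theta> 0 x = 0) \<and> (\<forall>k x. \<bar>\<theta> k x\<bar> \<le> (\<Prod>i<k. 2 / a i))"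
proof -
  define S where "S = suminf a"
  have S: "S \<ge> 0" unfolding S_def using a_summable a_pos by (intro suminf_nonneg) (auto simp: less_imp_le)
  \<comment> \<open>A trapezoid equal to 1 for |x| \<le> 1 + S and to 0 for |x| \<ge> 2 + S. The
    averages look back by S at most, which leaves the value 1 on [-1,1] and 0 from 2 + 2 S
    on.\<close>
  define u where "u x = max 0 (min 1 (2 + S - \<bar>x\<bar>))" for x :: real
  have "\<bar>max 0 (min 1 p) - max 0 (min 1 q)\<bar> \<le> \<bar>p - q\<bar>" for p q :: real by linarith
  then have "\<bar>u x - u y\<bar> \<le> \<bar>(2 + S - \<bar>x\<bar>) - (2 + S - \<bar>y\<bar>)\<bar>" for x y unfolding u_def .
  then have "\<bar>u x - u y\<bar> \<le> \<bar>x - y\<bar>" for x y by (smt (verit))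
  then have u: "bounded_lipschitz 1 1 u" unfolding bounded_lipschitz_def by (auto simp: u_def)
  define \<theta> where "\<theta> k = avg_lim a k (diffq_iter k u)" for k
  note bl = diffq_iter_bounded_lipschitz[OF u]
  have "(\<theta> k has_vector_derivative \<theta> (Suc k) x) (at x)" for k x
    unfolding \<theta>_def using avg_lim_deriv[OF bl[of k], of k x] by simp
  moreover have "\<theta> 0 x = 1" if "\<bar>x\<bar> \<le> 1" for x
    unfolding \<theta>_def diffq_iter.simps(1)
    by (rule avg_lim_local_const[OF u]) (use that S in \<open>auto simp: u_def S_def[symmetric]\<close>)
  moreover have "\<theta> 0 x = 0" if "\<bar>x\<bar> \<ge> 2 + 2 * S" for x
    unfolding \<theta>_def diffq_iter.simps(1)
    by (rule avg_lim_local_const[OF u]) (use that S in \<open>auto simp: u_def S_def[symmetric]\<close>)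
  moreover have "\<bar>\<theta> k x\<bar> \<le> (\<Prod>i<k. 2 / a i)" for k x
    unfolding \<theta>_def using avg_lim_abs_le[OF bl[of k], of k x] by simp
  ultimately show ?thesis by blast
qed

end

text \<open>Since r_k = t_k - t_(k+1), the terms are at most 2 (sqrt t_k - sqrt t_(k+1)) and
  telescope. The outcome is a summable sequence larger than \<open>r\<close> by factors that tend to
  infinity.\<close>

lemma summable_divide_sqrt_tail:
  fixes r :: "nat \<Rightarrow> real"
  assumes "\<And>k. r k > 0" "summable r"
  defines "t \<equiv> \<lambda>k. suminf r - sum r {..<k}"
  shows "summable (\<lambda>k. r k / sqrt (t k))" "t \<longlonglongrightarrow> 0" "\<And>k. t k > 0"
proof -
  show t: "t k > 0" for k unfolding t_def using sum_less_suminf[OF assms(2), of k] assms(1) by simp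
  have "t \<longlonglongrightarrow> suminf r - suminf r"
    unfolding t_def by (intro tendsto_intros summable_LIMSEQ assms(2))
  then show "t \<longlonglongrightarrow> 0" by simp
  have le: "r k / sqrt (t k) \<le> 2 * (sqrt (t k) - sqrt (t (Suc k)))" for k
  proof -
    have rk: "r k = t k - t (Suc k)" unfolding t_def by simp
    have "t (Suc k) \<le> t k" using assms(1)[of k] rk by linarith
    then have le: "sqrt (t (Suc k)) \<le> sqrt (t k)" by simp
    have "r k = (sqrt (t k) - sqrt (t (Suc k))) * (sqrt (t k) + sqrt (t (Suc k)))"
      using t[of k] t[of "Suc k"] rk by (simp add: algebra_simps)
    also have "\<dots> \<le> (sqrt (t k) - sqrt (t (Suc k))) * (2 * sqrt (t k))"
      using le by (intro mult_left_mono) auto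
    finally show ?thesis by (subst pos_divide_le_eq) (use t[of k] in \<open>simp_all add: algebra_simps\<close>)
  qed
  show "summable (\<lambda>k. r k / sqrt (t k))"
  proof (rule summableI_nonneg_bounded)
    show "0 \<le> r k / sqrt (t k)" for k using assms(1)[of k] t[of k] by (simp add: less_imp_le)
    have "(\<Sum>k<n. r k / sqrt (t k)) \<le> 2 * (sqrt (t 0) - sqrt (t n))" for n
    proof (induct n)
      case (Suc n)
      then show ?case using le[of n] by simp
    qed simp
    moreover have "2 * (sqrt (t 0) - sqrt (t n)) \<le> 2 * sqrt (t 0)" for n using t[of n] by simp
    ultimately show "(\<Sum>k<n. r k / sqrt (t k)) \<le> 2 * sqrt (t 0)" for n by (meson order_trans)
  qed
qed

section \<open>Cut-offs adapted to the weight sequence\<close>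

context weights
begin

text \<open>With a_k = r_k / sqrt t_k the factor 2 / a_k equals 2 sqrt t_k M_(k+1) / M_k. The
  quotients multiply to M_k, and the null sequence t_k supplies h^k for every h at once; lengths
  proportional to r_k would only reach a fixed scale.\<close>

lemma exists_cutoff_1d:
  "\<exists>(\<theta> :: nat \<Rightarrow> real \<Rightarrow> real) R. (\<forall>k x. (\<theta> k has_vector_derivative \<theta> (Suc k) x) (at x)) \<and>
    (\<forall>x. \<bar>x\<bar> \<le> 1 \<longrightarrow> \<theta> 0 x = 1) \<and> (\<forall>x. \<bar>x\<bar> \<ge> R \<longrightarrow> \<theta> 0 x = 0) \<and>
    (\<forall>h>0. \<exists>A. \<forall>k x. \<bar>\<theta> k x\<bar> \<le> A * h ^ k * M k)"
proof -
  define r where "r k = M k / M (Suc k)" for k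
  have r: "r k > 0" for k unfolding r_def by simp
  have rs: "summable r" using M_ratio_summable unfolding r_def .
  define t where "t k = suminf r - sum r {..<k}" for k
  note tail = summable_divide_sqrt_tail[OF r rs, folded t_def]
  define a where "a k = r k / sqrt (t k)" for k
  have a: "a k > 0" for k unfolding a_def using r tail(3) by simp
  have as: "summable a" using tail(1) unfolding a_def .
  obtain \<theta> R where \<theta>: "\<forall>k x. (\<theta> k has_vector_derivative \<theta> (Suc k) x) (at x)"
    "\<forall>x. \<bar>x\<bar> \<le> 1 \<longrightarrow> \<theta> 0 x = 1" "\<forall>x. \<bar>x\<bar> \<ge> R \<longrightarrow> \<theta> 0 x = 0" "\<forall>k x. \<bar>\<theta> k x\<bar> \<le> (\<Prod>i<k. 2 / a i)"
    using exists_iterated_average_cutoff[of a, OF a as] by blast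
  have "\<exists>A. \<forall>k x. \<bar>\<theta> k x\<bar> \<le> A * h ^ k * M k" if h: "h > 0" for h
  proof -
    define b where "b i = 2 * sqrt (t i) / h" for i
    have "b \<longlonglongrightarrow> 2 * sqrt 0 / h" unfolding b_def using tail(2) h by (intro tendsto_intros) auto
    moreover have "b i \<ge> 0" for i unfolding b_def using h tail(3)[of i] by (simp add: less_imp_le)
    ultimately obtain C where C: "C > 0" "\<And>n. (\<Prod>i<n. b i) \<le> C" using prod_bounded_of_tendsto_0[of b] by auto
    have e: "(\<Prod>i<k. 2 / a i) = (\<Prod>i<k. b i) * h ^ k * M k" for k
    proof (induct k)
      case (Suc k)
      have "2 / a k = b k * h * M (Suc k) / M k"
        using h M_pos[of k] M_pos[of "Suc k"] tail(3)[of k] by (simp add: b_def a_def r_def)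
      then have "(\<Prod>i<Suc k. 2 / a i) = ((\<Prod>i<k. b i) * h ^ k * M k) * (b k * h * M (Suc k) / M k)"
        using Suc by simp
      also have "\<dots> = (\<Prod>i<Suc k. b i) * h ^ Suc k * M (Suc k)"
        using M_pos[of k] by simp
      finally show ?case .
    qed simp
    have "\<bar>\<theta> k x\<bar> \<le> C * h ^ k * M k" for k x
    proof -
      have "\<bar>\<theta> k x\<bar> \<le> (\<Prod>i<k. b i) * h ^ k * M k" using \<theta>(4) e by simp
      also have "\<dots> \<le> C * h ^ k * M k" using C(2)[of k] h by (intro mult_right_mono) auto
      finally show ?thesis .
    qed
    then show ?thesis by blast
  qed
  then show ?thesis using \<theta>(1-3) by blast
qed

lemma pbound_prod:
  fixes f :: "'i \<Rightarrow> real^'n::finite \<Rightarrow> complex"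
  assumes "finite I" "\<And>i. i \<in> I \<Longrightarrow> smooth_fun (f i)" "\<And>i. i \<in> I \<Longrightarrow> pbound M (f i) x A h" "h \<ge> 0"
  shows "pbound M (\<lambda>x. \<Prod>i\<in>I. f i x) x (A ^ card I) (real (card I) * h)"
  using assms(1-3)
proof (induct I rule: finite_induct)
  case empty
  show ?case
    unfolding pbound_def using Dl_const_open[OF open_UNIV, of "\<lambda>x. 1" 1 x] by simp
next
  case (insert i I)
  have "pbound M (\<lambda>x. f i x * (\<Prod>i\<in>I. f i x)) x (A * A ^ card I) (h + real (card I) * h)"
    using insert assms(4) by (intro pbound_mult smooth_prod) auto
  then show ?case using insert by (simp add: algebra_simps)
qed

definition cutoffs :: "(nat \<Rightarrow> real^'n::finite \<Rightarrow> complex) \<Rightarrow> bool" where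
  "cutoffs \<kappa> \<longleftrightarrow> (\<forall>n. smooth_fun (\<kappa> n) \<and> bounded {x. \<kappa> n x \<noteq> 0}) \<and>
    (\<forall>n x. norm x \<le> real (Suc n) \<longrightarrow> \<kappa> n x = 1) \<and> (\<forall>h>0. \<exists>A. \<forall>n x. pbound M (\<kappa> n) x A h)"

lemma exists_cutoffs: "\<exists>\<kappa> :: nat \<Rightarrow> (real, 'n::finite) vec \<Rightarrow> complex. cutoffs \<kappa>"
proof -
  obtain \<theta> R where \<theta>: "\<forall>k x. (\<theta> k has_vector_derivative \<theta> (Suc k) x) (at x)"
    "\<forall>x::real. \<bar>x\<bar> \<le> 1 \<longrightarrow> \<theta> 0 x = (1::real)" "\<forall>x. \<bar>x\<bar> \<ge> R \<longrightarrow> \<theta> 0 x = 0"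
    "\<forall>h>0. \<exists>A. \<forall>k x. \<bar>\<theta> k x\<bar> \<le> A * h ^ k * M k" using exists_cutoff_1d by blast
  \<comment> \<open>A family closed under partial derivatives: direction j divides the coefficient c
    by r, every other direction sets it to 0. For r \<ge> 1 the coefficient stays within 1, so
    dilation does not worsen the bounds.\<close>
  define g where "g m c r j x = complex_of_real (c * \<theta> m (x $ j / r))" for m c r and j :: 'n and x :: "real^'n"
  have gd: "has_pdir k (g m c r j) (g (Suc m) (if k = j then c / r else 0) r j)" for m c r j k
    unfolding has_pdir_def
  proof
    fix x :: "real^'n"
    have "((\<lambda>t. (x + t *\<^sub>R axis k 1) $ j / r) has_vector_derivative (if k = j then 1 / r else 0)) (at 0)"
      by (auto simp: axis_def divide_inverse has_real_derivative_iff_has_vector_derivative[symmetric]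
          intro!: derivative_eq_intros)
    moreover have "(\<theta> m has_vector_derivative \<theta> (Suc m) (x $ j / r)) (at ((x + 0 *\<^sub>R axis k 1) $ j / r))"
      using \<theta>(1) by simp
    ultimately have "((\<lambda>t. \<theta> m ((x + t *\<^sub>R axis k 1) $ j / r)) has_vector_derivative
        (if k = j then 1 / r else 0) * \<theta> (Suc m) (x $ j / r)) (at 0)"
      using vector_diff_chain_at[of "\<lambda>t. (x + t *\<^sub>R axis k 1) $ j / r" "if k = j then 1 / r else 0" 0 "\<theta> m"
          "\<theta> (Suc m) (x $ j / r)"] by (simp add: comp_def)
    then have "((\<lambda>t. c * \<theta> m ((x + t *\<^sub>R axis k 1) $ j / r)) has_vector_derivative
        c * ((if k = j then 1 / r else 0) * \<theta> (Suc m) (x $ j / r))) (at 0)"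
      by (intro has_vector_derivative_mult_right)
    from has_vector_derivative_of_real[OF this[folded has_real_derivative_iff_has_vector_derivative]]
    show "((\<lambda>t. g m c r j (x + t *\<^sub>R axis k 1)) has_vector_derivative
        g (Suc m) (if k = j then c / r else 0) r j x) (at 0)"
      unfolding g_def by (cases "k = j") simp_all
  qed
  have gs: "smooth_fun (g m c r j)" for m c r j
  proof (rule smooth_coinduct[of _ "{g m c r j |m c. True}"])
    fix f assume f: "f \<in> {g m c r j |m c. True}"
    then show "\<exists>h\<in>{g m c r j |m c. True}. has_pdir k f h" for k using gd by blast
    have "continuous_on UNIV (\<theta> m)" for m
      using \<theta>(1) by (meson continuous_at_imp_continuous_on differentiable_imp_continuous_within differentiableI_vector)
    then have "continuous_on UNIV (\<lambda>x::real^'n. \<theta> m (x $ j / r))" for m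
      by (rule continuous_on_compose2) (auto intro!: continuous_intros simp: divide_inverse)
    then show "continuous_on UNIV f" using f unfolding g_def by (auto intro!: continuous_intros)
  qed auto
  have gD: "\<exists>c. \<bar>c\<bar> \<le> 1 \<and> Dl js (g 0 1 r j) = g (length js) c r j" if "r \<ge> 1" for r j js
  proof (induct js)
    case (Cons k js)
    then obtain c where c: "\<bar>c\<bar> \<le> 1" "Dl js (g 0 1 r j) = g (length js) c r j" by blast
    then have "Dl (k # js) (g 0 1 r j) = g (length (k # js)) (if k = j then c / r else 0) r j"
      using has_pdir_imp_pdir[OF gd] by simp
    moreover have "\<bar>if k = j then c / r else 0\<bar> \<le> 1"
      using c that by (auto simp: divide_le_eq)
    ultimately show ?case by blast
  qed (auto intro: exI[of _ 1])
  have gb: "pbound M (g 0 1 r j) x A h" if r: "r \<ge> 1" and A: "\<forall>k x. \<bar>\<theta> k x\<bar> \<le> A * h ^ k * M k" for r j x A h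
    unfolding pbound_def
  proof
    fix js
    obtain c where c: "\<bar>c\<bar> \<le> 1" "Dl js (g 0 1 r j) = g (length js) c r j" using gD[OF r] by blast
    have "cmod (Dl js (g 0 1 r j) x) = \<bar>c\<bar> * \<bar>\<theta> (length js) (x $ j / r)\<bar>"
      unfolding c g_def by (simp add: norm_mult)
    also have "\<dots> \<le> 1 * (A * h ^ length js * M (length js))"
      using c A by (intro mult_mono) auto
    finally show "cmod (Dl js (g 0 1 r j) x) \<le> A * h ^ length js * M (length js)" by simp
  qed
  define \<kappa> where "\<kappa> n x = (\<Prod>j\<in>UNIV. g 0 1 (real (Suc n)) j x)" for n x
  have \<kappa>s: "smooth_fun (\<kappa> n)" for n unfolding \<kappa>_def by (intro smooth_prod gs)
  have \<kappa>b: "\<exists>A. \<forall>n x. pbound M (\<kappa> n) x A h" if h: "h > 0" for h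
  proof -
    \<comment> \<open>Scales add up in a product, so each of the \<open>CARD('n)\<close> factors
      gets an equal share of h.\<close>
    obtain A where A: "\<forall>k x. \<bar>\<theta> k x\<bar> \<le> A * (h / CARD('n)) ^ k * M k" using \<theta>(4) h by (metis divide_pos_pos of_nat_0_less_iff zero_less_card_finite)
    have "pbound M (\<kappa> n) x (A ^ CARD('n)) (CARD('n) * (h / CARD('n)))" for n x
      unfolding \<kappa>_def using h by (intro pbound_prod gs gb A) auto
    then show ?thesis by auto
  qed
  have "\<kappa> n x = 1" if "norm x \<le> real (Suc n)" for n x
  proof -
    have "\<bar>x $ j / real (Suc n)\<bar> \<le> 1" for j
      using component_le_norm_cart[of x j] that by (simp add: divide_le_eq)
    then show ?thesis unfolding \<kappa>_def g_def using \<theta>(2) by simp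
  qed
  moreover have "bounded {x. \<kappa> n x \<noteq> 0}" for n
  proof -
    have "norm x \<le> (\<Sum>j\<in>(UNIV::'n set). R * real (Suc n))" if "\<kappa> n x \<noteq> 0" for x
    proof -
      have "\<bar>x $ j\<bar> \<le> R * real (Suc n)" for j
      proof (rule ccontr)
        assume "\<not> \<bar>x $ j\<bar> \<le> R * real (Suc n)"
        then have "\<bar>x $ j / real (Suc n)\<bar> \<ge> R" by (simp add: pos_le_divide_eq)
        then have "g 0 1 (real (Suc n)) j x = 0" unfolding g_def using \<theta>(3) by simp
        then show False using that unfolding \<kappa>_def by (metis UNIV_I finite prod_zero)
      qed
      then show ?thesis using norm_le_l1_cart[of x] by (meson order_trans sum_mono)
    qed
    then show ?thesis unfolding bounded_iff by blast
  qed
  ultimately show ?thesis using \<kappa>b \<kappa>s unfolding cutoffs_def by (intro exI[of _ \<kappa>]) blast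
qed

end

section \<open>Test function spaces and their duals\<close>

definition lin_closed :: "('a \<Rightarrow> complex) set \<Rightarrow> bool" where
  "lin_closed V \<longleftrightarrow> (\<lambda>x. 0) \<in> V \<and> (\<forall>f\<in>V. \<forall>g\<in>V. \<forall>a b. (\<lambda>x. a * f x + b * g x) \<in> V)"

lemma lin_on_zero:
  assumes "lin_on V S" "lin_closed V" shows "S (\<lambda>x. 0) = 0"
proof -
  have z: "(\<lambda>x. 0) \<in> V" using assms(2) unfolding lin_closed_def by blast
  show ?thesis using assms(1)[unfolded lin_on_def, rule_format, OF z z, of 0 0] by simp
qed

lemma lin_on_cmult:
  assumes "lin_on V S" "lin_closed V" "f \<in> V"
  shows "S (\<lambda>x. c * f x) = c * S f" "(\<lambda>x. c * f x) \<in> V"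
proof -
  have "S (\<lambda>x. c * f x + 0 * f x) = c * S f + 0 * S f" "(\<lambda>x. c * f x + 0 * f x) \<in> V"
    using assms unfolding lin_on_def lin_closed_def by blast+
  then show "S (\<lambda>x. c * f x) = c * S f" "(\<lambda>x. c * f x) \<in> V" by simp_all
qed

lemma lin_on_add:
  assumes "lin_on V S" "lin_closed V" "f \<in> V" "g \<in> V"
  shows "S (\<lambda>x. f x + g x) = S f + S g" "(\<lambda>x. f x + g x) \<in> V"
proof -
  have "S (\<lambda>x. 1 * f x + 1 * g x) = 1 * S f + 1 * S g" "(\<lambda>x. 1 * f x + 1 * g x) \<in> V"
    using assms unfolding lin_on_def lin_closed_def by blast+
  then show "S (\<lambda>x. f x + g x) = S f + S g" "(\<lambda>x. f x + g x) \<in> V" by simp_all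
qed

lemma lin_on_diff:
  assumes "lin_on V S" "lin_closed V" "f \<in> V" "g \<in> V"
  shows "S (\<lambda>x. f x - g x) = S f - S g" "(\<lambda>x. f x - g x) \<in> V"
proof -
  have "S (\<lambda>x. 1 * f x + (-1) * g x) = 1 * S f + (-1) * S g" "(\<lambda>x. 1 * f x + (-1) * g x) \<in> V"
    using assms unfolding lin_on_def lin_closed_def by blast+
  then show "S (\<lambda>x. f x - g x) = S f - S g" "(\<lambda>x. f x - g x) \<in> V" by simp_all
qed

lemma lin_on_sum:
  assumes "lin_on V S" "lin_closed V" "finite I" "\<And>i. i \<in> I \<Longrightarrow> f i \<in> V"
  shows "S (\<lambda>x. \<Sum>i\<in>I. f i x) = (\<Sum>i\<in>I. S (f i))" "(\<lambda>x. \<Sum>i\<in>I. f i x) \<in> V"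
proof -
  have "S (\<lambda>x. \<Sum>i\<in>I. f i x) = (\<Sum>i\<in>I. S (f i)) \<and> (\<lambda>x. \<Sum>i\<in>I. f i x) \<in> V"
    using assms(3,4)
  proof (induct I rule: finite_induct)
    case empty
    then show ?case using lin_on_zero[OF assms(1,2)] assms(2) unfolding lin_closed_def by simp
  next
    case (insert i I)
    then have i: "f i \<in> V" and I: "S (\<lambda>x. \<Sum>i\<in>I. f i x) = (\<Sum>i\<in>I. S (f i))" "(\<lambda>x. \<Sum>i\<in>I. f i x) \<in> V" by auto
    show ?case using lin_on_add[OF assms(1,2) i I(2)] I(1) insert by simp
  qed
  then show "S (\<lambda>x. \<Sum>i\<in>I. f i x) = (\<Sum>i\<in>I. S (f i))" "(\<lambda>x. \<Sum>i\<in>I. f i x) \<in> V" by auto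
qed

lemma Dl_zero: "Dl js (\<lambda>x. 0) x = 0"
  using Dl_const_open[OF open_UNIV, of "\<lambda>x. 0" 0 x js] by (auto split: if_splits)

section \<open>Multipliers, tempered functionals and density\<close>

context weights
begin

lemma pbound_const: "h \<ge> 0 \<Longrightarrow> pbound M (\<lambda>x. c) x (cmod c) h"
  unfolding pbound_def using Dl_const_open[OF open_UNIV, of "\<lambda>x. c" c x] by simp

lemma pbound_outside_support:
  assumes "x \<notin> closure {x. f x \<noteq> 0}" "a \<ge> 0" "h \<ge> 0"
  shows "pbound M f x a h"
  unfolding pbound_def
proof
  fix js
  have "Dl js f x = (if js = [] then 0 else 0)"
  proof (rule Dl_const_open[OF open_Compl[OF closed_closure]])
    show "f y = 0" if "y \<in> - closure {x. f x \<noteq> 0}" for y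
      using that closure_subset[of "{x. f x \<noteq> 0}"] by auto
    show "x \<in> - closure {x. f x \<noteq> 0}" using assms(1) by simp
  qed
  then show "cmod (Dl js f x) \<le> a * h ^ length js * M (length js)" using assms by simp
qed

lemma SB_imp_pbound:
  assumes "SB M h A \<phi>" shows "pbound M \<phi> x A h"
  using assms[unfolded SB_iff_pbound, rule_format, of x 0] by simp

text \<open>On a support of radius R the constant 1 is at most e^R e^(-|x|), and off the closed
  support all derivatives vanish; exponential decay therefore comes for free.\<close>

lemma SB_of_Dbound:
  assumes "bounded {x. \<phi> x \<noteq> 0}" "Dbound M h A \<phi>" "h > 0"
  shows "\<exists>B. SB M h B \<phi>"
proof -
  have "bounded (closure {x. \<phi> x \<noteq> 0})" using assms(1) by (rule bounded_closure)
  then obtain R where R: "\<And>x. x \<in> closure {x. \<phi> x \<noteq> 0} \<Longrightarrow> norm x \<le> R" unfolding bounded_iff by blast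
  have A: "A \<ge> 0" using assms(2) pbound_nonneg[of M \<phi> undefined A h] unfolding Dbound_iff_pbound by simp
  have "pbound M \<phi> x ((A * exp R) * exp (- 1 * norm x)) h" for x
  proof (cases "x \<in> closure {x. \<phi> x \<noteq> 0}")
    case True
    have "A * 1 \<le> A * exp (R - norm x)" using R[OF True] A by (intro mult_left_mono) auto
    then have "A \<le> (A * exp R) * exp (- 1 * norm x)" by (simp add: exp_diff exp_minus field_simps)
    then show ?thesis using assms A pbound_mono[of M \<phi> x A h _ h] unfolding Dbound_iff_pbound by auto
  next
    case False
    then show ?thesis using A assms(3) by (intro pbound_outside_support) auto
  qed
  then show ?thesis using SB_of_expdecay[of 1 h] assms(3) by (metis zero_less_one)
qed

lemma Dtest_subset_Stest: "Dtest s M \<subseteq> Stest s M"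
proof
  fix \<phi> :: "real^'n::finite \<Rightarrow> complex" assume \<phi>: "\<phi> \<in> Dtest s M"
  then have b: "bounded {x. \<phi> x \<noteq> 0}" unfolding Dtest_iff by simp
  show "\<phi> \<in> Stest s M" unfolding Stest_iff
  proof
    show "smooth_fun \<phi>" using \<phi> unfolding Dtest_iff by simp
    show "class_quant s (\<lambda>h. \<exists>A. SB M h A \<phi>)"
      by (rule class_quant_scale[of s "\<lambda>h. \<exists>A. Dbound M h A \<phi>" 1])
        (use \<phi> SB_of_Dbound[OF b] in \<open>auto simp: Dtest_iff\<close>)
  qed
qed

lemma lin_closed_Stest: "lin_closed (Stest s M :: (real^'n::finite \<Rightarrow> complex) set)"
  unfolding lin_closed_def
proof (intro conjI ballI allI)
  have "SB M h 0 (\<lambda>x::real^'n. 0)" for h unfolding SB_def by (simp add: Dl_zero)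
  then show "(\<lambda>x::real^'n. 0) \<in> Stest s M"
    unfolding Stest_iff by (auto intro!: class_quant_all smooth_const)
  fix f g :: "real^'n \<Rightarrow> complex" and a b assume "f \<in> Stest s M" "g \<in> Stest s M"
  then have f: "smooth_fun f" "class_quant s (\<lambda>h. \<exists>A. SB M h A f)"
    and g: "smooth_fun g" "class_quant s (\<lambda>h. \<exists>A. SB M h A g)" unfolding Stest_iff by auto
  have "class_quant s (\<lambda>h. (\<exists>A. SB M h A f) \<and> (\<exists>A. SB M h A g))"
    using f(2) g(2) by (rule class_quant_conj) (meson SB_mono less_imp_le order_refl)+
  then have "class_quant s (\<lambda>h. \<exists>A. SB M h A (\<lambda>x. a * f x + b * g x))"
  proof (rule class_quant_scale[where c=1])
    fix h assume "(\<exists>A. SB M h A f) \<and> (\<exists>A. SB M h A g)"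
    then obtain A B where "SB M h A f" "SB M h B g" by blast
    then have "SB M h (cmod a * A + cmod b * B) (\<lambda>x. a * f x + b * g x)"
      by (intro SB_add SB_cmult smooth_cmult f g)
    then show "\<exists>A. SB M (1 * h) A (\<lambda>x. a * f x + b * g x)" by auto
  qed simp
  then show "(\<lambda>x. a * f x + b * g x) \<in> Stest s M"
    unfolding Stest_iff using f g by (auto intro: smooth_add smooth_cmult)
qed

lemma Dtest_smooth_bounded: "\<phi> \<in> Dtest s M \<Longrightarrow> smooth_fun \<phi> \<and> bounded {x. \<phi> x \<noteq> 0}"
  unfolding Dtest_iff by simp

text \<open>On bounded supports the weight in x is harmless, in one direction by
  \<open>SB_of_Dbound\<close> and in the other by taking q = 0. Linear closure and cutting off then
  carry over from the larger space.\<close>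

lemma Dtest_iff_Stest: "\<phi> \<in> Dtest s M \<longleftrightarrow> \<phi> \<in> Stest s M \<and> bounded {x. \<phi> x \<noteq> 0}"
proof
  assume "\<phi> \<in> Stest s M \<and> bounded {x. \<phi> x \<noteq> 0}"
  then have "smooth_fun \<phi>" "class_quant s (\<lambda>h. \<exists>A. SB M h A \<phi>)" "bounded {x. \<phi> x \<noteq> 0}"
    unfolding Stest_iff by auto
  moreover from this(2) have "class_quant s (\<lambda>h. \<exists>A. Dbound M h A \<phi>)"
    by (rule class_quant_scale[where c=1], simp, unfold Dbound_iff_pbound mult_1, use SB_imp_pbound in blast)
  ultimately show "\<phi> \<in> Dtest s M" unfolding Dtest_iff by simp
qed (use Dtest_subset_Stest Dtest_smooth_bounded in blast)

lemma lin_closed_Dtest: "lin_closed (Dtest s M :: (real^'n::finite \<Rightarrow> complex) set)"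
  unfolding lin_closed_def
proof (intro conjI ballI allI)
  have st: "lin_closed (Stest s M :: (real^'n \<Rightarrow> complex) set)" by (rule lin_closed_Stest)
  then show "(\<lambda>x::real^'n. 0) \<in> Dtest s M"
    unfolding Dtest_iff_Stest lin_closed_def by simp
  fix f g :: "real^'n \<Rightarrow> complex" and a b assume "f \<in> Dtest s M" "g \<in> Dtest s M"
  then have f: "f \<in> Stest s M" "g \<in> Stest s M" "bounded ({x. f x \<noteq> 0} \<union> {x. g x \<noteq> 0})"
    unfolding Dtest_iff_Stest by auto
  have "{x. a * f x + b * g x \<noteq> 0} \<subseteq> {x. f x \<noteq> 0} \<union> {x. g x \<noteq> 0}" by auto
  then have "bounded {x. a * f x + b * g x \<noteq> 0}" using f(3) bounded_subset by blast
  then show "(\<lambda>x. a * f x + b * g x) \<in> Dtest s M"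
    using st f(1,2) unfolding Dtest_iff_Stest lin_closed_def by blast
qed

text \<open>Bounds at every scale make \<open>g\<close> a multiplier in both cases, since the
  Leibniz rule then only turns h into 2 h. The local variant below suffices on compact supports and
  admits exponentials.\<close>

definition mult_global :: "(real^'n::finite \<Rightarrow> complex) \<Rightarrow> bool" where
  "mult_global g \<longleftrightarrow> smooth_fun g \<and> (\<forall>h>0. \<exists>C. \<forall>x. pbound M g x C h)"

definition mult_local :: "(real^'n::finite \<Rightarrow> complex) \<Rightarrow> bool" where
  "mult_local g \<longleftrightarrow> smooth_fun g \<and> (\<forall>K. compact K \<longrightarrow> (\<forall>h>0. \<exists>C. \<forall>x\<in>K. pbound M g x C h))"

lemma Stest_mult:
  assumes "mult_global g" "\<phi> \<in> Stest s M"
  shows "(\<lambda>x. g x * \<phi> x) \<in> Stest s M"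
  unfolding Stest_iff
proof
  show "smooth_fun (\<lambda>x. g x * \<phi> x)"
    using assms unfolding mult_global_def Stest_iff by (auto intro: smooth_mult)
  have "class_quant s (\<lambda>h. \<exists>A. SB M h A \<phi>)" using assms(2) unfolding Stest_iff by simp
  then show "class_quant s (\<lambda>h. \<exists>A. SB M h A (\<lambda>x. g x * \<phi> x))"
  proof (rule class_quant_scale[where c=2])
    fix h :: real assume h: "h > 0" "\<exists>A. SB M h A \<phi>"
    then obtain A where A: "SB M h A \<phi>" by blast
    obtain C where C: "\<And>x. pbound M g x C h" using assms(1) h unfolding mult_global_def by blast
    have "SB M (h + h) (C * A) (\<lambda>x. g x * \<phi> x)"
      using SB_mult[OF _ _ C A] assms h unfolding mult_global_def Stest_iff by simp
    then show "\<exists>A. SB M (2 * h) A (\<lambda>x. g x * \<phi> x)" unfolding mult_2 by blast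
  qed simp
qed

lemma Dtest_mult:
  assumes "mult_local g" "\<phi> \<in> Dtest s M"
  shows "(\<lambda>x. g x * \<phi> x) \<in> Dtest s M"
  unfolding Dtest_iff
proof (intro conjI)
  have sm: "smooth_fun g" "smooth_fun \<phi>" using assms unfolding mult_local_def Dtest_iff by auto
  then show "smooth_fun (\<lambda>x. g x * \<phi> x)" by (rule smooth_mult)
  have b: "bounded {x. \<phi> x \<noteq> 0}" and K: "compact (closure {x. \<phi> x \<noteq> 0})"
    and cq: "class_quant s (\<lambda>h. \<exists>A. Dbound M h A \<phi>)" using assms unfolding Dtest_iff by auto
  have sub: "{x. g x * \<phi> x \<noteq> 0} \<subseteq> {x. \<phi> x \<noteq> 0}" by auto
  show "compact (closure {x. g x * \<phi> x \<noteq> 0})" using bounded_subset[OF b sub] by simp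
  show "class_quant s (\<lambda>h. \<exists>A. Dbound M h A (\<lambda>x. g x * \<phi> x))"
    using cq
  proof (rule class_quant_scale[where c=2])
    fix h :: real assume h: "h > 0" "\<exists>A. Dbound M h A \<phi>"
    then obtain A where A: "\<And>x. pbound M \<phi> x A h" unfolding Dbound_iff_pbound by blast
    obtain C where C: "\<And>x. x \<in> closure {x. \<phi> x \<noteq> 0} \<Longrightarrow> pbound M g x C h"
      using assms(1)[unfolded mult_local_def, THEN conjunct2, rule_format, OF K h(1)] by auto
    have A0: "A \<ge> 0" using pbound_nonneg[OF A] by simp
    \<comment> \<open>If the support is empty nothing fixes the sign of \<open>C\<close>; the
      absolute value covers that case.\<close>
    have "pbound M (\<lambda>x. g x * \<phi> x) x (\<bar>C\<bar> * A) (h + h)" for x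
    proof (cases "x \<in> closure {x. \<phi> x \<noteq> 0}")
      case True
      have "\<bar>C\<bar> = C" using pbound_nonneg[OF C[OF True]] by simp
      then show ?thesis using pbound_mult[OF sm C[OF True] A] h by simp
    next
      case False
      then show ?thesis
        using A0 h closure_mono[OF sub] by (intro pbound_outside_support) auto
    qed
    then show "\<exists>A. Dbound M (2 * h) A (\<lambda>x. g x * \<phi> x)" unfolding Dbound_iff_pbound mult_2 by blast
  qed simp
qed

lemma est_antimono: "est s M S k \<Longrightarrow> 0 < h \<Longrightarrow> h \<le> k \<Longrightarrow> est s M S h"
  unfolding est_def by (meson SB_mono less_imp_le order_refl)

lemma tempered_zero: "tempered s M (\<lambda>\<phi>. 0)"
proof -
  have "est s M (\<lambda>\<phi>::real^'n::finite \<Rightarrow> complex. 0) h" for h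
    unfolding est_def by (auto intro!: exI[of _ 0])
  then show ?thesis
    unfolding tempered_iff lin_on_def dual_quant_def
    by (cases s) (auto intro: exI[of _ 1])
qed

lemma tempered_add:
  assumes "tempered s M S" "tempered s M S'"
  shows "tempered s M (\<lambda>\<phi>. S \<phi> + S' \<phi>)"
  unfolding tempered_iff
proof
  show "lin_on (Stest s M) (\<lambda>\<phi>. S \<phi> + S' \<phi>)"
    using assms unfolding tempered_iff lin_on_def by (simp add: algebra_simps)
  have "dual_quant s (\<lambda>h. est s M S h \<and> est s M S' h)"
    using assms unfolding tempered_iff by (intro dual_quant_conj) (auto intro: est_antimono)
  then show "dual_quant s (est s M (\<lambda>\<phi>. S \<phi> + S' \<phi>))"
  proof (rule dual_quant_scale[where c=1])
    fix h assume "est s M S (1 * h) \<and> est s M S' (1 * h)"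
    then obtain C C' where C: "\<forall>\<phi>\<in>Stest s M. \<forall>A. SB M h A \<phi> \<longrightarrow> cmod (S \<phi>) \<le> C * A"
      "\<forall>\<phi>\<in>Stest s M. \<forall>A. SB M h A \<phi> \<longrightarrow> cmod (S' \<phi>) \<le> C' * A" unfolding est_def by auto
    have "\<forall>\<phi>\<in>Stest s M. \<forall>A. SB M h A \<phi> \<longrightarrow> cmod (S \<phi> + S' \<phi>) \<le> (C + C') * A"
      using C by (metis (no_types, lifting) add_mono distrib_right norm_triangle_le)
    then show "est s M (\<lambda>\<phi>. S \<phi> + S' \<phi>) h" unfolding est_def by blast
  qed simp
qed

lemma tempered_sum:
  "(\<And>i. i \<in> I \<Longrightarrow> tempered s M (S i)) \<Longrightarrow> tempered s M (\<lambda>\<phi>. \<Sum>i\<in>I. S i \<phi>)"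
  by (induct I rule: infinite_finite_induct) (auto intro: tempered_zero tempered_add)

lemma tempered_mult:
  fixes g :: "real^'n::finite \<Rightarrow> complex"
  assumes "tempered s M S" "mult_global g"
  shows "tempered s M (\<lambda>\<phi>. S (\<lambda>x. g x * \<phi> x))"
  unfolding tempered_iff
proof
  show "lin_on (Stest s M) (\<lambda>\<phi>. S (\<lambda>x. g x * \<phi> x))"
    unfolding lin_on_def
  proof (intro ballI allI)
    fix \<phi> \<psi> :: "real^'n \<Rightarrow> complex" and a b assume *: "\<phi> \<in> Stest s M" "\<psi> \<in> Stest s M"
    have "(\<lambda>x. g x * (a * \<phi> x + b * \<psi> x)) = (\<lambda>x. a * (g x * \<phi> x) + b * (g x * \<psi> x))"
      by (simp add: algebra_simps)
    then show "S (\<lambda>x. g x * (a * \<phi> x + b * \<psi> x)) = a * S (\<lambda>x. g x * \<phi> x) + b * S (\<lambda>x. g x * \<psi> x)"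
      using assms(1) Stest_mult[OF assms(2)] * unfolding tempered_iff lin_on_def by simp
  qed
  have "dual_quant s (est s M S)" using assms(1) unfolding tempered_iff by simp
  then show "dual_quant s (est s M (\<lambda>\<phi>. S (\<lambda>x. g x * \<phi> x)))"
  proof (rule dual_quant_scale[where c=2])
    fix h :: real assume h: "h > 0" "est s M S (2 * h)"
    obtain C where C: "\<And>x. pbound M g x C h" using assms(2) h unfolding mult_global_def by blast
    obtain C' where C': "\<forall>\<phi>\<in>Stest s M. \<forall>A. SB M (2 * h) A \<phi> \<longrightarrow> cmod (S \<phi>) \<le> C' * A"
      using h unfolding est_def by blast
    have "cmod (S (\<lambda>x. g x * \<phi> x)) \<le> (C' * C) * A" if "\<phi> \<in> Stest s M" "SB M h A \<phi>" for \<phi> A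
    proof -
      have "SB M (h + h) (C * A) (\<lambda>x. g x * \<phi> x)"
        using SB_mult[OF _ _ C that(2)] assms(2) that h unfolding mult_global_def Stest_iff by simp
      then have "SB M (2 * h) (C * A) (\<lambda>x. g x * \<phi> x)" unfolding mult_2 .
      with C'[rule_format, OF Stest_mult[OF assms(2) that(1)], of "C * A"]
      show ?thesis by (simp add: mult.assoc)
    qed
    then show "est s M (\<lambda>\<phi>. S (\<lambda>x. g x * \<phi> x)) h" unfolding est_def by blast
  qed simp
qed

lemma cutoff_mult_global: "cutoffs \<kappa> \<Longrightarrow> mult_global (\<kappa> n)"
  unfolding cutoffs_def mult_global_def by blast

lemma cutoff_mult_Dtest:
  assumes "cutoffs \<kappa>" "\<phi> \<in> Stest s M"
  shows "(\<lambda>x. \<kappa> n x * \<phi> x) \<in> Dtest s M"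
proof -
  have "bounded {x. \<kappa> n x * \<phi> x \<noteq> 0}"
    by (rule bounded_subset[of "{x. \<kappa> n x \<noteq> 0}"]) (use assms(1) in \<open>auto simp: cutoffs_def\<close>)
  then show ?thesis using Stest_mult[OF cutoff_mult_global assms(2)] assms(1) unfolding Dtest_iff_Stest by blast
qed

lemma cutoff_Dtest: "cutoffs \<kappa> \<Longrightarrow> \<kappa> n \<in> Dtest s M"
  unfolding cutoffs_def Dtest_iff Dbound_iff_pbound
  by (intro conjI class_quant_all) (simp, simp, blast)

text \<open>Inside the ball where \<kappa>_n = 1 the remainder vanishes. Outside, <x> \<ge> n + 1,
  so the seminorm with one more power of <x> gains 1/(n+1); (M.2) brings M_(q+1) back to M_q at the
  price of H in the scale.\<close>

lemma cutoff_remainder_SB: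
  fixes \<phi> :: "real^'n::finite \<Rightarrow> complex"
  assumes \<kappa>: "cutoffs \<kappa>" and \<phi>: "smooth_fun \<phi>" "SB M h A \<phi>" and h: "h > 0"
  shows "\<exists>C. \<forall>n. SB M (2 * H * h) (C * (1 / real (Suc n))) (\<lambda>x. (1 - \<kappa> n x) * \<phi> x)"
proof -
  obtain B where B: "\<And>n x. pbound M (\<kappa> n) x B h" using \<kappa> h unfolding cutoffs_def by blast
  have A: "A \<ge> 0" using SB_nonneg[OF \<phi>(2)] .
  have B0: "B \<ge> 0" using pbound_nonneg[OF B] by simp
  have s\<kappa>: "smooth_fun (\<lambda>x. 1 - \<kappa> n x)" for n
    using \<kappa> unfolding cutoffs_def by (intro smooth_diff smooth_const) blast
  have b: "pbound M (\<lambda>x. 1 - \<kappa> n x) x (1 + B) h" for n x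
    using pbound_add[OF smooth_const smooth_cmult, of "\<kappa> n" M 1 x 1 h "-1" B]
      pbound_const[of h 1 x] pbound_cmult[of "\<kappa> n" M x B h "-1"] B \<kappa> h unfolding cutoffs_def by simp
  define C where "C = (1 + B) * A * h * H * c0 * M 1"
  have C0: "C \<ge> 0" unfolding C_def using A B0 h H c0 by auto
  have "pbound M (\<lambda>x. (1 - \<kappa> n x) * \<phi> x) x (C * (1 / real (Suc n)) * (2 * H * h) ^ q * M q / jb x ^ q) (2 * H * h)"
    for n q x
  proof (cases "norm x < real (Suc n)")
    case True
    have "Dl js (\<lambda>x. (1 - \<kappa> n x) * \<phi> x) x = 0" for js
      using Dl_const_open[of "ball 0 (real (Suc n))" "\<lambda>x. (1 - \<kappa> n x) * \<phi> x" 0 x js] True \<kappa>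
      unfolding cutoffs_def by (auto split: if_splits)
    then show ?thesis unfolding pbound_def using C0 H h by (auto simp: less_imp_le)
  next
    case False
    let ?b = "A * h ^ Suc q * M (Suc q) / jb x ^ Suc q"
    have p: "pbound M (\<lambda>x. (1 - \<kappa> n x) * \<phi> x) x ((1 + B) * ?b) (h + h)"
      using SB_iff_pbound[THEN iffD1, OF \<phi>(2), rule_format, of x "Suc q"] h
      by (intro pbound_mult[OF s\<kappa> \<phi>(1) b]) auto
    have j: "real (Suc n) \<le> jb x" using False norm_le_jb[of x] by linarith
    have "M (Suc q) \<le> c0 * H ^ Suc q * M q * M 1" using M_add_le[of q 1] by simp
    then have "A * h ^ Suc q * M (Suc q) / jb x ^ Suc q \<le> A * h ^ Suc q * (c0 * H ^ Suc q * M q * M 1) / jb x ^ Suc q"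
      using A h by (intro divide_right_mono mult_left_mono) (auto simp: less_imp_le)
    also have "\<dots> \<le> A * h ^ Suc q * (c0 * H ^ Suc q * M q * M 1) / (real (Suc n) * jb x ^ q)"
      using A h H c0 j by (intro divide_left_mono) (auto intro!: mult_right_mono mult_nonneg_nonneg mult_pos_pos simp: less_imp_le)
    finally have "(1 + B) * ?b \<le> (1 + B) * (A * h ^ Suc q * (c0 * H ^ Suc q * M q * M 1) / (real (Suc n) * jb x ^ q))"
      using B0 by (intro mult_left_mono) auto
    also have "\<dots> = C * (1 / real (Suc n)) * (H * h) ^ q * M q / jb x ^ q"
      unfolding C_def by (simp add: power_mult_distrib)
    also have "\<dots> \<le> C * (1 / real (Suc n)) * (2 * H * h) ^ q * M q / jb x ^ q"
      using C0 H h by (intro divide_right_mono mult_right_mono mult_left_mono power_mono) (auto simp: less_imp_le)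
    finally have le: "(1 + B) * ?b \<le> C * (1 / real (Suc n)) * (2 * H * h) ^ q * M q / jb x ^ q" .
    show ?thesis
    proof (rule pbound_mono[OF p le])
      show "h + h \<le> 2 * H * h" using H h by simp
      show "0 \<le> (1 + B) * ?b" using A B0 h by (intro mult_nonneg_nonneg divide_nonneg_nonneg) (auto simp: less_imp_le)
    qed (use h in auto)
  qed
  then show ?thesis unfolding SB_iff_pbound by blast
qed

lemma tempered_cutoff_tendsto:
  assumes S: "tempered s M S" and \<kappa>: "cutoffs \<kappa>" and \<phi>: "\<phi> \<in> Stest s M"
  shows "(\<lambda>n. S (\<lambda>x. \<kappa> n x * \<phi> x)) \<longlonglongrightarrow> S \<phi>"
proof -
  have \<kappa>\<phi>: "(\<lambda>x. \<kappa> n x * \<phi> x) \<in> Stest s M" for n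
    using cutoff_mult_Dtest[OF \<kappa> \<phi>] Dtest_subset_Stest by blast
  have lin: "lin_on (Stest s M) S" using S unfolding tempered_iff by simp
  have e: "(\<lambda>x. (1 - \<kappa> n x) * \<phi> x) = (\<lambda>x. \<phi> x - \<kappa> n x * \<phi> x)" for n by (simp add: algebra_simps)
  have d: "S (\<lambda>x. (1 - \<kappa> n x) * \<phi> x) = S \<phi> - S (\<lambda>x. \<kappa> n x * \<phi> x)" "(\<lambda>x. (1 - \<kappa> n x) * \<phi> x) \<in> Stest s M" for n
    unfolding e using lin_on_diff[OF lin lin_closed_Stest \<phi> \<kappa>\<phi>] by auto
  have "class_quant s (\<lambda>h. \<exists>A. SB M h A \<phi>)" using \<phi> unfolding Stest_iff by simp
  then have "class_quant s (\<lambda>h. \<exists>C. \<forall>n\<in>UNIV. SB M h (C * (1 / real (Suc n))) (\<lambda>x. (1 - \<kappa> n x) * \<phi> x))"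
    by (rule class_quant_scale[where c="2 * H"])
      (use cutoff_remainder_SB[OF \<kappa>] \<phi> H in \<open>auto simp: Stest_iff\<close>)
  from tempered_family[OF S d(2) this]
  obtain C where C: "\<And>n. cmod (S \<phi> - S (\<lambda>x. \<kappa> n x * \<phi> x)) \<le> C * (1 / real (Suc n))" unfolding d(1) by auto
  have l: "(\<lambda>n. C * (1 / real (Suc n))) \<longlonglongrightarrow> 0"
    using tendsto_mult[OF tendsto_const LIMSEQ_inverse_real_of_nat, of C] by (simp add: divide_inverse)
  have "(\<lambda>n. S \<phi> - S (\<lambda>x. \<kappa> n x * \<phi> x)) \<longlonglongrightarrow> 0"
    by (rule Lim_null_comparison[OF _ l]) (use C in auto)
  from tendsto_diff[OF tendsto_const this, of "S \<phi>"] show ?thesis by simp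
qed

text \<open>Cut-offs make the compactly supported functions dense, so the tempered functional
  representing e^(-x\<xi>) T has only one set of values on test functions, and one representative
  can stand for all.\<close>

lemma tempered_determined_by_Dtest:
  assumes "tempered s M S" "tempered s M S'" "\<And>\<phi>. \<phi> \<in> Dtest s M \<Longrightarrow> S \<phi> = S' \<phi>" "\<phi> \<in> Stest s M"
  shows "S \<phi> = S' \<phi>"
proof -
  obtain \<kappa> :: "nat \<Rightarrow> real^'a \<Rightarrow> complex" where \<kappa>: "cutoffs \<kappa>" using exists_cutoffs by blast
  show ?thesis
    using tempered_cutoff_tendsto[OF assms(1) \<kappa> assms(4)] tempered_cutoff_tendsto[OF assms(2) \<kappa> assms(4)]
      assms(3)[OF cutoff_mult_Dtest[OF \<kappa> assms(4)]] LIMSEQ_unique by simp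
qed

end

section \<open>Exponentials divided by sums of exponentials\<close>

text \<open>Bilinear, without conjugation, so that exponentials are holomorphic in z.\<close>

definition cdot :: "real^'n::finite \<Rightarrow> complex^'n \<Rightarrow> complex" where
  "cdot x z = (\<Sum>j\<in>UNIV. complex_of_real (x $ j) * z $ j)"

definition cvec :: "real^'n::finite \<Rightarrow> complex^'n" where
  "cvec \<xi> = (\<chi> j. complex_of_real (\<xi> $ j))"

definition Rev :: "complex^'n::finite \<Rightarrow> real^'n" where
  "Rev z = (\<chi> j. Re (z $ j))"

definition expm :: "complex^'n::finite \<Rightarrow> real^'n \<Rightarrow> complex" where
  "expm z x = exp (- cdot x z)"

lemma cdot_add_right: "cdot x (z + w) = cdot x z + cdot x w"
  unfolding cdot_def by (simp add: distrib_left sum.distrib)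

lemma cdot_axis: "cdot (x + t *\<^sub>R axis j 1) z = cdot x z + complex_of_real t * z $ j"
proof -
  have "(\<Sum>i\<in>UNIV. complex_of_real (t * axis j 1 $ i) * z $ i)
      = (\<Sum>i\<in>UNIV. if i = j then complex_of_real t * z $ i else 0)"
    by (rule sum.cong) (auto simp: axis_def)
  then show ?thesis unfolding cdot_def by (simp add: distrib_right sum.distrib)
qed

lemma Re_cdot: "Re (cdot x z) = x \<bullet> Rev z"
  unfolding cdot_def Rev_def inner_vec_def by simp

lemma cmod_expm: "cmod (expm z x) = exp (- (x \<bullet> Rev z))"
  unfolding expm_def norm_exp_eq_Re by (simp add: Re_cdot)

lemma expm_add: "expm (z + w) x = expm z x * expm w x"
  unfolding expm_def cdot_add_right by (simp add: exp_add[symmetric])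

lemma expm_neq_0 [simp]: "expm z x \<noteq> 0" unfolding expm_def by simp

lemma cdot_cvec: "cdot x (cvec \<xi>) = complex_of_real (x \<bullet> \<xi>)"
  unfolding cdot_def cvec_def inner_vec_def by simp

lemma expm_cvec: "expm (cvec \<xi>) x = exp (- complex_of_real (x \<bullet> \<xi>))"
  unfolding expm_def cdot_cvec ..

lemma expm_cvec_real: "expm (cvec \<xi>) x = complex_of_real (exp (- (x \<bullet> \<xi>)))"
  unfolding expm_cvec by (metis exp_of_real of_real_minus)

lemma Rev_cvec [simp]: "Rev (cvec \<xi>) = \<xi>"
  unfolding Rev_def cvec_def by (simp add: vec_eq_iff)

lemma has_pdir_expm: "has_pdir j (expm z) (\<lambda>x. - (z $ j) * expm z x)"
  unfolding has_pdir_def expm_def cdot_axis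
proof
  fix x
  have "((\<lambda>w. exp (- (cdot x z + w * z $ j))) has_field_derivative - (z $ j) * exp (- cdot x z)) (at (of_real 0))"
    by (auto intro!: derivative_eq_intros)
  then show "((\<lambda>t. exp (- (cdot x z + complex_of_real t * z $ j))) has_vector_derivative
      - (z $ j) * exp (- cdot x z)) (at 0)"
    by (rule has_vector_derivative_real_field)
qed

lemma continuous_on_expm: "continuous_on S (expm z)"
  unfolding expm_def cdot_def by (intro continuous_intros)

lemma smooth_expm: "smooth_fun (expm z)"
proof (rule smooth_coinduct[of _ "{\<lambda>x. c * expm z x |c. True}"])
  have "expm z = (\<lambda>x. 1 * expm z x)" by simp
  then show "expm z \<in> {\<lambda>x. c * expm z x |c. True}" by blast
  fix f j assume "f \<in> {\<lambda>x. c * expm z x |c. True}"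
  then obtain c where f: "f = (\<lambda>x. c * expm z x)" by blast
  then show "continuous_on UNIV f" by (auto intro!: continuous_intros continuous_on_expm)
  have "has_pdir j f (\<lambda>x. (c * - (z $ j)) * expm z x)"
    using has_pdir_cmult[OF has_pdir_expm[of j z], of c] unfolding f by (simp add: mult.assoc)
  then show "\<exists>g\<in>{\<lambda>x. c * expm z x |c. True}. has_pdir j f g" by blast
qed

lemma cmod_Dl_expm_le:
  assumes "\<And>j. cmod (z $ j) \<le> R"
  shows "cmod (Dl js (expm z) x) \<le> R ^ length js * cmod (expm z x)"
proof (induct js rule: rev_induct)
  case (snoc j js)
  have R: "R \<ge> 0" using assms[of j] norm_ge_zero order_trans by blast
  have "Dl (js @ [j]) (expm z) x = - (z $ j) * Dl js (expm z) x"
    unfolding Dl_snoc has_pdir_imp_pdir[OF has_pdir_expm] by (simp only: Dl_cmult[OF smooth_expm])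
  then have "cmod (Dl (js @ [j]) (expm z) x) = cmod (z $ j) * cmod (Dl js (expm z) x)" by (simp add: norm_mult)
  also have "\<dots> \<le> R * (R ^ length js * cmod (expm z x))"
    using assms snoc R by (intro mult_mono) auto
  finally show ?case by simp
qed simp

text \<open>\<open>wsum F\<close> and \<open>Ediv F z\<close> are w and \<phi>_z of the overview.
  Only real exponents occur in the sum, so it is positive for nonempty \<open>F\<close> and may be
  divided by.\<close>

definition wsum :: "(real^'n::finite) set \<Rightarrow> real^'n \<Rightarrow> complex" where
  "wsum F x = (\<Sum>i\<in>F. expm (cvec i) x)"

definition Ediv :: "(real^'n::finite) set \<Rightarrow> complex^'n \<Rightarrow> real^'n \<Rightarrow> complex" where
  "Ediv F z x = expm z x * inverse (wsum F x)"

lemma wsum_real: "wsum F x = complex_of_real (\<Sum>i\<in>F. exp (- (x \<bullet> i)))"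
  unfolding wsum_def expm_cvec_real by simp

lemma wsum_sum_pos: "finite F \<Longrightarrow> F \<noteq> {} \<Longrightarrow> (\<Sum>i\<in>F. exp (- (x \<bullet> i))) > (0::real)"
  by (intro sum_pos) auto

lemma wsum_neq_0: "finite F \<Longrightarrow> F \<noteq> {} \<Longrightarrow> wsum F x \<noteq> 0"
  using wsum_sum_pos[of F x] unfolding wsum_real by (metis less_irrefl of_real_eq_0_iff)

lemma cmod_wsum: "finite F \<Longrightarrow> F \<noteq> {} \<Longrightarrow> cmod (wsum F x) = (\<Sum>i\<in>F. exp (- (x \<bullet> i)))"
  using wsum_sum_pos[of F x] unfolding wsum_real norm_of_real by simp

lemma smooth_wsum: "smooth_fun (wsum F)"
  unfolding wsum_def by (intro smooth_sum smooth_expm)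

lemma smooth_Ediv: "finite F \<Longrightarrow> F \<noteq> {} \<Longrightarrow> smooth_fun (Ediv F z)"
  unfolding Ediv_def by (intro smooth_mult smooth_expm smooth_inverse smooth_wsum wsum_neq_0)

lemma Ediv_add: "Ediv F (z + v) x = Ediv F z x * expm v x"
  unfolding Ediv_def expm_add by simp

lemma Ediv_wsum: "finite F \<Longrightarrow> F \<noteq> {} \<Longrightarrow> (\<Sum>i\<in>F. expm (cvec i) x * Ediv F z x) = expm z x"
  using wsum_neq_0[of F x] unfolding Ediv_def by (simp add: sum_distrib_right[symmetric] wsum_def)

text \<open>The functions $e^{-x\cdot v}w(x)^{-r}$ with $w=\sum_{i\in F}e^{-x\cdot i}$ are closed under differentiation up to
  linear combinations, and $\sum_i|e^{-x(v+i)}w^{-r-1}|=|e^{-xv}w^{-r}|$; this yields factorial, hence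
  ultradifferentiable, bounds.\<close>

definition Epow :: "(real^'n::finite) set \<Rightarrow> complex^'n \<Rightarrow> nat \<Rightarrow> real^'n \<Rightarrow> complex" where
  "Epow F v r x = expm v x * inverse (wsum F x) ^ r"

lemma smooth_Epow: "finite F \<Longrightarrow> F \<noteq> {} \<Longrightarrow> smooth_fun (Epow F z r)"
  unfolding Epow_def by (intro smooth_mult smooth_expm smooth_power smooth_inverse smooth_wsum wsum_neq_0)

lemma has_pdir_sum:
  "(\<And>i. i \<in> I \<Longrightarrow> has_pdir j (f i) (f' i)) \<Longrightarrow> has_pdir j (\<lambda>x. \<Sum>i\<in>I. f i x) (\<lambda>x. \<Sum>i\<in>I. f' i x)"
  by (induct I rule: infinite_finite_induct) (auto intro: has_pdir_const has_pdir_add)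

lemma has_pdir_Epow:
  assumes F: "finite F" "F \<noteq> {}"
  shows "has_pdir j (Epow F v r) (\<lambda>x. - (v $ j) * Epow F v r x +
      (\<Sum>i\<in>F. (of_nat r * complex_of_real (i $ j)) * Epow F (v + cvec i) (Suc r) x))"
proof -
  let ?w' = "\<lambda>x. \<Sum>i\<in>F. - (cvec i $ j) * expm (cvec i) x"
  have w: "has_pdir j (wsum F) ?w'"
    unfolding wsum_def[abs_def] by (intro has_pdir_sum has_pdir_expm)
  have iw: "has_pdir j (\<lambda>x. inverse (wsum F x)) (\<lambda>x. - ?w' x * (inverse (wsum F x) * inverse (wsum F x)))"
    by (rule has_pdir_inverse[OF w wsum_neq_0[OF F]])
  have p: "has_pdir j (\<lambda>x. inverse (wsum F x) ^ r) (\<lambda>x. of_nat r * - ?w' x * inverse (wsum F x) ^ Suc r)"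
  proof (induct r)
    case 0
    then show ?case using has_pdir_const[of j 1] by simp
  next
    case (Suc r)
    from has_pdir_mult[OF iw this] show ?case by (simp add: algebra_simps)
  qed
  have "has_pdir j (Epow F v r)
    (\<lambda>x. expm v x * (of_nat r * - ?w' x * inverse (wsum F x) ^ Suc r) + (- (v $ j) * expm v x) * inverse (wsum F x) ^ r)"
    unfolding Epow_def[abs_def] by (rule has_pdir_mult[OF has_pdir_expm p])
  moreover have "(\<Sum>i\<in>F. (of_nat r * complex_of_real (i $ j)) * Epow F (v + cvec i) (Suc r) x)
      = expm v x * (of_nat r * - ?w' x * inverse (wsum F x) ^ Suc r)" for x
  proof -
    have "(of_nat r * complex_of_real (i $ j)) * Epow F (v + cvec i) (Suc r) x
        = - (expm v x * of_nat r * inverse (wsum F x) ^ Suc r) * (- (cvec i $ j) * expm (cvec i) x)" for i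
      unfolding Epow_def expm_add by (simp add: cvec_def)
    then have "(\<Sum>i\<in>F. (of_nat r * complex_of_real (i $ j)) * Epow F (v + cvec i) (Suc r) x)
        = - (expm v x * of_nat r * inverse (wsum F x) ^ Suc r) * ?w' x"
      by (simp only: sum_distrib_left)
    also have "\<dots> = expm v x * (of_nat r * - ?w' x * inverse (wsum F x) ^ Suc r)"
      by (simp only: mult_minus_left mult_minus_right mult_ac)
    finally show ?thesis .
  qed
  moreover have "- (v $ j) * Epow F v r x = (- (v $ j) * expm v x) * inverse (wsum F x) ^ r" for x
    unfolding Epow_def by simp
  ultimately show ?thesis by (simp only: add.commute)
qed

lemma sum_cmod_Epow:
  assumes F: "finite F" "F \<noteq> {}"
  shows "(\<Sum>i\<in>F. cmod (Epow F (v + cvec i) (Suc r) x)) = cmod (Epow F v r x)"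
proof -
  have "cmod (Epow F (v + cvec i) (Suc r) x) = exp (- (x \<bullet> i)) * (cmod (Epow F v r x) / cmod (wsum F x))" for i
    unfolding Epow_def expm_add norm_mult norm_power norm_inverse cmod_expm[of "cvec i"] by (simp add: divide_inverse mult_ac)
  then have "(\<Sum>i\<in>F. cmod (Epow F (v + cvec i) (Suc r) x))
      = (\<Sum>i\<in>F. exp (- (x \<bullet> i))) * (cmod (Epow F v r x) / cmod (wsum F x))"
    by (simp only: sum_distrib_right)
  also have "\<dots> = cmod (Epow F v r x)"
    using cmod_wsum[OF F, of x] wsum_neq_0[OF F, of x] by (metis nonzero_mult_div_cancel_left norm_eq_zero times_divide_eq_right)
  finally show ?thesis .
qed

lemma cmod_Dl_Epow_le:
  fixes F :: "(real^'n::finite) set"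
  assumes F: "finite F" "F \<noteq> {}" and R: "\<And>i j. i \<in> F \<Longrightarrow> \<bar>i $ j\<bar> \<le> R"
    and "\<And>j. cmod (v $ j) \<le> R * real r"
  shows "cmod (Dl js (Epow F v r) x) \<le> (2 * R) ^ length js * (fact (r + length js) / fact r) * cmod (Epow F v r x)"
  using assms(4)
proof (induct js arbitrary: v r rule: rev_induct)
  case (snoc j js)
  let ?n = "length js"
  have R0: "R \<ge> 0" using R F(2) by (metis abs_ge_zero all_not_in_conv order_trans)
  let ?e = "cmod (Epow F v r x)" and ?R = "(2 * R) ^ ?n"
  \<comment> \<open>Adding a point of \<open>F\<close> raises the components by at most R, which is
    what r + 1 in place of r allows; the hypothesis is scaled by r in order to survive the
    induction.\<close>
  have vi: "cmod ((v + cvec i) $ k) \<le> R * real (Suc r)" if "i \<in> F" for i k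
    using norm_triangle_ineq[of "v $ k" "cvec i $ k"] snoc.prems[of k] R[OF that, of k]
    by (simp add: cvec_def algebra_simps)
  let ?A = "- (v $ j) * Dl js (Epow F v r) x"
  let ?B = "\<Sum>i\<in>F. (of_nat r * complex_of_real (i $ j)) * Dl js (Epow F (v + cvec i) (Suc r)) x"
  have sm: "smooth_fun (\<lambda>x. (of_nat r * complex_of_real (i $ j)) * Epow F (v + cvec i) (Suc r) x)" for i
    by (intro smooth_cmult smooth_Epow F)
  have a: "Dl (js @ [j]) (Epow F v r) x = ?A + ?B"
    unfolding Dl_snoc has_pdir_imp_pdir[OF has_pdir_Epow[OF F]]
    by (simp only: Dl_add[OF smooth_cmult[OF smooth_Epow[OF F]] smooth_sum[OF sm]] Dl_sum[OF sm]
        Dl_cmult[OF smooth_Epow[OF F]])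
  have b: "cmod ?A = cmod (v $ j) * cmod (Dl js (Epow F v r) x)" by (simp add: norm_mult)
  have c: "cmod ?B \<le> (\<Sum>i\<in>F. (real r * \<bar>i $ j\<bar>) * cmod (Dl js (Epow F (v + cvec i) (Suc r)) x))"
    by (rule sum_norm_le) (simp add: norm_mult)
  have "cmod (Dl (js @ [j]) (Epow F v r) x) \<le> cmod (v $ j) * cmod (Dl js (Epow F v r) x) +
      (\<Sum>i\<in>F. (real r * \<bar>i $ j\<bar>) * cmod (Dl js (Epow F (v + cvec i) (Suc r)) x))"
    unfolding a by (rule order_trans[OF norm_triangle_ineq add_mono[OF eq_refl[OF b] c]])
  also have "\<dots> \<le> (R * real r) * (?R * (fact (r + ?n) / fact r) * ?e) +
      (\<Sum>i\<in>F. (real r * R) * (?R * (fact (Suc r + ?n) / fact (Suc r)) * cmod (Epow F (v + cvec i) (Suc r) x)))"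
  proof (intro add_mono sum_mono mult_mono)
    show "cmod (Dl js (Epow F v r) x) \<le> ?R * (fact (r + ?n) / fact r) * ?e"
      by (rule snoc.hyps[OF snoc.prems])
    show "cmod (Dl js (Epow F (v + cvec i) (Suc r)) x)
        \<le> ?R * (fact (Suc r + ?n) / fact (Suc r)) * cmod (Epow F (v + cvec i) (Suc r) x)" if "i \<in> F" for i
      by (rule snoc.hyps[OF vi[OF that]])
  qed (use snoc.prems R R0 in auto)
  also have "(\<Sum>i\<in>F. (real r * R) * (?R * (fact (Suc r + ?n) / fact (Suc r)) * cmod (Epow F (v + cvec i) (Suc r) x)))
     = (real r * R) * (?R * (fact (Suc r + ?n) / fact (Suc r)) * ?e)"
    unfolding sum_distrib_left[symmetric] sum_cmod_Epow[OF F] ..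
  also have "(R * real r) * (?R * (fact (r + ?n) / fact r) * ?e) + (real r * R) * (?R * (fact (Suc r + ?n) / fact (Suc r)) * ?e)
     = R * ?R * ?e * (real r * (fact (r + ?n) / fact r) + real r * (fact (Suc r + ?n) / fact (Suc r)))"
    by (simp only: algebra_simps)
  also have "\<dots> \<le> R * ?R * ?e * (2 * (fact (Suc r + ?n) / fact r))"
  proof (intro mult_left_mono)
    have "real r * fact (r + ?n) \<le> (fact (Suc r + ?n) :: real)"
      by (simp add: algebra_simps)
    then have 1: "real r * (fact (r + ?n) / fact r) \<le> fact (Suc r + ?n) / (fact r :: real)"
      by (simp add: divide_right_mono)
    have "real r / real (Suc r) \<le> 1" by simp
    then have "real r / real (Suc r) * (fact (Suc r + ?n) / fact r) \<le> 1 * (fact (Suc r + ?n) / (fact r :: real))"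
      by (intro mult_right_mono) auto
    then have 2: "real r * (fact (Suc r + ?n) / fact (Suc r)) \<le> fact (Suc r + ?n) / (fact r :: real)"
      by (simp add: mult_ac)
    show "real r * (fact (r + ?n) / fact r) + real r * (fact (Suc r + ?n) / fact (Suc r))
        \<le> 2 * (fact (Suc r + ?n) / (fact r :: real))"
      using 1 2 by linarith
  qed (use R0 in auto)
  also have "\<dots> = (2 * R) ^ length (js @ [j]) * (fact (r + length (js @ [j])) / fact r) * ?e"
    by simp
  finally show ?case .
qed simp

section \<open>Size of the quotient in terms of the convex hull\<close>

lemma Ediv_eq_Epow: "Ediv F z = Epow F z 1"
  unfolding Ediv_def Epow_def by auto

text \<open>If every point of \<open>F\<close> had a larger product with x than \<xi>, the open
  half-space containing them would contain the whole hull, and \<xi> itself. So a single summand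
  already dominates.\<close>

lemma exp_inner_le_wsum:
  assumes "finite F" "\<xi> \<in> convex hull F"
  shows "exp (- (x \<bullet> \<xi>)) \<le> (\<Sum>i\<in>F. exp (- (x \<bullet> i)))"
proof -
  have "\<exists>i\<in>F. x \<bullet> i \<le> x \<bullet> \<xi>"
  proof (rule ccontr)
    assume "\<not> (\<exists>i\<in>F. x \<bullet> i \<le> x \<bullet> \<xi>)"
    then have "F \<subseteq> {y. x \<bullet> y > x \<bullet> \<xi>}" by auto
    then have "convex hull F \<subseteq> {y. x \<bullet> y > x \<bullet> \<xi>}"
      by (rule hull_minimal) (rule convex_halfspace_gt)
    then show False using assms(2) by auto
  qed
  then obtain i where i: "i \<in> F" "x \<bullet> i \<le> x \<bullet> \<xi>" by blast
  then have "exp (- (x \<bullet> \<xi>)) \<le> exp (- (x \<bullet> i))" by simp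
  also have "\<dots> \<le> (\<Sum>i\<in>F. exp (- (x \<bullet> i)))"
    using i assms(1) by (intro member_le_sum) auto
  finally show ?thesis .
qed

lemma cmod_Ediv: "finite F \<Longrightarrow> F \<noteq> {} \<Longrightarrow> cmod (Ediv F z x) = exp (- (x \<bullet> Rev z)) / (\<Sum>i\<in>F. exp (- (x \<bullet> i)))"
  unfolding Ediv_def by (simp add: norm_mult norm_inverse cmod_expm cmod_wsum divide_inverse)

lemma cmod_Ediv_le_1:
  assumes "finite F" "F \<noteq> {}" "Rev z \<in> convex hull F"
  shows "cmod (Ediv F z x) \<le> 1"
  using exp_inner_le_wsum[OF assms(1,3), of x] wsum_sum_pos[OF assms(1,2), of x]
  unfolding cmod_Ediv[OF assms(1,2)] by (simp add: divide_le_eq)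

lemma cmod_Ediv_decay:
  assumes F: "finite F" "F \<noteq> {}" and e: "cball \<xi>0 (2 * e) \<subseteq> convex hull F" "e \<ge> 0" and z: "dist (Rev z) \<xi>0 \<le> e"
  shows "cmod (Ediv F z x) \<le> exp (- e * norm x)"
proof -
  \<comment> \<open>\<open>Rev z\<close> is pushed by e in the direction in which the exponential
    grows; the point stays in the ball of radius 2 e, and the push is worth e^(e |x|). At x = 0 the
    division yields 0 and \<xi> is \<open>Rev z\<close>.\<close>
  define \<xi> where "\<xi> = Rev z - (e / norm x) *\<^sub>R x"
  have "dist \<xi> (Rev z) \<le> e" unfolding \<xi>_def dist_norm using e(2) by simp
  then have "dist \<xi> \<xi>0 \<le> 2 * e" using z dist_triangle[of \<xi> \<xi>0 "Rev z"] by simp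
  then have "\<xi> \<in> convex hull F" using e by (auto simp: dist_commute)
  then have "exp (- (x \<bullet> \<xi>)) \<le> (\<Sum>i\<in>F. exp (- (x \<bullet> i)))" by (rule exp_inner_le_wsum[OF F(1)])
  moreover have "x \<bullet> \<xi> = x \<bullet> Rev z - e * norm x"
    unfolding \<xi>_def inner_diff_right by (cases "x = 0") (auto simp: dot_square_norm power2_eq_square)
  ultimately have "exp (- (x \<bullet> Rev z)) * exp (e * norm x) \<le> (\<Sum>i\<in>F. exp (- (x \<bullet> i)))"
    by (simp add: exp_add[symmetric])
  then show ?thesis
    unfolding cmod_Ediv[OF F] using wsum_sum_pos[OF F, of x] by (simp add: divide_le_eq exp_minus field_simps)
qed

text \<open>A small box around the point fits into the open hull and is itself the hull of finitely
  many points. By Caratheodory each of these is a convex combination of finitely many points of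
  \<open>B\<close>, and \<open>F\<close> collects them all.\<close>

lemma convex_hull_finite_cball:
  fixes B :: "(real^'n::finite) set"
  assumes "open B" "\<xi>0 \<in> convex hull B"
  shows "\<exists>F e. finite F \<and> F \<noteq> {} \<and> F \<subseteq> B \<and> e > 0 \<and> cball \<xi>0 (2 * e) \<subseteq> convex hull F"
proof -
  have "open (convex hull B)" using assms(1) by (rule open_convex_hull)
  then obtain a b where ab: "cbox a b \<subseteq> convex hull B" "\<xi>0 \<in> box a b"
    using open_contains_cbox[OF _ assms(2)] by metis
  have "polytope (cbox a b)" by (rule polytope_interval)
  then obtain V where V: "finite V" "cbox a b = convex hull V" unfolding polytope_def by blast
  have "\<exists>S. finite S \<and> S \<subseteq> B \<and> v \<in> convex hull S" if "v \<in> V" for v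
  proof -
    have "v \<in> convex hull B" using V ab that hull_subset[of V convex] by blast
    then show ?thesis unfolding caratheodory[of B] by blast
  qed
  then obtain S where S: "\<And>v. v \<in> V \<Longrightarrow> finite (S v) \<and> S v \<subseteq> B \<and> v \<in> convex hull (S v)" by metis
  define F where "F = (\<Union>v\<in>V. S v)"
  have "V \<subseteq> convex hull F"
  proof
    fix v assume v: "v \<in> V"
    then have "S v \<subseteq> F" unfolding F_def by blast
    then show "v \<in> convex hull F" using S[OF v] hull_mono by blast
  qed
  then have sub: "cbox a b \<subseteq> convex hull F"
    unfolding V(2) by (rule hull_minimal) (rule convex_convex_hull)
  obtain d where d: "d > 0" "cball \<xi>0 d \<subseteq> box a b"
    using ab(2) open_box open_contains_cball by blast
  then have "cball \<xi>0 d \<subseteq> convex hull F" using sub box_subset_cbox[of a b] by (meson subset_trans)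
  then have "cball \<xi>0 (2 * (d / 2)) \<subseteq> convex hull F" by simp
  moreover have "finite F" "F \<subseteq> B" unfolding F_def using V S by auto
  moreover have "F \<noteq> {}" using sub ab(2) box_subset_cbox[of a b] by auto
  moreover have "d / 2 > 0" using d by simp
  ultimately show ?thesis by blast
qed

section \<open>Exponential multipliers and the representation over the convex hull\<close>

context weights
begin

lemma pbound_expm:
  assumes "h > 0"
  shows "\<exists>C>0. \<forall>z x. (\<forall>j. cmod (z $ j) \<le> R) \<longrightarrow> pbound M (expm z) x (C * cmod (expm z x)) h"
proof -
  obtain C where C: "C > 0" "\<And>n. (\<bar>R\<bar> / h) ^ n \<le> C * M n" using power_le[of "\<bar>R\<bar> / h"] assms by auto
  have "pbound M (expm z) x (C * cmod (expm z x)) h" if "\<forall>j. cmod (z $ j) \<le> R" for z :: "complex^'a" and x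
    unfolding pbound_def
  proof
    fix js
    have "cmod (Dl js (expm z) x) \<le> \<bar>R\<bar> ^ length js * cmod (expm z x)"
      using that by (intro cmod_Dl_expm_le) (meson abs_ge_self order_trans)
    also have "\<bar>R\<bar> ^ length js \<le> C * M (length js) * h ^ length js"
      using C(2)[of "length js"] assms by (simp add: power_divide divide_le_eq)
    finally show "cmod (Dl js (expm z) x) \<le> C * cmod (expm z x) * h ^ length js * M (length js)"
      by (simp add: mult_right_mono mult_ac)
  qed
  with C(1) show ?thesis by blast
qed

lemma mult_local_expm: "mult_local (expm z)"
  unfolding mult_local_def
proof (intro conjI smooth_expm allI impI)
  fix K :: "(real^'a) set" and h :: real assume K: "compact K" and h: "h > 0"
  obtain C where C: "C > 0" "\<And>x. pbound M (expm z) x (C * cmod (expm z x)) h"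
    using pbound_expm[OF h, of "norm z"] Finite_Cartesian_Product.norm_nth_le[of z] by blast
  have "bounded (expm z ` K)" by (intro compact_imp_bounded compact_continuous_image continuous_on_expm K)
  then obtain b where b: "\<And>x. x \<in> K \<Longrightarrow> cmod (expm z x) \<le> b" unfolding bounded_iff by auto
  have "pbound M (expm z) x (C * b) h" if "x \<in> K" for x
    using C b[OF that] h by (intro pbound_mono[OF C(2)[of x]]) (auto intro: mult_left_mono)
  then show "\<exists>C. \<forall>x\<in>K. pbound M (expm z) x C h" by blast
qed

text \<open>The bound is relative to the modulus of the function, so its decay is inherited by all
  derivatives; the scale h is arbitrary because factorials are dominated by
  \<open>M\<close>.\<close>

lemma pbound_Ediv:
  fixes F :: "(real^'n::finite) set"
  assumes F: "finite F" "F \<noteq> {}" and h: "h > 0"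
  shows "\<exists>C>0. \<forall>z x. (\<forall>j. cmod (z $ j) \<le> R) \<longrightarrow> pbound M (Ediv F z) x (C * cmod (Ediv F z x)) h"
proof -
  have "bounded F" using F(1) by (rule finite_imp_bounded)
  then obtain R1 where R1: "\<And>i. i \<in> F \<Longrightarrow> norm i \<le> R1" unfolding bounded_iff by blast
  define Q where "Q = max \<bar>R\<bar> R1"
  have Q: "Q \<ge> 0" "Q \<ge> R" "Q \<ge> R1" unfolding Q_def by auto
  have iQ: "\<bar>i $ j\<bar> \<le> Q" if "i \<in> F" for i j
    using R1[OF that] Q component_le_norm_cart[of i j] by linarith
  \<comment> \<open>Of the factor 4 Q per derivative, 2 Q comes from \<open>cmod_Dl_Epow_le\<close>
    and 2 from (n+1)! \<le> 2^n n!; the division by h makes room for h^n.\<close>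
  obtain C where C: "C > 0" "\<And>n. fact n * (4 * Q / h) ^ n \<le> C * M n" using fact_le[of "4 * Q / h"] Q h by auto
  have "pbound M (Ediv F z) x (C * cmod (Ediv F z x)) h" if z: "\<forall>j. cmod (z $ j) \<le> R" for z x
    unfolding pbound_def
  proof
    fix js :: "'n list"
    let ?n = "length js"
    have "cmod (z $ j) \<le> Q * real 1" for j using z Q by (metis mult.right_neutral of_nat_1 order_trans)
    then have "cmod (Dl js (Ediv F z) x) \<le> (2 * Q) ^ ?n * (fact (1 + ?n) / fact 1) * cmod (Ediv F z x)"
      unfolding Ediv_eq_Epow by (intro cmod_Dl_Epow_le[OF F iQ])
    also have "(2 * Q) ^ ?n * (fact (1 + ?n) / fact 1) \<le> (2 * Q) ^ ?n * (2 ^ ?n * fact ?n)"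
    proof (intro mult_left_mono)
      have "1 + ?n \<le> 2 ^ ?n" by (induct js) auto
      then have "real (1 + ?n) \<le> 2 ^ ?n" by (metis of_nat_le_iff of_nat_numeral of_nat_power)
      then show "fact (1 + ?n) / fact 1 \<le> (2 ^ ?n * fact ?n :: real)" by (simp add: mult_right_mono)
    qed (use Q in auto)
    also have "\<dots> = (fact ?n * (4 * Q / h) ^ ?n) * h ^ ?n"
    proof -
      have "4 * Q = (2 * Q) * 2" by simp
      then have "(4 * Q) ^ ?n = (2 * Q) ^ ?n * 2 ^ ?n" by (metis power_mult_distrib)
      moreover have "(4 * Q / h) ^ ?n * h ^ ?n = (4 * Q) ^ ?n" using h by (simp add: power_divide)
      ultimately have e: "(4 * Q / h) ^ ?n * h ^ ?n = (2 * Q) ^ ?n * 2 ^ ?n" by simp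
      show ?thesis unfolding mult.assoc e by (simp only: mult_ac)
    qed
    also have "\<dots> \<le> (C * M ?n) * h ^ ?n" using C(2) h by (intro mult_right_mono) auto
    finally show "cmod (Dl js (Ediv F z) x) \<le> C * cmod (Ediv F z x) * h ^ ?n * M ?n"
      by (simp add: mult_right_mono mult_ac)
  qed
  with C(1) show ?thesis by blast
qed

lemma mult_global_Ediv:
  assumes "finite F" "F \<noteq> {}" "Rev z \<in> convex hull F"
  shows "mult_global (Ediv F z)"
  unfolding mult_global_def
proof (intro conjI smooth_Ediv assms allI impI)
  fix h :: real assume h: "h > 0"
  obtain C where C: "C > 0" "\<And>x. pbound M (Ediv F z) x (C * cmod (Ediv F z x)) h"
    using pbound_Ediv[OF assms(1,2) h, of "norm z"] Finite_Cartesian_Product.norm_nth_le[of z] by blast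
  have "pbound M (Ediv F z) x (C * 1) h" for x
    using C cmod_Ediv_le_1[OF assms] h by (intro pbound_mono[OF C(2)[of x]]) (auto intro: mult_left_mono)
  then show "\<exists>C. \<forall>x. pbound M (Ediv F z) x C h" by blast
qed

text \<open>Off the hull \<open>Ediv F z\<close> may grow exponentially. Splitting off a point of
  \<open>F\<close> writes it as a global multiplier times one exponential, and the latter is bounded
  on compact sets.\<close>

lemma mult_local_Ediv:
  assumes "finite F" "F \<noteq> {}"
  shows "mult_local (Ediv F z)"
proof -
  obtain i where i: "i \<in> F" using assms by blast
  have g: "mult_global (Ediv F (cvec i))" using i by (intro mult_global_Ediv assms) (simp add: hull_inc)
  have e: "Ediv F z = (\<lambda>x. Ediv F (cvec i) x * expm (z - cvec i) x)"
    using Ediv_add[of F "cvec i" "z - cvec i"] by auto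
  show ?thesis
    unfolding mult_local_def
  proof (intro conjI smooth_Ediv assms allI impI)
    fix K :: "(real^'a) set" and h :: real assume K: "compact K" and h: "h > 0"
    obtain C where C: "\<And>x. pbound M (Ediv F (cvec i)) x C (h / 2)"
      using g h unfolding mult_global_def by (meson half_gt_zero)
    obtain C' where C': "\<And>x. x \<in> K \<Longrightarrow> pbound M (expm (z - cvec i)) x C' (h / 2)"
      using mult_local_expm[of "z - cvec i", unfolded mult_local_def, THEN conjunct2, rule_format, OF K, of "h / 2"] h by auto
    have "pbound M (Ediv F z) x (C * C') (h / 2 + h / 2)" if "x \<in> K" for x
      unfolding e using h C'[OF that] by (intro pbound_mult smooth_Ediv assms smooth_expm C) auto
    then show "\<exists>C. \<forall>x\<in>K. pbound M (Ediv F z) x C h" by auto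
  qed
qed

text \<open>Algebraically e^(-xz) is the sum over i of e^(-xi) times \<open>Ediv F z\<close>, and
  e^(-xi) T is given by \<open>S i\<close>. The compact support of \<phi> admits every complex z
  here.\<close>

lemma ultradist_eq_sum:
  assumes T: "ultradist s M T" and F: "finite F" "F \<noteq> {}"
    and S: "\<And>i. i \<in> F \<Longrightarrow> represents_exp_mult s M T i (S i)" and \<phi>: "\<phi> \<in> Dtest s M"
  shows "T (\<lambda>x. expm z x * \<phi> x) = (\<Sum>i\<in>F. S i (\<lambda>x. Ediv F z x * \<phi> x))"
proof -
  have lin: "lin_on (Dtest s M) T" using T unfolding ultradist_def by simp
  have p: "(\<lambda>x. Ediv F z x * \<phi> x) \<in> Dtest s M" by (rule Dtest_mult[OF mult_local_Ediv[OF F] \<phi>])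
  have "(\<lambda>x. expm z x * \<phi> x) = (\<lambda>x. \<Sum>i\<in>F. expm (cvec i) x * (Ediv F z x * \<phi> x))"
    using Ediv_wsum[OF F, of _ z] by (simp add: sum_distrib_right[symmetric] mult.assoc[symmetric])
  then have "T (\<lambda>x. expm z x * \<phi> x) = (\<Sum>i\<in>F. T (\<lambda>x. expm (cvec i) x * (Ediv F z x * \<phi> x)))"
    using lin_on_sum(1)[OF lin lin_closed_Dtest F(1), of "\<lambda>i x. expm (cvec i) x * (Ediv F z x * \<phi> x)"]
      Dtest_mult[OF mult_local_expm p] by simp
  also have "\<dots> = (\<Sum>i\<in>F. S i (\<lambda>x. Ediv F z x * \<phi> x))"
    using S p unfolding represents_exp_mult_def expm_cvec by (intro sum.cong) auto
  finally show ?thesis .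
qed

text \<open>Over the hull the quotient is bounded together with its derivatives, hence a global
  multiplier, and multiplying the functionals \<open>S i\<close> by it keeps them tempered.\<close>

lemma represents_convex_hull:
  assumes T: "ultradist s M T" and F: "finite F" "F \<noteq> {}"
    and S: "\<And>i. i \<in> F \<Longrightarrow> represents_exp_mult s M T i (S i)" and \<xi>: "\<xi> \<in> convex hull F"
  shows "represents_exp_mult s M T \<xi> (\<lambda>\<phi>. \<Sum>i\<in>F. S i (\<lambda>x. Ediv F (cvec \<xi>) x * \<phi> x))"
  unfolding represents_exp_mult_def
proof (intro conjI ballI)
  have "mult_global (Ediv F (cvec \<xi>))" using \<xi> by (intro mult_global_Ediv F) simp
  then show "tempered s M (\<lambda>\<phi>. \<Sum>i\<in>F. S i (\<lambda>x. Ediv F (cvec \<xi>) x * \<phi> x))"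
    using S unfolding represents_exp_mult_def by (intro tempered_sum tempered_mult) auto
  fix \<phi> :: "real^'a \<Rightarrow> complex" assume "\<phi> \<in> Dtest s M"
  then show "(\<Sum>i\<in>F. S i (\<lambda>x. Ediv F (cvec \<xi>) x * \<phi> x)) = T (\<lambda>x. exp (- complex_of_real (x \<bullet> \<xi>)) * \<phi> x)"
    using ultradist_eq_sum[OF T F S, of \<phi> "cvec \<xi>"] unfolding expm_cvec by simp
qed

end

section \<open>The Laplace transform on a patch of the convex hull\<close>

context weights
begin

text \<open>Without boundedness the real supremum in \<open>assoc_fun\<close> would carry no
  information. Where the power is 0, the convention \<open>ln 0 = 0\<close> makes the entry
  vanish.\<close>

lemma assoc_fun_bdd: "\<rho> \<ge> 0 \<Longrightarrow> bdd_above (range (\<lambda>p. max 0 (ln (\<rho> ^ p / M p))))"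
proof -
  assume \<rho>: "\<rho> \<ge> 0"
  obtain C where C: "C > 0" "\<And>n. \<rho> ^ n \<le> C * M n" using power_le[OF \<rho>] by blast
  have "max 0 (ln (\<rho> ^ p / M p)) \<le> max 0 (ln C)" for p
  proof (cases "\<rho> ^ p = 0")
    case False
    then have "0 < \<rho> ^ p" using zero_le_power[OF \<rho>, of p] by linarith
    then have "0 < \<rho> ^ p / M p" "\<rho> ^ p / M p \<le> C" using C(2)[of p] by (auto simp: divide_le_eq)
    then show ?thesis using C(1) by (simp add: max.coboundedI2)
  next
    case True
    show ?thesis unfolding True by simp
  qed
  then show ?thesis by (rule bdd_aboveI2)
qed

lemma power_le_assoc_fun:
  assumes "\<rho> \<ge> 0" shows "\<rho> ^ p \<le> M p * exp (assoc_fun M \<rho>)"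
proof (cases "\<rho> ^ p = 0")
  case False
  then have pos: "0 < \<rho> ^ p" using zero_le_power[OF assms, of p] by linarith
  have "max 0 (ln (\<rho> ^ p / M p)) \<le> assoc_fun M \<rho>"
    unfolding assoc_fun_def by (rule cSUP_upper[OF _ assoc_fun_bdd[OF assms]]) simp
  then have "ln (\<rho> ^ p / M p) \<le> assoc_fun M \<rho>" by simp
  then have "exp (ln (\<rho> ^ p / M p)) \<le> exp (assoc_fun M \<rho>)" by (subst exp_le_cancel_iff)
  then have "\<rho> ^ p / M p \<le> exp (assoc_fun M \<rho>)" using pos by simp
  then show ?thesis by (simp add: divide_le_eq mult.commute)
next
  case True
  show ?thesis unfolding True by simp
qed

lemma assoc_fun_mono:
  assumes "0 \<le> \<rho>" "\<rho> \<le> \<rho>'" shows "assoc_fun M \<rho> \<le> assoc_fun M \<rho>'"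
  unfolding assoc_fun_def
proof (rule cSUP_mono)
  show "bdd_above (range (\<lambda>p. max 0 (ln (\<rho>' ^ p / M p))))" using assms by (intro assoc_fun_bdd) simp
  fix p
  have "max 0 (ln (\<rho> ^ p / M p)) \<le> max 0 (ln (\<rho>' ^ p / M p))"
  proof (cases "\<rho> ^ p = 0")
    case False
    then have "0 < \<rho> ^ p" using zero_le_power[OF assms(1), of p] by linarith
    moreover have "\<rho> ^ p \<le> \<rho>' ^ p" using assms by (intro power_mono) auto
    ultimately have "ln (\<rho> ^ p / M p) \<le> ln (\<rho>' ^ p / M p)" by (subst ln_le_cancel_iff) (auto simp: divide_right_mono)
    then show ?thesis by (simp add: max.coboundedI2)
  next
    case True
    show ?thesis unfolding True by simp
  qed
  then show "\<exists>q\<in>UNIV. max 0 (ln (\<rho> ^ p / M p)) \<le> max 0 (ln (\<rho>' ^ q / M q))" by blast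
qed simp

text \<open>The amplitudes \<open>A i\<close> pass unchanged from pointwise exponential decay to the
  values of the functional, because \<open>SB_of_expdecay\<close> has one constant for all
  functions.\<close>

lemma expdecay_family:
  fixes f :: "'i \<Rightarrow> real^'n::finite \<Rightarrow> complex"
  assumes S: "tempered s M S" and \<delta>: "\<delta> > 0" and f: "\<And>i. i \<in> I \<Longrightarrow> smooth_fun (f i)"
    "class_quant s (\<lambda>h. \<exists>C. \<forall>i\<in>I. \<forall>x. pbound M (f i) x (C * A i * exp (- \<delta> * norm x)) h)"
  shows "i \<in> I \<Longrightarrow> f i \<in> Stest s M" "\<exists>C. \<forall>i\<in>I. cmod (S (f i)) \<le> C * A i"
proof -
  have SB: "class_quant s (\<lambda>h. \<exists>C. \<forall>i\<in>I. SB M h (C * A i) (f i))"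
    using f(2)
  proof (rule class_quant_scale[where c=1])
    fix h :: real assume h: "h > 0" "\<exists>C. \<forall>i\<in>I. \<forall>x. pbound M (f i) x (C * A i * exp (- \<delta> * norm x)) h"
    obtain C where C: "\<forall>i\<in>I. \<forall>x. pbound M (f i) x (C * A i * exp (- \<delta> * norm x)) h" using h(2) by blast
    obtain C' where C': "\<forall>A (f :: real^'n \<Rightarrow> complex). (\<forall>x. pbound M f x (A * exp (- \<delta> * norm x)) h) \<longrightarrow> SB M h (C' * A) f"
      using SB_of_expdecay[OF \<delta> h(1)] by blast
    have "SB M (1 * h) (C' * C * A i) (f i)" if "i \<in> I" for i
      using C'[rule_format, of "f i" "C * A i"] C that by (simp add: mult.assoc)
    then show "\<exists>C. \<forall>i\<in>I. SB M (1 * h) (C * A i) (f i)" by blast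
  qed simp
  have mem: "f i \<in> Stest s M" if i: "i \<in> I" for i
  proof -
    have "class_quant s (\<lambda>h. \<exists>A. SB M h A (f i))"
      using SB by (rule class_quant_scale[where c=1]) (use i in auto)
    then show ?thesis unfolding Stest_iff using f(1)[OF i] by simp
  qed
  then show "i \<in> I \<Longrightarrow> f i \<in> Stest s M" .
  show "\<exists>C. \<forall>i\<in>I. cmod (S (f i)) \<le> C * A i"
    by (rule tempered_family[OF S mem SB])
qed

end

section \<open>Taylor estimates for exponentials\<close>

lemma cmod_cdot_le: "cmod (cdot x v) \<le> real CARD('n) * norm x * norm v" for x :: "real^'n::finite"
proof -
  have "cmod (cdot x v) \<le> (\<Sum>j\<in>(UNIV::'n set). norm x * norm v)"
    unfolding cdot_def
  proof (rule sum_norm_le)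
    fix j
    show "cmod (complex_of_real (x $ j) * v $ j) \<le> norm x * norm v"
      unfolding norm_mult norm_of_real
      by (intro mult_mono component_le_norm_cart Finite_Cartesian_Product.norm_nth_le) auto
  qed
  then show ?thesis by (simp add: mult.assoc)
qed

lemma has_pdir_cdot: "has_pdir j (\<lambda>x. cdot x v) (\<lambda>x. v $ j)"
  unfolding has_pdir_def cdot_axis
proof
  fix x
  have "((\<lambda>w. cdot x v + w * v $ j) has_field_derivative v $ j) (at (of_real 0))"
    by (auto intro!: derivative_eq_intros)
  then show "((\<lambda>t. cdot x v + complex_of_real t * v $ j) has_vector_derivative v $ j) (at 0)"
    by (rule has_vector_derivative_real_field)
qed

lemma smooth_cdot: "smooth_fun (\<lambda>x. cdot x v)"
  unfolding cdot_def by (intro smooth_sum smooth_mult smooth_coord smooth_const)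

lemma norm_Rev_le: "norm (Rev v) \<le> norm v"
  by (rule norm_le_componentwise_cart) (simp add: Rev_def abs_Re_le_cmod)

lemma Rev_add: "Rev (z + v) = Rev z + Rev v"
  unfolding Rev_def by (simp add: vec_eq_iff)

definition ivec :: "real^'n::finite \<Rightarrow> complex^'n" where
  "ivec \<eta> = (\<chi> j. \<i> * complex_of_real (\<eta> $ j))"

lemma cpt_eq: "cpt \<xi> \<eta> = cvec \<xi> + ivec \<eta>"
  unfolding cpt_def cvec_def ivec_def by (simp add: vec_eq_iff complex_eq_iff)

lemma Rev_ivec [simp]: "Rev (ivec \<eta>) = 0"
  unfolding Rev_def ivec_def by (simp add: vec_eq_iff)

lemma cmod_ivec_nth_le: "cmod (ivec \<eta> $ j) \<le> norm \<eta>"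
  unfolding ivec_def using component_le_norm_cart[of \<eta> j] by (simp add: norm_mult)

lemma cmod_expm_ivec [simp]: "cmod (expm (ivec \<eta>) x) = 1"
  unfolding cmod_expm by simp

lemma norm_exp_remainders:
  fixes c :: complex
  shows "cmod (exp (- c) - 1) \<le> exp (cmod c) * cmod c" "cmod (exp (- c) - 1 + c) \<le> exp (cmod c) * (cmod c)\<^sup>2"
proof -
  have e: "exp \<bar>Re c\<bar> \<le> exp (cmod c)" using abs_Re_le_cmod[of c] by simp
  have "cmod (exp (- c) - 1) \<le> exp \<bar>Re c\<bar> * cmod c" using Taylor_exp[of "- c" 0] by simp
  also have "\<dots> \<le> exp (cmod c) * cmod c" by (intro mult_right_mono e) auto
  finally show "cmod (exp (- c) - 1) \<le> exp (cmod c) * cmod c" .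
  have "cmod (exp (- c) - 1 + c) \<le> exp \<bar>Re c\<bar> * (cmod c)\<^sup>2"
    using Taylor_exp[of "- c" 1] by (simp add: numeral_2_eq_2 algebra_simps)
  also have "\<dots> \<le> exp (cmod c) * (cmod c)\<^sup>2" by (intro mult_right_mono e) auto
  finally show "cmod (exp (- c) - 1 + c) \<le> exp (cmod c) * (cmod c)\<^sup>2" .
qed

context weights
begin

lemma one_le_weight:
  assumes "h > 0" shows "\<exists>C>0. \<forall>n. 1 \<le> C * h ^ n * M n"
proof -
  obtain C where C: "C > 0" "\<And>n. (1 / h) ^ n \<le> C * M n" using power_le[of "1 / h"] assms by auto
  have "1 \<le> C * h ^ n * M n" for n using C(2)[of n] assms by (simp add: power_one_over field_simps)
  with C(1) show ?thesis by blast
qed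

text \<open>h^n M_n is bounded below by a positive constant, so a bound that ignores the order of
  the derivative is a bound at every scale.\<close>

lemma pbound_of_uniform:
  assumes "h > 0"
  shows "\<exists>C>0. \<forall>(f :: real^'n::finite \<Rightarrow> complex) x a. (\<forall>js. cmod (Dl js f x) \<le> a) \<longrightarrow> pbound M f x (C * a) h"
proof -
  obtain C where C: "C > 0" "\<And>n. 1 \<le> C * h ^ n * M n" using one_le_weight[OF assms] by blast
  have "pbound M f x (C * a) h" if a: "\<forall>js. cmod (Dl js f x) \<le> a" for f :: "real^'n \<Rightarrow> complex" and x a
    unfolding pbound_def
  proof
    fix js :: "'n list"
    have a0: "a \<ge> 0" using a[rule_format, of "[]"] norm_ge_zero order_trans by blast
    have "a * 1 \<le> a * (C * h ^ length js * M (length js))" using C(2) a0 by (intro mult_left_mono) auto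
    then show "cmod (Dl js f x) \<le> C * a * h ^ length js * M (length js)"
      using a[rule_format, of js] by (simp add: mult_ac)
  qed
  with C(1) show ?thesis by blast
qed

lemma pbound_cdot:
  assumes "\<delta> > 0" "h > 0"
  shows "\<exists>C. \<forall>v. \<forall>x::real^'n::finite. pbound M (\<lambda>x. cdot x v) x (C * norm v * exp (\<delta> * norm x)) h"
proof -
  define N where "N = real CARD('n)"
  define K where "K = N / \<delta> + 1"
  have K: "K \<ge> 1" unfolding K_def N_def using assms by simp
  have "\<forall>js. cmod (Dl js (\<lambda>x. cdot x v) x) \<le> K * norm v * exp (\<delta> * norm x)" for v and x :: "real^'n"
  proof
    fix js :: "'n list"
    show "cmod (Dl js (\<lambda>x. cdot x v) x) \<le> K * norm v * exp (\<delta> * norm x)"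
    proof (cases js rule: rev_cases)
      case Nil
      have "\<delta> * norm x \<le> exp (\<delta> * norm x)" using power_div_fact_le_exp[of "\<delta> * norm x" 1] assms by simp
      then have "norm x \<le> exp (\<delta> * norm x) / \<delta>" using assms by (simp add: pos_le_divide_eq mult.commute)
      then have "N * norm x * norm v \<le> N * (exp (\<delta> * norm x) / \<delta>) * norm v"
        by (intro mult_right_mono mult_left_mono) (auto simp: N_def)
      then have "cmod (cdot x v) \<le> N / \<delta> * norm v * exp (\<delta> * norm x)"
        using cmod_cdot_le[of x v] by (simp add: N_def mult_ac)
      also have "\<dots> \<le> K * norm v * exp (\<delta> * norm x)" unfolding K_def by (intro mult_right_mono) auto
      finally show ?thesis using Nil by simp
    next
      case (snoc ks j)
      have "Dl js (\<lambda>x. cdot x v) x = (if ks = [] then v $ j else 0)"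
        unfolding snoc Dl_snoc has_pdir_imp_pdir[OF has_pdir_cdot] using Dl_const_open[OF open_UNIV, of "\<lambda>x. v $ j" "v $ j" x ks] by simp
      then have "cmod (Dl js (\<lambda>x. cdot x v) x) \<le> 1 * norm v * 1"
        using Finite_Cartesian_Product.norm_nth_le[of v j] by auto
      also have "\<dots> \<le> K * norm v * exp (\<delta> * norm x)" using K assms by (intro mult_mono) auto
      finally show ?thesis .
    qed
  qed
  then show ?thesis using pbound_of_uniform[OF assms(2)] by (metis mult.assoc)
qed

text \<open>Order 0 is a second-order Taylor remainder, order 1 gives v_j times a first-order one,
  and from order 2 on each derivative supplies a factor of its own. Powers of |x| cost one
  e^(\<delta>|x|), the exponential of \<open>cdot x v\<close> at most another, since N |v| \<le>
  \<delta>.\<close>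

lemma pbound_exp_remainder:
  assumes "\<delta> > 0" "h > 0"
  shows "\<exists>C. \<forall>v. norm v \<le> 1 \<longrightarrow> real CARD('n) * norm v \<le> \<delta> \<longrightarrow>
    (\<forall>x::real^'n::finite. pbound M (\<lambda>x. expm v x - 1 + cdot x v) x (C * (norm v)\<^sup>2 * exp (2 * \<delta> * norm x)) h)"
proof -
  define N where "N = real CARD('n)"
  \<comment> \<open>One summand for each case: order 0, order 1, and the orders from 2 on.\<close>
  define K where "K = 2 * N\<^sup>2 / \<delta>\<^sup>2 + N / \<delta> + 1"
  have K: "K \<ge> 1" "K \<ge> N / \<delta>" "K \<ge> 2 * N\<^sup>2 / \<delta>\<^sup>2" unfolding K_def N_def using assms by auto
  have "\<forall>js. cmod (Dl js (\<lambda>x. expm v x - 1 + cdot x v) x) \<le> K * ((norm v)\<^sup>2 * exp (2 * \<delta> * norm x))"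
    if v: "norm v \<le> 1" "N * norm v \<le> \<delta>" for v and x :: "real^'n"
  proof
    fix js :: "'n list"
    define y where "y = \<delta> * norm x"
    have y: "y \<ge> 0" "y \<le> exp y" "y\<^sup>2 / 2 \<le> exp y"
      unfolding y_def using power_div_fact_le_exp[of "\<delta> * norm x" 1] power_div_fact_le_exp[of "\<delta> * norm x" 2] assms
      by (auto simp: numeral_2_eq_2)
    have e2: "exp (2 * \<delta> * norm x) = exp y * exp y" unfolding y_def by (simp add: exp_add[symmetric])
    have e1: "1 \<le> exp y" using y by simp
    have c: "cmod (cdot x v) \<le> N * norm x * norm v" using cmod_cdot_le[of x v] unfolding N_def .
    also have "\<dots> \<le> \<delta> * norm x" using mult_right_mono[OF v(2), of "norm x"] by (simp add: mult_ac)
    finally have cy: "cmod (cdot x v) \<le> y" unfolding y_def .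
    then have ecy: "exp (cmod (cdot x v)) \<le> exp y" by simp
    have nx: "norm x = y / \<delta>" unfolding y_def using assms by simp
    show "cmod (Dl js (\<lambda>x. expm v x - 1 + cdot x v) x) \<le> K * ((norm v)\<^sup>2 * exp (2 * \<delta> * norm x))"
    proof (cases js rule: rev_cases)
      case Nil
      have "cmod (expm v x - 1 + cdot x v) \<le> exp (cmod (cdot x v)) * (cmod (cdot x v))\<^sup>2"
        unfolding expm_def by (rule norm_exp_remainders)
      also have "\<dots> \<le> exp y * (N * norm x * norm v)\<^sup>2"
        using c ecy by (intro mult_mono power_mono) auto
      also have "\<dots> = exp y * (2 * N\<^sup>2 / \<delta>\<^sup>2 * (y\<^sup>2 / 2) * (norm v)\<^sup>2)"
        unfolding nx by (simp add: power_mult_distrib power_divide)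
      also have "\<dots> \<le> exp y * (2 * N\<^sup>2 / \<delta>\<^sup>2 * exp y * (norm v)\<^sup>2)"
        using y by (intro mult_left_mono mult_right_mono) auto
      also have "\<dots> = 2 * N\<^sup>2 / \<delta>\<^sup>2 * ((norm v)\<^sup>2 * exp (2 * \<delta> * norm x))" unfolding e2 by simp
      also have "\<dots> \<le> K * ((norm v)\<^sup>2 * exp (2 * \<delta> * norm x))" using K by (intro mult_right_mono) auto
      finally show ?thesis using Nil by simp
    next
      case (snoc ks j)
      have "has_pdir j (\<lambda>x. (expm v x + (-1)) + cdot x v) (\<lambda>x. (- (v $ j) * expm v x + 0) + v $ j)"
        by (intro has_pdir_add has_pdir_expm has_pdir_const has_pdir_cdot)
      then have "pdir j (\<lambda>x. expm v x - 1 + cdot x v) = (\<lambda>x. - (v $ j) * expm v x - - (v $ j))"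
        using has_pdir_imp_pdir by force
      then have D: "Dl js (\<lambda>x. expm v x - 1 + cdot x v) x
          = - (v $ j) * Dl ks (expm v) x - (if ks = [] then - (v $ j) else 0)"
        unfolding snoc Dl_snoc using Dl_diff[OF smooth_cmult[OF smooth_expm] smooth_const, of ks "- (v $ j)" v "- (v $ j)"]
          Dl_cmult[OF smooth_expm, of ks "- (v $ j)" v] Dl_const_open[OF open_UNIV, of "\<lambda>x. - (v $ j)" "- (v $ j)" x ks] by simp
      have vj: "cmod (v $ j) \<le> norm v" by (rule Finite_Cartesian_Product.norm_nth_le)
      show ?thesis
      proof (cases "ks = []")
        case True
        have "cmod (Dl js (\<lambda>x. expm v x - 1 + cdot x v) x) = cmod (v $ j * (expm v x - 1))"
          unfolding D by (simp add: True algebra_simps norm_minus_commute)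
        also have "\<dots> \<le> norm v * (exp y * (N * norm x * norm v))"
          unfolding norm_mult
        proof (intro mult_mono vj)
          have "cmod (expm v x - 1) \<le> exp (cmod (cdot x v)) * cmod (cdot x v)"
            unfolding expm_def by (rule norm_exp_remainders)
          also have "\<dots> \<le> exp y * (N * norm x * norm v)" using c ecy by (intro mult_mono) auto
          finally show "cmod (expm v x - 1) \<le> exp y * (N * norm x * norm v)" .
        qed auto
        also have "\<dots> = N / \<delta> * (norm v)\<^sup>2 * (y * exp y)"
          unfolding nx by (simp add: power2_eq_square)
        also have "\<dots> \<le> K * (norm v)\<^sup>2 * (exp y * exp y)"
          using K y by (intro mult_mono) (auto simp: N_def)
        finally show ?thesis unfolding e2 by (simp add: mult.assoc)
      next
        case False
        have "cmod (Dl js (\<lambda>x. expm v x - 1 + cdot x v) x) = cmod (v $ j) * cmod (Dl ks (expm v) x)"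
          unfolding D using False by (simp add: norm_mult)
        also have "\<dots> \<le> norm v * (norm v ^ length ks * cmod (expm v x))"
          by (intro mult_mono vj cmod_Dl_expm_le Finite_Cartesian_Product.norm_nth_le) auto
        also have "\<dots> = norm v ^ Suc (length ks) * cmod (expm v x)" by simp
        also have "\<dots> \<le> (norm v)\<^sup>2 * exp (2 * \<delta> * norm x)"
        proof (intro mult_mono)
          show "norm v ^ Suc (length ks) \<le> (norm v)\<^sup>2"
            using v False by (intro power_decreasing) (cases ks; simp)+
          have "cmod (expm v x) \<le> exp (cmod (cdot x v))"
            unfolding expm_def norm_exp_eq_Re using abs_Re_le_cmod[of "cdot x v"] by simp
          also have "\<dots> \<le> exp y * exp y" using ecy e1 mult_mono[of 1 "exp y" "exp (cmod (cdot x v))" "exp y"] by simp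
          finally show "cmod (expm v x) \<le> exp (2 * \<delta> * norm x)" unfolding e2 .
        qed auto
        also have "\<dots> \<le> K * ((norm v)\<^sup>2 * exp (2 * \<delta> * norm x))"
          using mult_right_mono[OF K(1), of "(norm v)\<^sup>2 * exp (2 * \<delta> * norm x)"] by simp
        finally show ?thesis .
      qed
    qed
  qed
  moreover obtain C where "C > 0" "\<forall>(f :: real^'n \<Rightarrow> complex) x a. (\<forall>js. cmod (Dl js f x) \<le> a) \<longrightarrow> pbound M f x (C * a) h"
    using pbound_of_uniform[OF assms(2)] by blast
  ultimately have "\<forall>v. norm v \<le> 1 \<longrightarrow> N * norm v \<le> \<delta> \<longrightarrow>
    (\<forall>x::real^'n. pbound M (\<lambda>x. expm v x - 1 + cdot x v) x (C * (K * ((norm v)\<^sup>2 * exp (2 * \<delta> * norm x)))) h)"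
    by blast
  then have "\<forall>v. norm v \<le> 1 \<longrightarrow> N * norm v \<le> \<delta> \<longrightarrow>
    (\<forall>x::real^'n. pbound M (\<lambda>x. expm v x - 1 + cdot x v) x ((C * K) * (norm v)\<^sup>2 * exp (2 * \<delta> * norm x)) h)"
    by (simp only: mult.assoc)
  then show ?thesis unfolding N_def by blast
qed

text \<open>Where the sequence diverges \<open>lim\<close> is arbitrary; over the hull convergence
  is part of \<open>laplace_eq\<close>.\<close>

definition laplace :: "((real^'n::finite \<Rightarrow> complex) \<Rightarrow> complex) \<Rightarrow> (nat \<Rightarrow> real^'n \<Rightarrow> complex) \<Rightarrow> complex^'n \<Rightarrow> complex" where
  "laplace T \<kappa> z = lim (\<lambda>n. T (\<lambda>x. expm z x * \<kappa> n x))"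

end

text \<open>The data around one point \<xi>0 of the hull. The tube in use is |Re z - \<xi>0| \<le>
  e; the other half of the radius 2 e is kept for the decay e^(-e|x|).\<close>

locale exp_patch = weights M c0 H
  for M :: "nat \<Rightarrow> real" and c0 H :: real +
  fixes s :: utype and T :: "(real^'n::finite \<Rightarrow> complex) \<Rightarrow> complex" and F :: "(real^'n) set"
    and \<xi>0 :: "real^'n" and e :: real and S :: "real^'n \<Rightarrow> (real^'n \<Rightarrow> complex) \<Rightarrow> complex"
  assumes T: "ultradist s M T" and F: "finite F" "F \<noteq> {}" and e: "e > 0"
    and hull: "cball \<xi>0 (2 * e) \<subseteq> convex hull F"
    and S: "\<And>i. i \<in> F \<Longrightarrow> represents_exp_mult s M T i (S i)"
begin

definition SF :: "(real^'n \<Rightarrow> complex) \<Rightarrow> complex" where "SF \<phi> = (\<Sum>i\<in>F. S i \<phi>)"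

lemma tempered_SF: "tempered s M SF"
  unfolding SF_def[abs_def] using S unfolding represents_exp_mult_def by (intro tempered_sum) auto

lemma lin_on_SF: "lin_on (Stest s M) SF"
  using tempered_SF unfolding tempered_iff by simp

lemma mem_hull: "dist \<xi> \<xi>0 \<le> e \<Longrightarrow> \<xi> \<in> convex hull F"
proof -
  assume "dist \<xi> \<xi>0 \<le> e"
  then have "\<xi> \<in> cball \<xi>0 (2 * e)" using e by (simp add: dist_commute)
  then show ?thesis using hull by blast
qed

text \<open>The factor \<open>g i\<close> may use up half of the decay of the quotient; the other
  half still puts the product into the test space. Linear forms, Taylor remainders and Fourier
  transforms all enter as such factors.\<close>

lemma Ediv_family:
  assumes z: "\<And>i. i \<in> I \<Longrightarrow> dist (Rev (z i)) \<xi>0 \<le> e" "\<And>i j. i \<in> I \<Longrightarrow> cmod (z i $ j) \<le> R"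
    and g: "\<And>i. i \<in> I \<Longrightarrow> smooth_fun (g i)"
      "class_quant s (\<lambda>h. \<exists>C. \<forall>i\<in>I. \<forall>x. pbound M (g i) x (C * A i * exp (e / 2 * norm x)) h)"
  shows "i \<in> I \<Longrightarrow> (\<lambda>x. Ediv F (z i) x * g i x) \<in> Stest s M"
    "\<exists>C. \<forall>i\<in>I. cmod (SF (\<lambda>x. Ediv F (z i) x * g i x)) \<le> C * A i"
proof -
  have b: "class_quant s (\<lambda>h. \<exists>C. \<forall>i\<in>I. \<forall>x. pbound M (\<lambda>x. Ediv F (z i) x * g i x) x (C * A i * exp (- (e / 2) * norm x)) h)"
    using g(2)
  proof (rule class_quant_scale[where c=2])
    fix h :: real
    assume h: "h > 0" "\<exists>C. \<forall>i\<in>I. \<forall>x. pbound M (g i) x (C * A i * exp (e / 2 * norm x)) h"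
    obtain C where C: "\<forall>i\<in>I. \<forall>x. pbound M (g i) x (C * A i * exp (e / 2 * norm x)) h"
      using h(2) by blast
    obtain C' where C': "C' > 0" "\<forall>z x. (\<forall>j. cmod (z $ j) \<le> R) \<longrightarrow> pbound M (Ediv F z) x (C' * cmod (Ediv F z x)) h"
      using pbound_Ediv[OF F h(1), of R] by blast
    have "pbound M (\<lambda>x. Ediv F (z i) x * g i x) x (C' * C * A i * exp (- (e / 2) * norm x)) (2 * h)"
      if i: "i \<in> I" for i x
    proof -
      have gi: "pbound M (g i) x (C * A i * exp (e / 2 * norm x)) h" using C i by blast
      have "pbound M (Ediv F (z i)) x (C' * cmod (Ediv F (z i) x)) h" using C'(2) z(2)[OF i] by blast
      from pbound_mult[OF smooth_Ediv[OF F] g(1)[OF i] this gi] h(1)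
      have p: "pbound M (\<lambda>x. Ediv F (z i) x * g i x) x
          (C' * cmod (Ediv F (z i) x) * (C * A i * exp (e / 2 * norm x))) (2 * h)"
        unfolding mult_2 by simp
      have nn: "C * A i * exp (e / 2 * norm x) \<ge> 0" using pbound_nonneg[OF gi] by simp
      have "C' * cmod (Ediv F (z i) x) * (C * A i * exp (e / 2 * norm x))
          \<le> C' * exp (- e * norm x) * (C * A i * exp (e / 2 * norm x))"
        using C'(1) cmod_Ediv_decay[OF F hull _ z(1)[OF i], of x] e nn
        by (intro mult_right_mono mult_left_mono) auto
      also have "\<dots> = C' * C * A i * (exp (- e * norm x) * exp (e / 2 * norm x))" by simp
      also have "exp (- e * norm x) * exp (e / 2 * norm x) = exp (- (e / 2) * norm x)"
        by (simp add: exp_add[symmetric] field_simps)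
      finally show ?thesis
        using h C'(1) nn by (intro pbound_mono[OF p]) auto
    qed
    then show "\<exists>C. \<forall>i\<in>I. \<forall>x. pbound M (\<lambda>x. Ediv F (z i) x * g i x) x (C * A i * exp (- (e / 2) * norm x)) (2 * h)"
      by blast
  qed simp
  have sm: "smooth_fun (\<lambda>x. Ediv F (z i) x * g i x)" if "i \<in> I" for i
    by (intro smooth_mult smooth_Ediv F g that)
  have e2: "e / 2 > 0" using e by simp
  show "i \<in> I \<Longrightarrow> (\<lambda>x. Ediv F (z i) x * g i x) \<in> Stest s M"
    "\<exists>C. \<forall>i\<in>I. cmod (SF (\<lambda>x. Ediv F (z i) x * g i x)) \<le> C * A i"
    using expdecay_family[OF tempered_SF e2, of I "\<lambda>i x. Ediv F (z i) x * g i x" A, OF sm b] by blast+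
qed

lemma Ediv_mem: "dist (Rev z) \<xi>0 \<le> e \<Longrightarrow> Ediv F z \<in> Stest s M"
proof -
  assume z: "dist (Rev z) \<xi>0 \<le> e"
  have "(\<lambda>x. Ediv F z x * (\<lambda>x. 1) x) \<in> Stest s M"
  proof (rule Ediv_family(1)[of "{()}" "\<lambda>_. z" "norm z" "\<lambda>_ x. 1" "\<lambda>_. 1", OF _ _ _ class_quant_all])
    fix h :: real assume h: "h > 0"
    have "pbound M (\<lambda>x. 1) x (1 * 1 * exp (e / 2 * norm x)) h" for x :: "real^'n"
      using pbound_const[of h 1 x] h e by (auto elim!: pbound_mono)
    then show "\<exists>C. \<forall>i\<in>{()}. \<forall>x. pbound M (\<lambda>x. 1) x (C * 1 * exp (e / 2 * norm (x :: real^'n))) h" by blast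
  qed (use z in \<open>auto intro: smooth_const Finite_Cartesian_Product.norm_nth_le\<close>)
  then show ?thesis by simp
qed

lemma laplace_eq:
  assumes "cutoffs \<kappa>" "dist (Rev z) \<xi>0 \<le> e"
  shows "laplace T \<kappa> z = SF (Ediv F z)"
proof -
  have "(\<lambda>n. SF (\<lambda>x. \<kappa> n x * Ediv F z x)) \<longlonglongrightarrow> SF (Ediv F z)"
    by (rule tempered_cutoff_tendsto[OF tempered_SF assms(1) Ediv_mem[OF assms(2)]])
  moreover have "T (\<lambda>x. expm z x * \<kappa> n x) = SF (\<lambda>x. \<kappa> n x * Ediv F z x)" for n
    using ultradist_eq_sum[OF T F S cutoff_Dtest[OF assms(1)], of z n]
    unfolding SF_def by (simp add: mult.commute)
  ultimately show ?thesis unfolding laplace_def by (simp add: limI)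
qed

text \<open>The scale h is shared equally between the quotient at the real part and e^(-ix\<eta>).
  Writing |\<eta>|^n = (2|\<eta>|/h)^n (h/2)^n gives the rate k = 2/h, so that some h yields some k
  and all h yield all k.\<close>

lemma laplace_growth:
  assumes \<kappa>: "cutoffs \<kappa>" and h: "h > 0" "est s M SF h"
  shows "\<exists>C. \<forall>\<xi>\<in>cball \<xi>0 e. \<forall>\<eta>. cmod (laplace T \<kappa> (cpt \<xi> \<eta>)) \<le> C * exp (assoc_fun M (2 / h * norm \<eta>))"
proof -
  obtain C where C: "\<forall>\<phi>\<in>Stest s M. \<forall>A. SB M h A \<phi> \<longrightarrow> cmod (SF \<phi>) \<le> C * A" using h(2) unfolding est_def by blast
  obtain C1 where C1: "C1 > 0"
    "\<forall>z x. (\<forall>j. cmod (z $ j) \<le> norm \<xi>0 + e) \<longrightarrow> pbound M (Ediv F z) x (C1 * cmod (Ediv F z x)) (h / 2)"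
    using pbound_Ediv[OF F, of "h / 2" "norm \<xi>0 + e"] h by auto
  obtain C2 where C2: "C2 > 0"
    "\<forall>A (f :: real^'n \<Rightarrow> complex). (\<forall>x. pbound M f x (A * exp (- e * norm x)) h) \<longrightarrow> SB M h (C2 * A) f"
    using SB_of_expdecay[OF e h(1)] by blast
  have "cmod (laplace T \<kappa> (cpt \<xi> \<eta>)) \<le> C * C2 * C1 * exp (assoc_fun M (2 / h * norm \<eta>))"
    if \<xi>: "\<xi> \<in> cball \<xi>0 e" for \<xi> \<eta>
  proof -
    let ?A = "exp (assoc_fun M (2 / h * norm \<eta>))"
    have d: "dist (Rev (cpt \<xi> \<eta>)) \<xi>0 \<le> e" "dist (Rev (cvec \<xi>)) \<xi>0 \<le> e"
      using \<xi> unfolding cpt_eq Rev_add by (auto simp: dist_commute)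
    have "norm \<xi> \<le> norm \<xi>0 + e" using \<xi> norm_triangle_ineq2[of \<xi> \<xi>0] by (simp add: dist_norm norm_minus_commute)
    then have cj: "\<forall>j. cmod (cvec \<xi> $ j) \<le> norm \<xi>0 + e"
      using component_le_norm_cart[of \<xi>] unfolding cvec_def by (auto intro: order_trans)
    have "pbound M (Ediv F (cpt \<xi> \<eta>)) x (C1 * ?A * exp (- e * norm x)) h" for x
    proof -
      have p1: "pbound M (expm (ivec \<eta>)) x ?A (h / 2)"
        unfolding pbound_def
      proof
        fix js :: "'n list"
        let ?n = "length js"
        have "(2 / h * norm \<eta>) ^ ?n \<le> M ?n * ?A" using h by (intro power_le_assoc_fun) auto
        then have "(2 / h * norm \<eta>) ^ ?n * (h / 2) ^ ?n \<le> M ?n * ?A * (h / 2) ^ ?n"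
          using h by (intro mult_right_mono) auto
        then have "norm \<eta> ^ ?n \<le> ?A * (h / 2) ^ ?n * M ?n"
          using h unfolding power_mult_distrib[symmetric] by (simp add: mult_ac)
        then show "cmod (Dl js (expm (ivec \<eta>)) x) \<le> ?A * (h / 2) ^ ?n * M ?n"
          using cmod_Dl_expm_le[OF cmod_ivec_nth_le[of \<eta>], of js x] by simp
      qed
      have "pbound M (Ediv F (cvec \<xi>)) x (C1 * cmod (Ediv F (cvec \<xi>) x)) (h / 2)" using C1(2) cj by blast
      from pbound_mult[OF smooth_Ediv[OF F] smooth_expm this p1] h
      have p: "pbound M (Ediv F (cpt \<xi> \<eta>)) x (C1 * cmod (Ediv F (cvec \<xi>) x) * ?A) h"
        unfolding cpt_eq Ediv_add[abs_def] by simp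
      have "C1 * cmod (Ediv F (cvec \<xi>) x) * ?A \<le> C1 * exp (- e * norm x) * ?A"
        using C1(1) cmod_Ediv_decay[OF F hull _ d(2), of x] e by (intro mult_right_mono mult_left_mono) auto
      then show ?thesis using h C1(1) by (intro pbound_mono[OF p]) (auto simp: mult_ac)
    qed
    then have "SB M h (C2 * (C1 * ?A)) (Ediv F (cpt \<xi> \<eta>))" using C2(2) by blast
    then have "cmod (SF (Ediv F (cpt \<xi> \<eta>))) \<le> C * (C2 * (C1 * ?A))" using C Ediv_mem[OF d(1)] by blast
    then show ?thesis unfolding laplace_eq[OF \<kappa> d(1)] by (simp add: mult.assoc)
  qed
  then show ?thesis by blast
qed

text \<open>Only the centre of a patch is treated, since every point of the hull is the centre of
  one. The functional is O(|v|^2) on the remainder of e^(-xv), and complex linearity of the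
  derivative comes from that of \<open>cdot\<close> in v.\<close>

lemma laplace_holomorphic:
  assumes \<kappa>: "cutoffs \<kappa>" and z: "Rev z = \<xi>0"
  shows "\<exists>L. (laplace T \<kappa> has_derivative L) (at z) \<and> (\<forall>v. L (\<chi> j. \<i> * v $ j) = \<i> * L v)"
proof -
  define N where "N = real CARD('n)"
  have N: "N > 0" unfolding N_def by simp
  \<comment> \<open>Three demands: |v| \<le> 1 for the remainder estimate, z + v in the patch, and N
    |v| \<le> e/4 so that the remainder grows at most like e^(e|x|/2).\<close>
  define \<epsilon> where "\<epsilon> = min (min 1 e) (e / 4 / N)"
  have \<epsilon>: "\<epsilon> > 0" "\<epsilon> \<le> 1" "\<epsilon> \<le> e" "\<epsilon> \<le> e / 4 / N" unfolding \<epsilon>_def using e N by auto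
  have \<epsilon>N: "N * \<epsilon> \<le> e / 4" using mult_left_mono[OF \<epsilon>(4), of N] N by simp
  define L where "L v = SF (\<lambda>x. Ediv F z x * - cdot x v)" for v
  have zd: "dist (Rev z) \<xi>0 \<le> e" using z e by simp
  have zj: "cmod (z $ j) \<le> norm z" for j by (rule Finite_Cartesian_Product.norm_nth_le)
  have mem: "(\<lambda>x. Ediv F z x * - cdot x v) \<in> Stest s M" for v
  proof (rule Ediv_family(1)[of UNIV "\<lambda>_. z" "norm z" "\<lambda>v x. - cdot x v" norm, OF _ _ _ class_quant_all])
    show "smooth_fun (\<lambda>x::real^'n. - cdot x v)" for v using smooth_cmult[OF smooth_cdot, of "-1" v] by simp
    fix h :: real assume h: "h > 0"
    obtain C where C: "\<forall>v. \<forall>x::real^'n. pbound M (\<lambda>x. cdot x v) x (C * norm v * exp (e / 2 * norm x)) h"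
      using pbound_cdot[of "e / 2" h] e h by auto
    have "pbound M (\<lambda>x. - cdot x v) x (C * norm v * exp (e / 2 * norm x)) h" for v and x :: "real^'n"
      using pbound_cmult[OF smooth_cdot C[rule_format, of v x], of "-1"] by simp
    then show "\<exists>C. \<forall>v\<in>UNIV. \<forall>x. pbound M (\<lambda>x. - cdot x v) x (C * norm v * exp (e / 2 * norm (x :: real^'n))) h"
      by (intro exI[of _ C] ballI allI)
  qed (use zd zj in auto)
  have add: "L (v + w) = L v + L w" for v w
    by (simp only: L_def cdot_add_right minus_add_distrib distrib_left
        lin_on_add(1)[OF lin_on_SF lin_closed_Stest mem[of v] mem[of w]])
  have scale: "L w = c * L v" if "\<And>j. w $ j = c * v $ j" for c v w
  proof -
    have "(\<lambda>x. Ediv F z x * - cdot x w) = (\<lambda>x. c * (Ediv F z x * - cdot x v))"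
      unfolding cdot_def that by (simp add: sum_distrib_left mult_ac)
    then show ?thesis using lin_on_cmult(1)[OF lin_on_SF lin_closed_Stest mem[of v], of c] unfolding L_def by simp
  qed
  have "linear L"
  proof (rule linearI)
    fix r and v :: "complex^'n"
    have "(r *\<^sub>R v) $ j = complex_of_real r * v $ j" for j
      unfolding vector_scaleR_component by (rule scaleR_conv_of_real)
    from scale[OF this] show "L (r *\<^sub>R v) = r *\<^sub>R L v" unfolding scaleR_conv_of_real[of r "L v"] .
  qed (rule add)
  then have bl: "bounded_linear L" using linear_conv_bounded_linear by blast
  have rem: "\<And>v. v \<in> {v. norm v \<le> \<epsilon>} \<Longrightarrow> (\<lambda>x. Ediv F z x * (expm v x - 1 + cdot x v)) \<in> Stest s M"
    and remb: "\<exists>C. \<forall>v\<in>{v. norm v \<le> \<epsilon>}. cmod (SF (\<lambda>x. Ediv F z x * (expm v x - 1 + cdot x v))) \<le> C * (norm v)\<^sup>2"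
  proof -
    have g: "\<exists>C. \<forall>v\<in>{v. norm v \<le> \<epsilon>}. \<forall>x::real^'n. pbound M (\<lambda>x. expm v x - 1 + cdot x v) x (C * (norm v)\<^sup>2 * exp (e / 2 * norm x)) h"
      if h: "h > 0" for h
    proof -
      have e4: "e / 4 > 0" using e by simp
      obtain C where C: "\<forall>v. norm v \<le> 1 \<longrightarrow> real CARD('n) * norm v \<le> e / 4 \<longrightarrow>
          (\<forall>x::real^'n. pbound M (\<lambda>x. expm v x - 1 + cdot x v) x (C * (norm v)\<^sup>2 * exp (2 * (e / 4) * norm x)) h)"
        using pbound_exp_remainder[OF e4 h] by blast
      have "N * norm v \<le> e / 4" if "norm v \<le> \<epsilon>" for v :: "complex^'n"
        using mult_left_mono[OF that, of N] N \<epsilon>N by linarith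
      then have "pbound M (\<lambda>x. expm v x - 1 + cdot x v) x (C * (norm v)\<^sup>2 * exp (2 * (e / 4) * norm x)) h"
        if "norm v \<le> \<epsilon>" for v and x :: "real^'n" using C that \<epsilon>(2) unfolding N_def by auto
      then show ?thesis by (intro exI[of _ C]) simp
    qed
    have sm: "smooth_fun (\<lambda>x::real^'n. expm v x - 1 + cdot x v)" for v
      by (intro smooth_add smooth_diff smooth_expm smooth_const smooth_cdot)
    show "(\<lambda>x. Ediv F z x * (expm v x - 1 + cdot x v)) \<in> Stest s M" if "v \<in> {v. norm v \<le> \<epsilon>}" for v
      using Ediv_family(1)[of "{v. norm v \<le> \<epsilon>}" "\<lambda>_. z" "norm z" "\<lambda>v x. expm v x - 1 + cdot x v" "\<lambda>v. (norm v)\<^sup>2",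
          OF zd zj sm class_quant_all[OF g] that] .
    show "\<exists>C. \<forall>v\<in>{v. norm v \<le> \<epsilon>}. cmod (SF (\<lambda>x. Ediv F z x * (expm v x - 1 + cdot x v))) \<le> C * (norm v)\<^sup>2"
      using Ediv_family(2)[of "{v. norm v \<le> \<epsilon>}" "\<lambda>_. z" "norm z" "\<lambda>v x. expm v x - 1 + cdot x v" "\<lambda>v. (norm v)\<^sup>2",
          OF zd zj sm class_quant_all[OF g]] .
  qed
  obtain C where C: "\<And>v. norm v \<le> \<epsilon> \<Longrightarrow> cmod (SF (\<lambda>x. Ediv F z x * (expm v x - 1 + cdot x v))) \<le> C * (norm v)\<^sup>2"
    using remb by auto
  have diff: "laplace T \<kappa> (z + v) - laplace T \<kappa> z - L v = SF (\<lambda>x. Ediv F z x * (expm v x - 1 + cdot x v))"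
    if v: "norm v \<le> \<epsilon>" for v
  proof -
    have "(\<lambda>x. Ediv F z x * (expm v x - 1 + cdot x v)) \<in> Stest s M" using rem v by blast
    note a1 = lin_on_add[OF lin_on_SF lin_closed_Stest this Ediv_mem[OF zd]]
    have "dist (Rev (z + v)) \<xi>0 \<le> e"
      using norm_Rev_le[of v] v \<epsilon>(3) unfolding Rev_add z by (simp add: dist_norm)
    then have "laplace T \<kappa> (z + v) = SF (Ediv F (z + v))" by (rule laplace_eq[OF \<kappa>])
    also have "Ediv F (z + v) = (\<lambda>x. (Ediv F z x * (expm v x - 1 + cdot x v) + Ediv F z x) + Ediv F z x * - cdot x v)"
      unfolding Ediv_add[abs_def] by (auto simp: algebra_simps)
    also have "SF \<dots> = (SF (\<lambda>x. Ediv F z x * (expm v x - 1 + cdot x v)) + SF (Ediv F z)) + SF (\<lambda>x. Ediv F z x * - cdot x v)"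
      by (simp only: a1(1) lin_on_add(1)[OF lin_on_SF lin_closed_Stest a1(2) mem[of v]])
    finally show ?thesis unfolding L_def laplace_eq[OF \<kappa> zd] by simp
  qed
  have lim0: "((\<lambda>v. norm (laplace T \<kappa> (z + v) - laplace T \<kappa> z - L v) / norm v) \<longlongrightarrow> 0) (at 0)"
  proof (rule tendsto_sandwich[where f="\<lambda>_. 0" and h="\<lambda>v. C * norm v"])
    have "\<forall>\<^sub>F v in at (0 :: complex^'n). norm v < \<epsilon>"
      using eventually_at[of "\<lambda>v. norm v < \<epsilon>" "0 :: complex^'n" UNIV] \<epsilon>(1) by (auto simp: dist_norm)
    then show "\<forall>\<^sub>F v in at 0. norm (laplace T \<kappa> (z + v) - laplace T \<kappa> z - L v) / norm v \<le> C * norm v"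
    proof eventually_elim
      case (elim v)
      have "norm (laplace T \<kappa> (z + v) - laplace T \<kappa> z - L v) / norm v \<le> C * (norm v)\<^sup>2 / norm v"
        using C[of v] diff[of v] elim by (intro divide_right_mono) auto
      also have "\<dots> = C * norm v" by (simp add: power2_eq_square)
      finally show ?case .
    qed
    show "((\<lambda>v. C * norm v) \<longlongrightarrow> 0) (at (0 :: complex^'n))" by (auto intro!: tendsto_eq_intros)
  qed auto
  have "(laplace T \<kappa> has_derivative L) (at z)" unfolding has_derivative_at using bl lim0 by simp
  moreover have "L (\<chi> j. \<i> * v $ j) = \<i> * L v" for v by (rule scale) simp
  ultimately show ?thesis by blast
qed

end

section \<open>Fourier transforms of rapidly decreasing functions\<close>

text \<open>This power of the bracket dominates the product of 1 + \<eta>_j^2 over all coordinates,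
  which makes \<open>jdec\<close> an integrable majorant by Fubini.\<close>

definition jdec :: "real^'n::finite \<Rightarrow> real" where
  "jdec \<eta> = 1 / jb \<eta> ^ (2 * CARD('n))"

lemma jdec_pos [simp]: "jdec \<eta> > 0" unfolding jdec_def by simp

lemma jdec_nonneg [simp]: "jdec \<eta> \<ge> 0" using jdec_pos[of \<eta>] by linarith

lemma continuous_on_jb: "continuous_on S jb"
  unfolding jb_def by (intro continuous_intros)

lemma jdec_measurable [measurable]: "jdec \<in> borel_measurable borel"
proof -
  have "continuous_on UNIV (\<lambda>\<eta>::real^'n. 1 / jb \<eta> ^ (2 * CARD('n)))"
    by (intro continuous_intros continuous_on_jb) (metis jb_pos less_irrefl power_not_zero)
  then show ?thesis unfolding jdec_def[abs_def] by (rule borel_measurable_continuous_onI)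
qed

lemma integrable_inverse_square: "integrable lborel (\<lambda>x::real. inverse (1 + x\<^sup>2))"
  using integrable_inverse_1_plus_square by (simp add: set_integrable_def einterval_def)

lemma integrable_jdec: "integrable lborel (jdec :: real^'n::finite \<Rightarrow> real)"
proof (rule integrableI_bounded)
  define f where "f b x = ennreal (inverse (1 + x\<^sup>2))" for b :: "real^'n" and x :: real
  have le: "ennreal (norm (jdec \<eta>)) \<le> (\<Prod>b\<in>Basis. f b (\<eta> \<bullet> b))" for \<eta> :: "real^'n"
  proof -
    have "(\<Prod>b\<in>(Basis::(real^'n) set). (1 + (\<eta> \<bullet> b)\<^sup>2)) \<le> (\<Prod>b\<in>(Basis::(real^'n) set). (jb \<eta>)\<^sup>2)"
    proof (intro prod_mono conjI)
      fix b :: "real^'n" assume b: "b \<in> Basis"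
      have "\<bar>\<eta> \<bullet> b\<bar> \<le> norm \<eta>" by (rule Basis_le_norm[OF b])
      then have "(\<eta> \<bullet> b)\<^sup>2 \<le> (norm \<eta>)\<^sup>2" by (metis abs_le_square_iff abs_norm_cancel)
      then show "1 + (\<eta> \<bullet> b)\<^sup>2 \<le> (jb \<eta>)\<^sup>2" unfolding jb_def by simp
    qed simp
    also have "\<dots> = jb \<eta> ^ (2 * CARD('n))" by (simp add: power_mult)
    finally have "jdec \<eta> \<le> 1 / (\<Prod>b\<in>(Basis::(real^'n) set). (1 + (\<eta> \<bullet> b)\<^sup>2))"
      unfolding jdec_def by (intro divide_left_mono) (auto intro!: prod_pos mult_pos_pos simp: add_pos_nonneg)
    also have "\<dots> = (\<Prod>b\<in>(Basis::(real^'n) set). inverse (1 + (\<eta> \<bullet> b)\<^sup>2))"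
      unfolding divide_inverse mult_1 by (rule prod_inversef[unfolded comp_def, symmetric])
    finally have "ennreal (norm (jdec \<eta>)) \<le> ennreal (\<Prod>b\<in>(Basis::(real^'n) set). inverse (1 + (\<eta> \<bullet> b)\<^sup>2))"
      by (intro ennreal_leI) (simp add: abs_of_nonneg)
    also have "\<dots> = (\<Prod>b\<in>Basis. f b (\<eta> \<bullet> b))"
      unfolding f_def by (subst prod_ennreal) auto
    finally show ?thesis .
  qed
  have fin: "(\<integral>\<^sup>+x. f b x \<partial>lborel) < \<infinity>" for b
    using integrable_inverse_square unfolding f_def integrable_iff_bounded by (simp add: abs_of_nonneg add_nonneg_nonneg)
  have "(\<integral>\<^sup>+\<eta>. ennreal (norm (jdec (\<eta> :: real^'n))) \<partial>lborel) \<le> (\<integral>\<^sup>+\<eta>. (\<Prod>b\<in>(Basis::(real^'n) set). f b (\<eta> \<bullet> b)) \<partial>lborel)"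
    by (intro nn_integral_mono le)
  also have "\<dots> = (\<Prod>b\<in>(Basis::(real^'n) set). (\<integral>\<^sup>+x. f b x \<partial>lborel))"
    by (rule nn_integral_lborel_prod) (auto simp: f_def)
  also have "\<dots> < \<infinity>"
  proof -
    have "(\<Prod>b\<in>I. (\<integral>\<^sup>+x. f b x \<partial>lborel)) < \<infinity>" for I
      by (induct I rule: infinite_finite_induct) (use fin in \<open>auto simp: ennreal_mult_less_top\<close>)
    then show ?thesis .
  qed
  finally show "(\<integral>\<^sup>+\<eta>. ennreal (norm (jdec (\<eta> :: real^'n))) \<partial>lborel) < \<infinity>" .
qed measurable

lemma integrable_of_jdec_bound:
  fixes f :: "real^'n::finite \<Rightarrow> 'b::{banach, second_countable_topology}"
  assumes "f \<in> borel_measurable lborel" "\<And>\<eta>. norm (f \<eta>) \<le> K * jdec \<eta>"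
  shows "integrable lborel f" "norm (LINT \<eta>|lborel. f \<eta>) \<le> K * (LINT \<eta>|lborel. jdec (\<eta> :: real^'n))"
proof -
  have K: "integrable lborel (\<lambda>\<eta>::real^'n. K * jdec \<eta>)" by (intro integrable_mult_right integrable_jdec)
  have "K * jdec \<eta> \<ge> 0" for \<eta> :: "real^'n" using assms(2)[of \<eta>] norm_ge_zero order_trans by blast
  then show "integrable lborel f"
    using assms by (intro Bochner_Integration.integrable_bound[OF K assms(1)]) auto
  then have "norm (LINT \<eta>|lborel. f \<eta>) \<le> (LINT \<eta>|lborel. K * jdec (\<eta> :: real^'n))"
    using assms(2) by (intro Bochner_Integration.integral_norm_bound_integral K) auto
  then show "norm (LINT \<eta>|lborel. f \<eta>) \<le> K * (LINT \<eta>|lborel. jdec (\<eta> :: real^'n))" by simp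
qed

section \<open>Fourier integrals and their derivatives\<close>

lemma cdot_ivec: "cdot x (ivec \<eta>) = \<i> * complex_of_real (x \<bullet> \<eta>)"
  unfolding cdot_def ivec_def inner_vec_def by (simp add: sum_distrib_left mult_ac)

lemma fourier_eq: "fourier \<psi> x = (LINT \<eta>|lborel. expm (ivec \<eta>) x * \<psi> \<eta>)"
  unfolding fourier_def expm_def cdot_ivec by simp

lemma continuous_on_expm_ivec: "continuous_on S (\<lambda>\<eta>. expm (ivec \<eta>) x)"
  unfolding expm_def cdot_ivec by (intro continuous_intros)

lemma expm_ivec_measurable [measurable]: "(\<lambda>\<eta>. expm (ivec \<eta>) x) \<in> borel_measurable borel"
  by (rule borel_measurable_continuous_onI[OF continuous_on_expm_ivec])

text \<open>The symbol (-i\<eta>)^\<alpha> of the iterated derivative: the eigenvalue of D^\<alpha>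
  on e^(-ix\<eta>).\<close>

definition mon :: "'n::finite list \<Rightarrow> real^'n \<Rightarrow> complex" where
  "mon js \<eta> = prod_list (map (\<lambda>j. - \<i> * complex_of_real (\<eta> $ j)) js)"

lemma mon_Nil [simp]: "mon [] \<eta> = 1" and mon_Cons: "mon (j # js) \<eta> = - \<i> * complex_of_real (\<eta> $ j) * mon js \<eta>"
  unfolding mon_def by auto

lemma smooth_mon: "smooth_fun (mon js)"
proof (induct js)
  case Nil
  show ?case using smooth_const[of 1] by (simp add: mon_def[abs_def])
next
  case (Cons j js)
  have "mon (j # js) = (\<lambda>\<eta>. - \<i> * complex_of_real (\<eta> $ j) * mon js \<eta>)" by (auto simp: mon_Cons)
  then show ?case using smooth_mult[OF smooth_cmult[OF smooth_coord, of "- \<i>" j] Cons] by simp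
qed

lemma mon_measurable [measurable]: "mon js \<in> borel_measurable borel"
  by (rule borel_measurable_continuous_onI[OF smooth_fun_continuous[OF smooth_mon]])

lemma cmod_mon_le: "cmod (mon js \<eta>) \<le> norm \<eta> ^ length js"
proof (induct js)
  case (Cons j js)
  then show ?case
    unfolding mon_Cons norm_mult using component_le_norm_cart[of \<eta> j] by (auto intro!: mult_mono)
qed simp

lemma Dl_expm_ivec: "Dl js (expm (ivec \<eta>)) = (\<lambda>x. mon js \<eta> * expm (ivec \<eta>) x)"
proof (induct js)
  case (Cons j js)
  then have "Dl (j # js) (expm (ivec \<eta>)) = (\<lambda>x. mon js \<eta> * (- (ivec \<eta> $ j) * expm (ivec \<eta>) x))"
    using has_pdir_imp_pdir[OF has_pdir_cmult[OF has_pdir_expm[of j "ivec \<eta>"], of "mon js \<eta>"]] by simp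
  then show ?case by (simp add: mon_Cons ivec_def mult_ac)
qed simp

text \<open>Wide enough for functions cut off by indicators of balls, which the exchange with the
  integral produces; the moments alone make the Fourier transform smooth.\<close>

definition moments :: "(real^'n::finite \<Rightarrow> complex) \<Rightarrow> bool" where
  "moments \<psi> \<longleftrightarrow> \<psi> \<in> borel_measurable lborel \<and> (\<forall>n. integrable lborel (\<lambda>\<eta>. norm \<eta> ^ n * cmod (\<psi> \<eta>)))"

lemma moments_integrable:
  assumes "moments \<psi>" shows "integrable lborel \<psi>"
proof -
  have "integrable lborel (\<lambda>\<eta>. norm \<eta> ^ 0 * cmod (\<psi> \<eta>))" "\<psi> \<in> borel_measurable lborel"
    using assms unfolding moments_def by blast+
  then show ?thesis using integrable_norm_iff[of \<psi> lborel] by simp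
qed

lemma moments_dominated:
  assumes "moments \<psi>" "\<phi> \<in> borel_measurable lborel" "\<And>\<eta>. cmod (\<phi> \<eta>) \<le> K * norm \<eta> ^ k * cmod (\<psi> \<eta>)"
  shows "moments \<phi>"
  unfolding moments_def
proof (intro conjI assms(2) allI)
  fix n
  have m [measurable]: "\<phi> \<in> borel_measurable borel" using assms(2) by simp
  have "integrable lborel (\<lambda>\<eta>. K * (norm \<eta> ^ (n + k) * cmod (\<psi> \<eta>)))"
    using assms(1) unfolding moments_def by simp
  then show "integrable lborel (\<lambda>\<eta>. norm \<eta> ^ n * cmod (\<phi> \<eta>))"
  proof (rule Bochner_Integration.integrable_bound)
    show "(\<lambda>\<eta>. norm \<eta> ^ n * cmod (\<phi> \<eta>)) \<in> borel_measurable lborel" by measurable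
    have "norm (norm \<eta> ^ n * cmod (\<phi> \<eta>)) \<le> norm (K * (norm \<eta> ^ (n + k) * cmod (\<psi> \<eta>)))" for \<eta>
    proof -
      have "norm \<eta> ^ n * cmod (\<phi> \<eta>) \<le> norm \<eta> ^ n * (K * norm \<eta> ^ k * cmod (\<psi> \<eta>))"
        using assms(3) by (intro mult_left_mono) auto
      also have "\<dots> = K * (norm \<eta> ^ (n + k) * cmod (\<psi> \<eta>))" by (simp add: power_add)
      finally show ?thesis by simp
    qed
    then show "AE \<eta> in lborel. norm (norm \<eta> ^ n * cmod (\<phi> \<eta>)) \<le> norm (K * (norm \<eta> ^ (n + k) * cmod (\<psi> \<eta>)))" by simp
  qed
qed

lemma moments_mon:
  assumes "moments \<psi>" shows "moments (\<lambda>\<eta>. mon js \<eta> * \<psi> \<eta>)"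
proof (rule moments_dominated[OF assms, of _ 1 "length js"])
  have [measurable]: "\<psi> \<in> borel_measurable borel" using assms unfolding moments_def by simp
  show "(\<lambda>\<eta>. mon js \<eta> * \<psi> \<eta>) \<in> borel_measurable lborel" by measurable
  show "cmod (mon js \<eta> * \<psi> \<eta>) \<le> 1 * norm \<eta> ^ length js * cmod (\<psi> \<eta>)" for \<eta>
    unfolding norm_mult by (intro mult_right_mono) (use cmod_mon_le[of js \<eta>] in auto)
qed

lemma moments_expm:
  assumes "moments \<psi>" shows "moments (\<lambda>\<eta>. expm (ivec \<eta>) x * \<psi> \<eta>)"
proof (rule moments_dominated[OF assms, of _ 1 0])
  have [measurable]: "\<psi> \<in> borel_measurable borel" using assms unfolding moments_def by simp
  show "(\<lambda>\<eta>. expm (ivec \<eta>) x * \<psi> \<eta>) \<in> borel_measurable lborel" by measurable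
qed (simp add: norm_mult)

text \<open>The exponent is imaginary, so the Taylor remainders carry no exponential factor.\<close>

lemma norm_expm_ivec_remainders:
  "cmod (expm (ivec \<eta>) (x + y) - expm (ivec \<eta>) x) \<le> \<bar>y \<bullet> \<eta>\<bar>"
  "cmod (expm (ivec \<eta>) (x + y) - expm (ivec \<eta>) x + cdot y (ivec \<eta>) * expm (ivec \<eta>) x) \<le> (y \<bullet> \<eta>)\<^sup>2"
proof -
  let ?c = "cdot y (ivec \<eta>)"
  have e: "expm (ivec \<eta>) (x + y) = expm (ivec \<eta>) x * exp (- ?c)"
    unfolding expm_def cdot_ivec by (simp add: exp_add[symmetric] algebra_simps inner_add_left)
  have c: "Re ?c = 0" "cmod ?c = \<bar>y \<bullet> \<eta>\<bar>" unfolding cdot_ivec by (auto simp: norm_mult)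
  have "expm (ivec \<eta>) (x + y) - expm (ivec \<eta>) x = expm (ivec \<eta>) x * (exp (- ?c) - 1)" unfolding e by (simp add: algebra_simps)
  then show "cmod (expm (ivec \<eta>) (x + y) - expm (ivec \<eta>) x) \<le> \<bar>y \<bullet> \<eta>\<bar>"
    using Taylor_exp[of "- ?c" 0] c by (simp add: norm_mult)
  have "expm (ivec \<eta>) (x + y) - expm (ivec \<eta>) x + ?c * expm (ivec \<eta>) x = expm (ivec \<eta>) x * (exp (- ?c) - (1 - ?c))"
    unfolding e by (simp add: algebra_simps)
  then show "cmod (expm (ivec \<eta>) (x + y) - expm (ivec \<eta>) x + ?c * expm (ivec \<eta>) x) \<le> (y \<bullet> \<eta>)\<^sup>2"
    using Taylor_exp[of "- ?c" 1] c by (simp add: norm_mult numeral_2_eq_2)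
qed

text \<open>The second-order remainder of e^(-ix\<eta>) is at most h^2 |\<eta>|^2, so the second
  absolute moment bounds the remainder of the integral.\<close>

lemma has_pdir_fourier:
  assumes \<psi>: "moments \<psi>"
  shows "has_pdir j (fourier \<psi>) (fourier (\<lambda>\<eta>. mon [j] \<eta> * \<psi> \<eta>))"
  unfolding has_pdir_def
proof
  fix x :: "real^'a"
  have [measurable]: "\<psi> \<in> borel_measurable borel" using \<psi> unfolding moments_def by simp
  have i2: "integrable lborel (\<lambda>\<eta>. (norm \<eta>)\<^sup>2 * cmod (\<psi> \<eta>))" using \<psi> unfolding moments_def by blast
  show "((\<lambda>t. fourier \<psi> (x + t *\<^sub>R axis j 1)) has_vector_derivative fourier (\<lambda>\<eta>. mon [j] \<eta> * \<psi> \<eta>) x) (at 0)"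
  proof (rule has_vector_derivative_quadratic)
    fix h :: real
    let ?y = "h *\<^sub>R axis j 1 :: real^'a"
    let ?f = "\<lambda>\<eta>. (expm (ivec \<eta>) (x + ?y) - expm (ivec \<eta>) x + cdot ?y (ivec \<eta>) * expm (ivec \<eta>) x) * \<psi> \<eta>"
    have cd: "cdot ?y (ivec \<eta>) = - (complex_of_real h * mon [j] \<eta>)" for \<eta>
      unfolding cdot_ivec mon_Cons by (simp add: inner_axis' mult_ac)
    have int: "integrable lborel (\<lambda>\<eta>. expm (ivec \<eta>) z * \<psi> \<eta>)" "integrable lborel (\<lambda>\<eta>. expm (ivec \<eta>) z * (mon [j] \<eta> * \<psi> \<eta>))" for z
      using moments_integrable moments_expm \<psi> moments_mon by blast+
    have "fourier \<psi> (x + ?y) - fourier \<psi> x - h *\<^sub>R fourier (\<lambda>\<eta>. mon [j] \<eta> * \<psi> \<eta>) x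
        = (LINT \<eta>|lborel. expm (ivec \<eta>) (x + ?y) * \<psi> \<eta> - expm (ivec \<eta>) x * \<psi> \<eta> - h *\<^sub>R (expm (ivec \<eta>) x * (mon [j] \<eta> * \<psi> \<eta>)))"
      unfolding fourier_eq using int by simp
    also have "\<dots> = (LINT \<eta>|lborel. ?f \<eta>)"
      unfolding cd by (intro Bochner_Integration.integral_cong) (auto simp: algebra_simps scaleR_conv_of_real)
    also have "norm \<dots> \<le> (LINT \<eta>|lborel. h\<^sup>2 * ((norm \<eta>)\<^sup>2 * cmod (\<psi> \<eta>)))"
    proof (rule Bochner_Integration.integral_norm_bound_integral)
      have *: "norm (?f \<eta>) \<le> h\<^sup>2 * ((norm \<eta>)\<^sup>2 * cmod (\<psi> \<eta>))" for \<eta>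
      proof -
        have "(?y \<bullet> \<eta>)\<^sup>2 \<le> h\<^sup>2 * (norm \<eta>)\<^sup>2"
          using component_le_norm_cart[of \<eta> j] by (auto simp: inner_axis' power_mult_distrib abs_le_square_iff[symmetric] intro!: mult_left_mono)
        then have "norm (expm (ivec \<eta>) (x + ?y) - expm (ivec \<eta>) x + cdot ?y (ivec \<eta>) * expm (ivec \<eta>) x) \<le> h\<^sup>2 * (norm \<eta>)\<^sup>2"
          using norm_expm_ivec_remainders(2)[of \<eta> x ?y] by linarith
        then show ?thesis unfolding norm_mult mult.assoc[symmetric] by (intro mult_right_mono) auto
      qed
      then show "norm (?f \<eta>) \<le> h\<^sup>2 * ((norm \<eta>)\<^sup>2 * cmod (\<psi> \<eta>))" for \<eta> .
      show i: "integrable lborel (\<lambda>\<eta>. h\<^sup>2 * ((norm \<eta>)\<^sup>2 * cmod (\<psi> \<eta>)))" using i2 by simp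
      show "integrable lborel ?f"
        by (rule Bochner_Integration.integrable_bound[OF i]) (use * in \<open>auto simp: cd\<close>)
    qed
    also have "\<dots> = (LINT \<eta>|lborel. (norm \<eta>)\<^sup>2 * cmod (\<psi> \<eta>)) * h\<^sup>2" by simp
    finally show "norm (fourier \<psi> (x + (0 + h) *\<^sub>R axis j 1) - fourier \<psi> (x + 0 *\<^sub>R axis j 1) - h *\<^sub>R fourier (\<lambda>\<eta>. mon [j] \<eta> * \<psi> \<eta>) x)
        \<le> (LINT \<eta>|lborel. (norm \<eta>)\<^sup>2 * cmod (\<psi> \<eta>)) * h\<^sup>2" by simp
  qed
qed

lemma continuous_on_fourier:
  assumes \<psi>: "moments \<psi>" shows "continuous_on UNIV (fourier \<psi>)"
proof -
  have [measurable]: "\<psi> \<in> borel_measurable borel" using \<psi> unfolding moments_def by simp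
  have i1: "integrable lborel (\<lambda>\<eta>. norm \<eta> ^ 1 * cmod (\<psi> \<eta>))" using \<psi> unfolding moments_def by blast
  have int: "integrable lborel (\<lambda>\<eta>. expm (ivec \<eta>) z * \<psi> \<eta>)" for z using moments_integrable moments_expm \<psi> by blast
  define K where "K = (LINT \<eta>|lborel. norm \<eta> * cmod (\<psi> \<eta>))"
  have le: "norm (fourier \<psi> y - fourier \<psi> x) \<le> K * norm (y - x)" for x y
  proof -
    have "fourier \<psi> y - fourier \<psi> x = (LINT \<eta>|lborel. (expm (ivec \<eta>) y - expm (ivec \<eta>) x) * \<psi> \<eta>)"
      unfolding fourier_eq using int by (simp add: left_diff_distrib)
    also have "norm \<dots> \<le> (LINT \<eta>|lborel. norm (y - x) * (norm \<eta> * cmod (\<psi> \<eta>)))"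
    proof (rule Bochner_Integration.integral_norm_bound_integral)
      show "integrable lborel (\<lambda>\<eta>. (expm (ivec \<eta>) y - expm (ivec \<eta>) x) * \<psi> \<eta>)" using int by (simp add: left_diff_distrib)
      show "integrable lborel (\<lambda>\<eta>. norm (y - x) * (norm \<eta> * cmod (\<psi> \<eta>)))" using i1 by simp
      show "norm ((expm (ivec \<eta>) y - expm (ivec \<eta>) x) * \<psi> \<eta>) \<le> norm (y - x) * (norm \<eta> * cmod (\<psi> \<eta>))" for \<eta>
        unfolding norm_mult mult.assoc[symmetric]
        using norm_expm_ivec_remainders(1)[of \<eta> x "y - x"] Cauchy_Schwarz_ineq2[of "y - x" \<eta>]
        by (intro mult_right_mono) auto
    qed
    finally show ?thesis unfolding K_def by (simp add: mult.commute)
  qed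
  have "K \<ge> 0" unfolding K_def by simp
  then have "K-lipschitz_on UNIV (fourier \<psi>)" using le by (auto intro!: lipschitz_onI simp: dist_norm)
  then show ?thesis by (rule lipschitz_on_continuous_on)
qed

lemma smooth_fourier: "moments \<psi> \<Longrightarrow> smooth_fun (fourier \<psi>)"
proof (rule smooth_coinduct[of _ "{fourier \<psi> |\<psi>. moments \<psi>}"])
  fix f and j :: 'a assume "f \<in> {fourier \<psi> |\<psi>. moments (\<psi> :: real^'a \<Rightarrow> complex)}"
  then obtain \<psi> where "moments \<psi>" "f = fourier \<psi>" by blast
  then show "\<exists>g\<in>{fourier \<psi> |\<psi>. moments \<psi>}. has_pdir j f g" using has_pdir_fourier moments_mon by blast
  show "continuous_on UNIV f" using \<open>moments \<psi>\<close> \<open>f = fourier \<psi>\<close> continuous_on_fourier by blast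
qed blast

lemma Dl_fourier: "moments \<psi> \<Longrightarrow> Dl js (fourier \<psi>) = fourier (\<lambda>\<eta>. mon js \<eta> * \<psi> \<eta>)"
proof (induct js)
  case (Cons j js)
  then show ?case
    using has_pdir_imp_pdir[OF has_pdir_fourier[OF moments_mon[OF Cons(2), of js], of j]]
    by (simp add: mon_Cons mult.assoc)
qed simp

section \<open>Integration by parts\<close>

definition rapid :: "(real^'n::finite \<Rightarrow> complex) \<Rightarrow> bool" where
  "rapid g \<longleftrightarrow> smooth_fun g \<and> (\<forall>ks. \<exists>C. \<forall>\<eta>. cmod (Dl ks g \<eta>) \<le> C * jdec \<eta>)"

lemma rapid_pdir: "rapid g \<Longrightarrow> rapid (pdir j g)"
  unfolding rapid_def using smooth_fun_pdir by (metis Dl_snoc)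

lemma smooth_measurable: "smooth_fun g \<Longrightarrow> g \<in> borel_measurable lborel"
  using borel_measurable_continuous_onI[OF smooth_fun_continuous] by auto

lemma rapid_integrable:
  assumes "rapid g" shows "integrable lborel g" "integrable lborel (\<lambda>\<eta>. expm (ivec \<eta>) x * g \<eta>)"
proof -
  obtain C where C: "cmod (g \<eta>) \<le> C * jdec \<eta>" for \<eta> using assms unfolding rapid_def by (metis Dl.simps(1))
  have m: "g \<in> borel_measurable lborel" using smooth_measurable assms unfolding rapid_def by blast
  then have [measurable]: "g \<in> borel_measurable borel" by simp
  show "integrable lborel g" by (rule integrable_of_jdec_bound(1)[OF m C])
  show "integrable lborel (\<lambda>\<eta>. expm (ivec \<eta>) x * g \<eta>)"
    by (rule integrable_of_jdec_bound(1)[of _ C]) (use C in \<open>auto simp: norm_mult\<close>)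
qed

text \<open>A Peetre inequality for shifts of length at most 1; it allows a majorant at a nearby
  point to be read at \<eta> itself.\<close>

lemma jb_shift_le:
  assumes "norm v \<le> 1" shows "jb \<eta> \<le> 2 * jb (\<eta> + v)"
proof -
  define a where "a = norm (\<eta> + v)"
  define n where "n = norm \<eta>"
  have "n \<le> a + 1"
    unfolding n_def a_def using norm_triangle_ineq4[of "\<eta> + v" v] assms by simp
  then have "n\<^sup>2 \<le> (a + 1)\<^sup>2" by (intro power_mono) (auto simp: n_def)
  also have "\<dots> \<le> 2 * a\<^sup>2 + 2" using sum_squares_bound[of a 1] by (simp add: power2_sum)
  finally have na: "n\<^sup>2 \<le> 2 * a\<^sup>2 + 2" .
  have "1 + p \<le> 4 * (1 + q)" if "p \<le> 2 * q + 2" "0 \<le> q" for p q :: real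
    using that by simp
  from this[OF na zero_le_power2] have "1 + n\<^sup>2 \<le> 4 * (1 + a\<^sup>2)" .
  then have "1 + (norm \<eta>)\<^sup>2 \<le> 2\<^sup>2 * (1 + (norm (\<eta> + v))\<^sup>2)" unfolding n_def a_def by simp
  then have "sqrt (1 + (norm \<eta>)\<^sup>2) \<le> sqrt (2\<^sup>2 * (1 + (norm (\<eta> + v))\<^sup>2))" by (rule real_sqrt_le_mono)
  also have "\<dots> = 2 * sqrt (1 + (norm (\<eta> + v))\<^sup>2)" by (simp only: real_sqrt_mult real_sqrt_abs abs_numeral)
  finally show ?thesis unfolding jb_def .
qed

lemma jdec_shift_le:
  fixes \<eta> v :: "real^'n::finite"
  assumes "norm v \<le> 1" shows "jdec (\<eta> + v) \<le> 4 ^ CARD('n) * jdec \<eta>"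
proof -
  have "jb \<eta> ^ (2 * CARD('n)) \<le> (2 * jb (\<eta> + v)) ^ (2 * CARD('n))"
    using jb_shift_le[OF assms, of \<eta>] by (intro power_mono) (auto simp: less_imp_le)
  also have "\<dots> = 4 ^ CARD('n) * jb (\<eta> + v) ^ (2 * CARD('n))"
    by (simp add: power_mult_distrib power_mult)
  finally show ?thesis unfolding jdec_def by (simp add: field_simps)
qed

text \<open>Two mean value estimates along the line, in which the second derivative at shifted
  points is compared with \<open>jdec \<eta>\<close>; the remainder thus keeps an integrable
  majorant.\<close>

lemma rapid_taylor:
  fixes g :: "real^'n::finite \<Rightarrow> complex"
  assumes g: "rapid g"
  shows "\<exists>C. \<forall>\<eta> t. \<bar>t\<bar> \<le> 1 \<longrightarrow> cmod (g (\<eta> + t *\<^sub>R axis j 1) - g \<eta> - t *\<^sub>R pdir j g \<eta>) \<le> C * t\<^sup>2 * jdec \<eta>"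
proof -
  obtain C where C: "\<And>\<eta>. cmod (pdir j (pdir j g) \<eta>) \<le> C * jdec \<eta>"
    using g unfolding rapid_def by (metis Dl.simps)
  have C0: "C \<ge> 0" using order_trans[OF norm_ge_zero C[of 0]] jdec_pos[of 0] by (metis linorder_not_less mult_neg_pos)
  define D where "D = C * 4 ^ CARD('n)"
  have sm: "smooth_fun g" "smooth_fun (pdir j g)" using g smooth_fun_pdir unfolding rapid_def by blast+
  have line: "((\<lambda>t. f (\<eta> + t *\<^sub>R axis j 1)) has_vector_derivative pdir j f (\<eta> + t *\<^sub>R axis j 1)) (at t within S)"
    if "smooth_fun f" for f \<eta> t S
  proof -
    have "((\<lambda>s. f ((\<eta> + t *\<^sub>R axis j 1) + s *\<^sub>R axis j 1)) has_vector_derivative pdir j f (\<eta> + t *\<^sub>R axis j 1)) (at 0)"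
      using smooth_fun_has_pdir0[OF that] unfolding has_pdir_def by blast
    then have "((\<lambda>s. f (\<eta> + (s + t) *\<^sub>R axis j 1)) has_vector_derivative pdir j f (\<eta> + t *\<^sub>R axis j 1)) (at (t - t))"
      by (simp add: scaleR_add_left algebra_simps)
    from vector_diff_chain_at[of "\<lambda>s. s - t" 1 t, OF _ this]
    have "((\<lambda>s. f (\<eta> + s *\<^sub>R axis j 1)) has_vector_derivative pdir j f (\<eta> + t *\<^sub>R axis j 1)) (at t)"
      by (simp add: comp_def has_vector_derivative_diff_const)
    then show ?thesis by (rule has_vector_derivative_at_within)
  qed
  have "cmod (g (\<eta> + t *\<^sub>R axis j 1) - g \<eta> - t *\<^sub>R pdir j g \<eta>) \<le> (3 * D) * t\<^sup>2 * jdec \<eta>" if t: "\<bar>t\<bar> \<le> 1" for \<eta> t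
  proof -
    have seg: "\<bar>s\<bar> \<le> \<bar>t\<bar>" if "s \<in> closed_segment 0 t" for s
      using segment_bound1[OF that] by simp
    have b2: "cmod (pdir j (pdir j g) (\<eta> + s *\<^sub>R axis j 1)) \<le> D * jdec \<eta>" if "s \<in> closed_segment 0 t" for s
    proof -
      have "norm (s *\<^sub>R axis j (1::real)) \<le> 1" using seg[OF that] t by simp
      then have "C * jdec (\<eta> + s *\<^sub>R axis j 1) \<le> C * (4 ^ CARD('n) * jdec \<eta>)"
        using C0 jdec_shift_le[of "s *\<^sub>R axis j 1" \<eta>] by (intro mult_left_mono) auto
      then show ?thesis using C[of "\<eta> + s *\<^sub>R axis j 1"] unfolding D_def by (simp add: mult.assoc)
    qed
    \<comment> \<open>2 D for the oscillation of the second derivative and D for its value at the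
      base point.\<close>
    have b1: "cmod (pdir j g (\<eta> + s *\<^sub>R axis j 1) - pdir j g (\<eta> + 0 *\<^sub>R axis j 1)) \<le> 3 * D * \<bar>t\<bar> * jdec \<eta>"
      if s: "s \<in> closed_segment 0 t" for s
    proof -
      have ss: "closed_segment 0 s \<subseteq> closed_segment 0 t" using s by (simp add: subset_closed_segment)
      have "norm (pdir j g (\<eta> + s *\<^sub>R axis j 1) - pdir j g (\<eta> + 0 *\<^sub>R axis j 1) - (s - 0) *\<^sub>R pdir j (pdir j g) (\<eta> + 0 *\<^sub>R axis j 1))
          \<le> norm (s - 0) * (2 * D * jdec \<eta>)"
      proof (rule vector_differentiable_bound_linearization[where S="closed_segment 0 t" and f'="\<lambda>s. pdir j (pdir j g) (\<eta> + s *\<^sub>R axis j 1)"])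
        show "norm (pdir j (pdir j g) (\<eta> + r *\<^sub>R axis j 1) - pdir j (pdir j g) (\<eta> + 0 *\<^sub>R axis j 1)) \<le> 2 * D * jdec \<eta>"
          if "r \<in> closed_segment 0 t" for r
          using norm_triangle_ineq4[of "pdir j (pdir j g) (\<eta> + r *\<^sub>R axis j 1)" "pdir j (pdir j g) (\<eta> + 0 *\<^sub>R axis j 1)"]
            b2[OF that] b2[of 0] by simp
      qed (use line[OF sm(2)] ss in auto)
      moreover have "norm ((s - 0) *\<^sub>R pdir j (pdir j g) (\<eta> + 0 *\<^sub>R axis j 1)) \<le> \<bar>s\<bar> * (D * jdec \<eta>)"
        using b2[of 0] by (auto intro: mult_left_mono)
      ultimately have "cmod (pdir j g (\<eta> + s *\<^sub>R axis j 1) - pdir j g (\<eta> + 0 *\<^sub>R axis j 1)) \<le> \<bar>s\<bar> * (3 * D * jdec \<eta>)"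
        using norm_triangle_sub[of "pdir j g (\<eta> + s *\<^sub>R axis j 1) - pdir j g (\<eta> + 0 *\<^sub>R axis j 1)"
            "(s - 0) *\<^sub>R pdir j (pdir j g) (\<eta> + 0 *\<^sub>R axis j 1)"] by (simp add: algebra_simps)
      also have "\<dots> \<le> \<bar>t\<bar> * (3 * D * jdec \<eta>)"
        using seg[OF s] C0 by (intro mult_right_mono) (auto simp: D_def)
      finally show ?thesis by (simp add: mult_ac)
    qed
    have "norm (g (\<eta> + t *\<^sub>R axis j 1) - g (\<eta> + 0 *\<^sub>R axis j 1) - (t - 0) *\<^sub>R pdir j g (\<eta> + 0 *\<^sub>R axis j 1))
        \<le> norm (t - 0) * (3 * D * \<bar>t\<bar> * jdec \<eta>)"
      by (rule vector_differentiable_bound_linearization[where S="closed_segment 0 t" and f'="\<lambda>s. pdir j g (\<eta> + s *\<^sub>R axis j 1)"])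
        (use line[OF sm(1)] b1 in auto)
    then show ?thesis by (simp add: power2_eq_square mult_ac abs_mult_self_eq flip: abs_mult)
  qed
  then show ?thesis by blast
qed

text \<open>Integration by parts, by differentiating the covariance of the Fourier transform under translations.\<close>

lemma fourier_pdir:
  fixes g :: "real^'n::finite \<Rightarrow> complex"
  assumes g: "rapid g"
  shows "fourier (pdir j g) x = \<i> * complex_of_real (x $ j) * fourier g x"
proof -
  have m [measurable]: "g \<in> borel_measurable borel" using smooth_measurable g unfolding rapid_def by auto
  have tr: "fourier (\<lambda>\<eta>. g (\<eta> + t *\<^sub>R axis j 1)) x = exp (\<i> * complex_of_real (t * x $ j)) * fourier g x" for t
  proof -
    let ?v = "t *\<^sub>R axis j 1 :: real^'n"
    have "fourier g x = (LINT \<eta>|distr lborel borel ((+) ?v). expm (ivec \<eta>) x * g \<eta>)"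
      unfolding lborel_distr_plus fourier_eq ..
    also have "\<dots> = (LINT \<eta>|lborel. expm (ivec (?v + \<eta>)) x * g (?v + \<eta>))"
      by (subst integral_distr) auto
    also have "\<dots> = (LINT \<eta>|lborel. exp (- (\<i> * complex_of_real (t * x $ j))) * (expm (ivec \<eta>) x * g (\<eta> + ?v)))"
      by (intro Bochner_Integration.integral_cong)
        (auto simp: expm_def cdot_ivec inner_add_right inner_axis exp_add[symmetric] algebra_simps)
    also have "\<dots> = exp (- (\<i> * complex_of_real (t * x $ j))) * fourier (\<lambda>\<eta>. g (\<eta> + ?v)) x"
      unfolding fourier_eq by simp
    finally show ?thesis by (simp add: exp_minus field_simps)
  qed
  obtain C where C: "\<And>\<eta> t. \<bar>t\<bar> \<le> 1 \<Longrightarrow> cmod (g (\<eta> + t *\<^sub>R axis j 1) - g \<eta> - t *\<^sub>R pdir j g \<eta>) \<le> C * t\<^sup>2 * jdec \<eta>"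
    using rapid_taylor[OF g, of j] by blast
  have d1: "((\<lambda>t. fourier (\<lambda>\<eta>. g (\<eta> + t *\<^sub>R axis j 1)) x) has_vector_derivative fourier (pdir j g) x) (at 0)"
  proof (rule has_vector_derivative_quadratic)
    fix h :: real assume h: "\<bar>h\<bar> \<le> 1"
    let ?f = "\<lambda>\<eta>. expm (ivec \<eta>) x * (g (\<eta> + h *\<^sub>R axis j 1) - g \<eta> - h *\<^sub>R pdir j g \<eta>)"
    have [measurable]: "pdir j g \<in> borel_measurable borel"
      using smooth_measurable[OF smooth_fun_pdir, of g j] g unfolding rapid_def by auto
    have b: "norm (?f \<eta>) \<le> (C * h\<^sup>2) * jdec \<eta>" for \<eta> using C[OF h, of \<eta>] by (simp add: norm_mult)
    have fm: "?f \<in> borel_measurable lborel" by measurable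
    note f = integrable_of_jdec_bound[OF fm b]
    have i0: "integrable lborel (\<lambda>\<eta>. expm (ivec \<eta>) x * g \<eta>)" "integrable lborel (\<lambda>\<eta>. expm (ivec \<eta>) x * pdir j g \<eta>)"
      using rapid_integrable(2) g rapid_pdir by blast+
    have "integrable lborel (\<lambda>\<eta>. ?f \<eta> + expm (ivec \<eta>) x * g \<eta> + h *\<^sub>R (expm (ivec \<eta>) x * pdir j g \<eta>))"
      using f(1) i0 by (intro Bochner_Integration.integrable_add) auto
    moreover have "(\<lambda>\<eta>. ?f \<eta> + expm (ivec \<eta>) x * g \<eta> + h *\<^sub>R (expm (ivec \<eta>) x * pdir j g \<eta>)) = (\<lambda>\<eta>. expm (ivec \<eta>) x * g (\<eta> + h *\<^sub>R axis j 1))"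
      by (auto simp: algebra_simps scaleR_conv_of_real)
    ultimately have i1: "integrable lborel (\<lambda>\<eta>. expm (ivec \<eta>) x * g (\<eta> + h *\<^sub>R axis j 1))" by simp
    have "fourier (\<lambda>\<eta>. g (\<eta> + h *\<^sub>R axis j 1)) x - fourier g x - h *\<^sub>R fourier (pdir j g) x
        = (LINT \<eta>|lborel. expm (ivec \<eta>) x * g (\<eta> + h *\<^sub>R axis j 1) - expm (ivec \<eta>) x * g \<eta> - h *\<^sub>R (expm (ivec \<eta>) x * pdir j g \<eta>))"
      unfolding fourier_eq using i0 i1 by simp
    also have "\<dots> = (LINT \<eta>|lborel. ?f \<eta>)"
      by (intro Bochner_Integration.integral_cong) (auto simp: algebra_simps scaleR_conv_of_real)
    finally have "norm (fourier (\<lambda>\<eta>. g (\<eta> + h *\<^sub>R axis j 1)) x - fourier g x - h *\<^sub>R fourier (pdir j g) x)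
        \<le> C * h\<^sup>2 * (LINT \<eta>|lborel. jdec (\<eta> :: real^'n))" using f(2) by simp
    then show "norm (fourier (\<lambda>\<eta>. g (\<eta> + (0 + h) *\<^sub>R axis j 1)) x - fourier (\<lambda>\<eta>. g (\<eta> + 0 *\<^sub>R axis j 1)) x - h *\<^sub>R fourier (pdir j g) x)
        \<le> (C * (LINT \<eta>|lborel. jdec (\<eta> :: real^'n))) * h\<^sup>2" by (simp add: mult_ac)
  qed
  have "((\<lambda>w. exp (\<i> * (w * complex_of_real (x $ j))) * fourier g x) has_field_derivative \<i> * complex_of_real (x $ j) * fourier g x) (at (of_real 0))"
    by (auto intro!: derivative_eq_intros)
  then have "((\<lambda>t. exp (\<i> * (complex_of_real t * complex_of_real (x $ j))) * fourier g x)
      has_vector_derivative \<i> * complex_of_real (x $ j) * fourier g x) (at 0)"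
    by (rule has_vector_derivative_real_field)
  then have d2: "((\<lambda>t. fourier (\<lambda>\<eta>. g (\<eta> + t *\<^sub>R axis j 1)) x) has_vector_derivative \<i> * complex_of_real (x $ j) * fourier g x) (at 0)"
    unfolding tr by simp
  show ?thesis by (rule vector_derivative_unique_at[OF d1 d2])
qed

lemma rapid_replicate: "rapid g \<Longrightarrow> rapid (Dl (replicate q j) g)"
  by (induct q) (auto intro: rapid_pdir)

lemma fourier_Dl_replicate:
  "rapid g \<Longrightarrow> fourier (Dl (replicate q j) g) x = (\<i> * complex_of_real (x $ j)) ^ q * fourier g x"
proof (induct q)
  case (Suc q)
  then show ?case using fourier_pdir[OF rapid_replicate[OF Suc(2)], of j q j x] by simp
qed simp

text \<open>A coordinate has constant first and vanishing second derivatives, so Leibniz leaves two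
  kinds of terms. At length 0 the truncated \<open>length ks - 1\<close> is multiplied by 0.\<close>

lemma cmod_Dl_coord_mult_le:
  fixes g :: "real^'n::finite \<Rightarrow> complex"
  assumes "smooth_fun g" "\<And>ks. cmod (Dl ks g \<eta>) \<le> G (length ks)"
  shows "cmod (Dl ks (\<lambda>\<eta>. - \<i> * complex_of_real (\<eta> $ j) * g \<eta>) \<eta>)
    \<le> \<bar>\<eta> $ j\<bar> * G (length ks) + real (length ks) * G (length ks - 1)"
  using assms
proof (induct ks arbitrary: g G rule: rev_induct)
  case Nil
  then show ?case using Nil(2)[of "[]"] by (simp add: norm_mult mult_left_mono)
next
  case (snoc i ks)
  let ?k = "length ks"
  have sg: "smooth_fun (pdir i g)" using snoc.prems(1) by (rule smooth_fun_pdir)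
  have sc: "smooth_fun (\<lambda>\<eta>. - \<i> * complex_of_real (\<eta> $ j))" by (rule smooth_cmult[OF smooth_coord])
  have "has_pdir i (\<lambda>\<eta>. - \<i> * complex_of_real (\<eta> $ j) * g \<eta>)
      (\<lambda>\<eta>. - \<i> * complex_of_real (\<eta> $ j) * pdir i g \<eta> + (- \<i> * (if j = i then 1 else 0)) * g \<eta>)"
    by (rule has_pdir_mult[OF has_pdir_cmult[OF has_pdir_coord] smooth_fun_has_pdir0[OF snoc.prems(1)]])
  from has_pdir_imp_pdir[OF this]
  have e: "Dl (ks @ [i]) (\<lambda>\<eta>. - \<i> * complex_of_real (\<eta> $ j) * g \<eta>) \<eta>
      = Dl ks (\<lambda>\<eta>. - \<i> * complex_of_real (\<eta> $ j) * pdir i g \<eta>) \<eta> + (- \<i> * (if j = i then 1 else 0)) * Dl ks g \<eta>"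
    unfolding Dl_snoc
    by (simp only: Dl_add[OF smooth_mult[OF sc sg] smooth_cmult[OF snoc.prems(1)]] Dl_cmult[OF snoc.prems(1)])
  have "cmod (Dl (ks @ [i]) (\<lambda>\<eta>. - \<i> * complex_of_real (\<eta> $ j) * g \<eta>) \<eta>)
      \<le> cmod (Dl ks (\<lambda>\<eta>. - \<i> * complex_of_real (\<eta> $ j) * pdir i g \<eta>) \<eta>) + cmod ((- \<i> * (if j = i then 1 else 0)) * Dl ks g \<eta>)"
    unfolding e by (rule norm_triangle_ineq)
  also have "\<dots> \<le> (\<bar>\<eta> $ j\<bar> * G (Suc ?k) + real ?k * G (Suc (?k - 1))) + G ?k"
  proof (rule add_mono)
    show "cmod (Dl ks (\<lambda>\<eta>. - \<i> * complex_of_real (\<eta> $ j) * pdir i g \<eta>) \<eta>) \<le> \<bar>\<eta> $ j\<bar> * G (Suc ?k) + real ?k * G (Suc (?k - 1))"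
    proof (rule snoc.hyps[OF sg, of "\<lambda>k. G (Suc k)"])
      show "cmod (Dl ls (pdir i g) \<eta>) \<le> G (Suc (length ls))" for ls
        using snoc.prems(2)[of "ls @ [i]"] by (simp add: Dl_snoc)
    qed
    show "cmod ((- \<i> * (if j = i then 1 else 0)) * Dl ks g \<eta>) \<le> G ?k"
      using snoc.prems(2)[of ks] order_trans[OF norm_ge_zero snoc.prems(2)[of ks]] by (simp add: norm_mult)
  qed
  also have "real ?k * G (Suc (?k - 1)) = real ?k * G ?k" by (cases ks) auto
  finally show ?case by (simp add: algebra_simps)
qed

text \<open>(p choose k) k! is the falling factorial that k derivatives produce from a monomial of
  degree p. Pascal's rule closes the induction, and for k > p both sides vanish.\<close>

lemma cmod_Dl_mon_le:
  "cmod (Dl ks (mon js) \<eta>) \<le> real (length js choose length ks) * fact (length ks) * jb \<eta> ^ length js"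
proof (induct js arbitrary: ks)
  case Nil
  have e: "mon [] = (\<lambda>\<eta>. 1)" by auto
  show ?case unfolding e using Dl_const_open[OF open_UNIV, of "\<lambda>\<eta>. 1" 1 \<eta> ks] by (cases ks) auto
next
  case (Cons j js)
  let ?p = "length js" and ?k = "length ks"
  let ?G = "\<lambda>k. real (?p choose k) * fact k * jb \<eta> ^ ?p"
  have G0: "?G k \<ge> 0" for k by (simp add: less_imp_le)
  have e: "mon (j # js) = (\<lambda>\<eta>. - \<i> * complex_of_real (\<eta> $ j) * mon js \<eta>)" by (auto simp: mon_Cons)
  have "cmod (Dl ks (mon (j # js)) \<eta>) \<le> \<bar>\<eta> $ j\<bar> * ?G ?k + real ?k * ?G (?k - 1)"
    unfolding e by (rule cmod_Dl_coord_mult_le[OF smooth_mon Cons])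
  also have "\<dots> \<le> jb \<eta> * ?G ?k + jb \<eta> * (real ?k * ?G (?k - 1))"
  proof (intro add_mono mult_right_mono G0)
    show "\<bar>\<eta> $ j\<bar> \<le> jb \<eta>" using component_le_norm_cart[of \<eta> j] norm_le_jb[of \<eta>] by linarith
    have "1 * (real ?k * ?G (?k - 1)) \<le> jb \<eta> * (real ?k * ?G (?k - 1))"
      using jb_ge_1 G0 by (intro mult_right_mono) auto
    then show "real ?k * ?G (?k - 1) \<le> jb \<eta> * (real ?k * ?G (?k - 1))" by simp
  qed
  also have "\<dots> = real (Suc ?p choose ?k) * fact ?k * jb \<eta> ^ Suc ?p"
    by (cases ?k) (simp_all add: algebra_simps)
  finally show ?case by simp
qed

section \<open>The Fourier transform maps the test spaces into themselves\<close>

context weights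
begin

lemma class_quant_ex: "class_quant s P \<Longrightarrow> \<exists>h>0. P h"
  by (cases s) (auto simp: class_quant_def intro: exI[of _ 1])

lemma SB_pointwise:
  "SB M h A \<psi> \<Longrightarrow> jb \<eta> ^ q * cmod (\<psi> \<eta>) \<le> A * h ^ q * M q"
  unfolding SB_def by (metis Dl.simps(1) M0 add_0 list.size(3) mult.right_neutral)

text \<open>Further powers of the bracket are bought by (M.2), at the price of H in the scale: 2
  \<open>CARD('n)\<close> of them become the integrable factor \<open>jdec\<close>, and k are
  spare.\<close>

lemma SB_power_jdec:
  fixes \<psi> :: "real^'n::finite \<Rightarrow> complex"
  assumes \<psi>: "SB M h A \<psi>" and h: "h > 0"
  shows "\<exists>K\<ge>0. \<forall>p \<eta>. jb \<eta> ^ (p + k) * cmod (\<psi> \<eta>) \<le> K * (H * h) ^ p * M p * jdec \<eta>"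
proof -
  let ?d = "2 * CARD('n)"
  define K where "K = A * h ^ (k + ?d) * c0 * H ^ (k + ?d) * M (k + ?d)"
  have A: "A \<ge> 0" using SB_nonneg[OF \<psi>] .
  have "jb \<eta> ^ (p + k) * cmod (\<psi> \<eta>) \<le> K * (H * h) ^ p * M p * jdec \<eta>" for p \<eta>
  proof -
    have "jb \<eta> ^ (p + (k + ?d)) * cmod (\<psi> \<eta>) \<le> A * h ^ (p + (k + ?d)) * M (p + (k + ?d))"
      by (rule SB_pointwise[OF \<psi>])
    also have "\<dots> \<le> A * h ^ (p + (k + ?d)) * (c0 * H ^ (p + (k + ?d)) * M p * M (k + ?d))"
      using A h by (intro mult_left_mono M_add_le) auto
    also have "\<dots> = K * (H * h) ^ p * M p"
      unfolding K_def by (simp add: power_add power_mult_distrib mult_ac)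
    finally have "jb \<eta> ^ (p + k) * cmod (\<psi> \<eta>) * jb \<eta> ^ ?d \<le> K * (H * h) ^ p * M p"
      by (simp only: power_add mult_ac)
    then show ?thesis unfolding jdec_def by (simp add: pos_le_divide_eq)
  qed
  moreover have "K \<ge> 0" unfolding K_def using A h H c0 by simp
  ultimately show ?thesis by blast
qed

lemma moments_SB:
  fixes \<psi> :: "real^'n::finite \<Rightarrow> complex"
  assumes "smooth_fun \<psi>" "SB M h A \<psi>" "h > 0"
  shows "moments \<psi>"
  unfolding moments_def
proof (intro conjI allI smooth_measurable assms(1))
  fix n
  have [measurable]: "\<psi> \<in> borel_measurable borel" using smooth_measurable[OF assms(1)] by simp
  obtain K where K: "K \<ge> 0" "\<And>p \<eta>. jb \<eta> ^ (p + 0) * cmod (\<psi> \<eta>) \<le> K * (H * h) ^ p * M p * jdec \<eta>"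
    using SB_power_jdec[OF assms(2,3), of 0] by blast
  show "integrable lborel (\<lambda>\<eta>. norm \<eta> ^ n * cmod (\<psi> \<eta>))"
  proof (rule integrable_of_jdec_bound(1))
    show "(\<lambda>\<eta>. norm \<eta> ^ n * cmod (\<psi> \<eta>)) \<in> borel_measurable lborel" by measurable
    fix \<eta>
    have "norm \<eta> ^ n * cmod (\<psi> \<eta>) \<le> jb \<eta> ^ n * cmod (\<psi> \<eta>)"
      using norm_le_jb[of \<eta>] by (intro mult_right_mono power_mono) auto
    also have "\<dots> \<le> (K * (H * h) ^ n * M n) * jdec \<eta>" using K(2)[of \<eta> n] by simp
    finally show "norm (norm \<eta> ^ n * cmod (\<psi> \<eta>)) \<le> (K * (H * h) ^ n * M n) * jdec \<eta>" by simp
  qed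
qed

text \<open>A k-th derivative of a monomial of degree p is at most 2^p k! times the p-th power of
  the bracket: the factorial is absorbed by M_k, 2^p by the scale 2 H h, and the bracket by the
  decay of \<psi>.\<close>

lemma SB_mon_mult:
  fixes \<psi> :: "real^'n::finite \<Rightarrow> complex"
  assumes \<psi>: "smooth_fun \<psi>" "SB M h A \<psi>" and h: "h > 0"
  shows "\<exists>K\<ge>0. \<forall>js ks \<eta>. cmod (Dl ks (\<lambda>\<eta>. mon js \<eta> * \<psi> \<eta>) \<eta>)
    \<le> (K * (2 * H * h) ^ length js * M (length js) * (2 * h) ^ length ks * M (length ks)) * jdec \<eta>"
proof -
  let ?d = "2 * CARD('n)"
  obtain C where C: "C > 0" "\<And>n. fact n * (1 / h) ^ n \<le> C * M n" using fact_le[of "1 / h"] h by auto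
  define K where "K = C * A * h ^ ?d * c0 * H ^ ?d * M ?d"
  have A: "A \<ge> 0" using SB_nonneg[OF \<psi>(2)] .
  have "cmod (Dl ks (\<lambda>\<eta>. mon js \<eta> * \<psi> \<eta>) \<eta>)
    \<le> (K * (2 * H * h) ^ length js * M (length js) * (2 * h) ^ length ks * M (length ks)) * jdec \<eta>"
    for js ks and \<eta> :: "real^'n"
  proof -
    let ?p = "length js"
    have p1: "pbound M (mon js) \<eta> (C * 2 ^ ?p * jb \<eta> ^ ?p) h"
      unfolding pbound_def
    proof
      fix ks :: "'n list"
      let ?k = "length ks"
      have f: "fact ?k \<le> C * h ^ ?k * M ?k"
        using C(2)[of ?k] h by (simp add: power_one_over field_simps)
      have "cmod (Dl ks (mon js) \<eta>) \<le> real (?p choose ?k) * fact ?k * jb \<eta> ^ ?p" by (rule cmod_Dl_mon_le)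
      also have "\<dots> \<le> 2 ^ ?p * (C * h ^ ?k * M ?k) * jb \<eta> ^ ?p"
      proof (intro mult_right_mono mult_mono f)
        have "real (?p choose ?k) \<le> real (2 ^ ?p)" using binomial_le_pow2 of_nat_le_iff by blast
        then show "real (?p choose ?k) \<le> 2 ^ ?p" by simp
      qed (auto simp: less_imp_le)
      finally show "cmod (Dl ks (mon js) \<eta>) \<le> C * 2 ^ ?p * jb \<eta> ^ ?p * h ^ ?k * M ?k" by (simp add: mult_ac)
    qed
    have p2: "pbound M \<psi> \<eta> (A * h ^ (?p + ?d) * M (?p + ?d) / jb \<eta> ^ (?p + ?d)) h"
      using SB_iff_pbound[THEN iffD1, OF \<psi>(2)] by blast
    have "C * 2 ^ ?p * jb \<eta> ^ ?p * (A * h ^ (?p + ?d) * M (?p + ?d) / jb \<eta> ^ (?p + ?d))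
        = (C * 2 ^ ?p * A * h ^ (?p + ?d)) * jdec \<eta> * M (?p + ?d)"
      unfolding jdec_def by (simp add: power_add field_simps)
    also have "\<dots> \<le> (C * 2 ^ ?p * A * h ^ (?p + ?d)) * jdec \<eta> * (c0 * H ^ (?p + ?d) * M ?p * M ?d)"
      using A h C(1) by (intro mult_left_mono M_add_le) auto
    also have "\<dots> = (K * (2 * H * h) ^ ?p * M ?p) * jdec \<eta>"
      unfolding K_def by (simp add: power_add power_mult_distrib mult_ac)
    finally have le: "C * 2 ^ ?p * jb \<eta> ^ ?p * (A * h ^ (?p + ?d) * M (?p + ?d) / jb \<eta> ^ (?p + ?d))
        \<le> (K * (2 * H * h) ^ ?p * M ?p) * jdec \<eta>" .
    have "pbound M (\<lambda>\<eta>. mon js \<eta> * \<psi> \<eta>) \<eta>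
        (C * 2 ^ ?p * jb \<eta> ^ ?p * (A * h ^ (?p + ?d) * M (?p + ?d) / jb \<eta> ^ (?p + ?d))) (h + h)"
      using h by (intro pbound_mult smooth_mon \<psi>(1) p1 p2) auto
    then have "pbound M (\<lambda>\<eta>. mon js \<eta> * \<psi> \<eta>) \<eta> ((K * (2 * H * h) ^ ?p * M ?p) * jdec \<eta>) (h + h)"
      by (rule pbound_mono[OF _ le]) (use h A C(1) in \<open>auto simp: less_imp_le\<close>)
    then have "cmod (Dl ks (\<lambda>\<eta>. mon js \<eta> * \<psi> \<eta>) \<eta>) \<le> (K * (2 * H * h) ^ ?p * M ?p) * jdec \<eta> * (h + h) ^ length ks * M (length ks)"
      unfolding pbound_def by blast
    moreover have "h + h = 2 * h" by simp
    ultimately show ?thesis by (simp only: mult_ac)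
  qed
  moreover have "K \<ge> 0" unfolding K_def using A h H c0 C(1) by simp
  ultimately show ?thesis by blast
qed

text \<open>The bracket is at most d + 1 times the largest of 1 and the |x_j|, so only pure powers
  of single coordinates matter; these correspond to repeated derivatives in one direction.\<close>

lemma jb_power_le:
  fixes x :: "real^'n::finite"
  shows "jb x ^ q \<le> (real CARD('n) + 1) ^ q * (1 + (\<Sum>j\<in>UNIV. \<bar>x $ j\<bar> ^ q))"
proof -
  define m where "m = Max (insert 1 (range (\<lambda>j. \<bar>x $ j\<bar>)))"
  have m1: "1 \<le> m" unfolding m_def by (rule Max_ge) auto
  have mj: "\<bar>x $ j\<bar> \<le> m" for j unfolding m_def by (rule Max_ge) auto
  have "m \<in> insert 1 (range (\<lambda>j. \<bar>x $ j\<bar>))" unfolding m_def by (rule Max_in) auto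
  then have mq: "m ^ q \<le> 1 + (\<Sum>j\<in>UNIV. \<bar>x $ j\<bar> ^ q)"
  proof
    assume "m \<in> range (\<lambda>j. \<bar>x $ j\<bar>)"
    then obtain j where j: "m = \<bar>x $ j\<bar>" by blast
    have "\<bar>x $ j\<bar> ^ q \<le> (\<Sum>j\<in>UNIV. \<bar>x $ j\<bar> ^ q)" by (rule member_le_sum) auto
    then show ?thesis unfolding j by simp
  qed (simp add: sum_nonneg)
  have "(\<Sum>j\<in>UNIV. \<bar>x $ j\<bar>) \<le> (\<Sum>j\<in>(UNIV :: 'n set). m)" by (intro sum_mono mj)
  then have "norm x \<le> real CARD('n) * m" using norm_le_l1_cart[of x] by simp
  then have "jb x \<le> (real CARD('n) + 1) * m" using jb_le[of x] m1 by (simp add: algebra_simps)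
  then have "jb x ^ q \<le> ((real CARD('n) + 1) * m) ^ q" by (intro power_mono) (auto simp: less_imp_le)
  also have "\<dots> = (real CARD('n) + 1) ^ q * m ^ q" by (rule power_mult_distrib)
  also have "\<dots> \<le> (real CARD('n) + 1) ^ q * (1 + (\<Sum>j\<in>UNIV. \<bar>x $ j\<bar> ^ q))" by (intro mult_left_mono mq) simp
  finally show ?thesis .
qed

text \<open>Derivatives in x become monomials in \<eta> and powers of x_j become derivatives in
  \<eta>, so the two indices of the seminorm exchange their roles.\<close>

lemma fourier_SB:
  fixes \<psi> :: "real^'n::finite \<Rightarrow> complex"
  assumes \<psi>: "smooth_fun \<psi>" "SB M h A \<psi>" and h: "h > 0"
  shows "\<exists>A'. SB M (2 * (real CARD('n) + 1) * H * h) A' (fourier \<psi>)"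
proof -
  define N where "N = real CARD('n)"
  have N: "N \<ge> 0" unfolding N_def by simp
  obtain K where K: "K \<ge> 0" "\<And>js ks \<eta>. cmod (Dl ks (\<lambda>\<eta>. mon js \<eta> * \<psi> \<eta>) \<eta>)
    \<le> (K * (2 * H * h) ^ length js * M (length js) * (2 * h) ^ length ks * M (length ks)) * jdec \<eta>"
    using SB_mon_mult[OF \<psi> h] by blast
  \<comment> \<open>This constant absorbs the summand 1 of \<open>jb_power_le\<close> into (2 h)^q
    M_q.\<close>
  obtain C where C: "C > 0" "\<And>n. 1 \<le> C * (2 * h) ^ n * M n" using one_le_weight[of "2 * h"] h by auto
  define I where "I = (LINT \<eta>|lborel. jdec (\<eta> :: real^'n))"
  have I: "I \<ge> 0" unfolding I_def by simp
  have sm: "smooth_fun (\<lambda>\<eta>. mon js \<eta> * \<psi> \<eta>)" for js by (intro smooth_mult smooth_mon \<psi>(1))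
  have ra: "rapid (\<lambda>\<eta>. mon js \<eta> * \<psi> \<eta>)" for js unfolding rapid_def using sm K(2) by blast
  define A' where "A' = K * I * (C + N)"
  have "jb x ^ q * cmod (Dl js (fourier \<psi>) x) \<le> A' * (2 * (N + 1) * H * h) ^ (length js + q) * M (length js) * M q"
    for js q x
  proof -
    let ?p = "length js" and ?g = "\<lambda>\<eta>. mon js \<eta> * \<psi> \<eta>"
    have D: "Dl js (fourier \<psi>) x = fourier ?g x"
      using Dl_fourier[OF moments_SB[OF \<psi> h]] by simp
    define B where "B r = K * (2 * H * h) ^ ?p * M ?p * (2 * h) ^ r * M r * I" for r
    have fb: "cmod (fourier (Dl (replicate r j) ?g) x) \<le> B r" for r j
    proof -
      have [measurable]: "Dl (replicate r j) ?g \<in> borel_measurable borel"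
        using smooth_measurable[OF smooth_fun_Dl[OF sm]] by simp
      have "cmod (LINT \<eta>|lborel. expm (ivec \<eta>) x * Dl (replicate r j) ?g \<eta>)
          \<le> (K * (2 * H * h) ^ ?p * M ?p * (2 * h) ^ r * M r) * (LINT \<eta>|lborel. jdec (\<eta> :: real^'n))"
      proof (rule integrable_of_jdec_bound(2))
        show "norm (expm (ivec \<eta>) x * Dl (replicate r j) ?g \<eta>) \<le> (K * (2 * H * h) ^ ?p * M ?p * (2 * h) ^ r * M r) * jdec \<eta>" for \<eta>
          using K(2)[of "replicate r j" js \<eta>] by (simp add: norm_mult)
      qed measurable
      then show ?thesis unfolding fourier_eq B_def I_def .
    qed
    have f0: "cmod (fourier ?g x) \<le> B 0" using fb[of 0 undefined] by simp
    have fj: "\<bar>x $ j\<bar> ^ q * cmod (fourier ?g x) \<le> B q" for j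
      using fb[of q j] fourier_Dl_replicate[OF ra, of q j js x] by (simp add: norm_mult norm_power)
    have "jb x ^ q * cmod (fourier ?g x) \<le> ((N + 1) ^ q * (1 + (\<Sum>j\<in>UNIV. \<bar>x $ j\<bar> ^ q))) * cmod (fourier ?g x)"
      unfolding N_def by (intro mult_right_mono jb_power_le) auto
    also have "\<dots> = (N + 1) ^ q * (cmod (fourier ?g x) + (\<Sum>j\<in>UNIV. \<bar>x $ j\<bar> ^ q * cmod (fourier ?g x)))"
      by (simp add: distrib_right sum_distrib_right mult.assoc)
    also have "\<dots> \<le> (N + 1) ^ q * (B 0 + (\<Sum>j\<in>(UNIV :: 'n set). B q))"
      using N by (intro mult_left_mono add_mono sum_mono f0 fj) auto
    also have "\<dots> = (N + 1) ^ q * (K * (2 * H * h) ^ ?p * M ?p * I) * (1 + N * ((2 * h) ^ q * M q))"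
      unfolding B_def N_def by (simp add: algebra_simps)
    also have "\<dots> \<le> (N + 1) ^ q * (K * (2 * H * h) ^ ?p * M ?p * I) * ((C + N) * ((2 * h) ^ q * M q))"
      using C(2)[of q] K(1) I N h H by (intro mult_left_mono) (auto simp: algebra_simps)
    also have "\<dots> = A' * M ?p * M q * ((2 * H * h) ^ ?p * ((N + 1) * (2 * h)) ^ q)"
      unfolding A'_def by (simp only: power_mult_distrib mult_ac)
    also have "\<dots> \<le> A' * M ?p * M q * ((2 * (N + 1) * H * h) ^ ?p * (2 * (N + 1) * H * h) ^ q)"
    proof -
      have "2 * H * h * 1 \<le> 2 * H * h * (N + 1)" using H h N by (intro mult_left_mono) auto
      then have a1: "2 * H * h \<le> 2 * (N + 1) * H * h" by (simp add: algebra_simps)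
      have "(N + 1) * (2 * h) * 1 \<le> (N + 1) * (2 * h) * H" using H h N by (intro mult_left_mono) auto
      then have a2: "(N + 1) * (2 * h) \<le> 2 * (N + 1) * H * h" by (simp add: algebra_simps)
      have z: "0 \<le> 2 * H * h" "0 \<le> (N + 1) * (2 * h)" "0 \<le> 2 * (N + 1) * H * h" using H h N by simp_all
      have "(2 * H * h) ^ ?p * ((N + 1) * (2 * h)) ^ q \<le> (2 * (N + 1) * H * h) ^ ?p * (2 * (N + 1) * H * h) ^ q"
        by (rule mult_mono[OF power_mono[OF a1 z(1)] power_mono[OF a2 z(2)] zero_le_power[OF z(3)] zero_le_power[OF z(2)]])
      moreover have "0 \<le> A' * M ?p * M q" unfolding A'_def using N K(1) I C(1) by simp
      ultimately show ?thesis by (rule mult_left_mono)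
    qed
    finally show ?thesis unfolding D by (simp only: power_add mult_ac)
  qed
  then show ?thesis unfolding SB_def N_def by blast
qed

lemma fourier_Stest:
  fixes \<psi> :: "real^'n::finite \<Rightarrow> complex"
  assumes "\<psi> \<in> Stest s M" shows "fourier \<psi> \<in> Stest s M"
proof -
  have sm: "smooth_fun \<psi>" and cq: "class_quant s (\<lambda>h. \<exists>A. SB M h A \<psi>)" using assms unfolding Stest_iff by auto
  obtain h A where "h > 0" "SB M h A \<psi>" using class_quant_ex[OF cq] by blast
  then have "smooth_fun (fourier \<psi>)" using smooth_fourier moments_SB sm by blast
  moreover have "class_quant s (\<lambda>h. \<exists>A. SB M h A (fourier \<psi>))"
    using cq
  proof (rule class_quant_scale[where c="2 * (real CARD('n) + 1) * H"])
    show "0 < 2 * (real CARD('n) + 1) * H" using H by (intro mult_pos_pos) auto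
  qed (use fourier_SB sm in blast)
  ultimately show ?thesis unfolding Stest_iff by simp
qed

end

section \<open>Dependence of the characters on the frequency\<close>

lemma cmod_mon_diff_le:
  assumes "norm \<eta> \<le> R" "norm \<eta>0 \<le> R" "R \<ge> 1"
  shows "cmod (mon js \<eta> - mon js \<eta>0) \<le> real (length js) * R ^ length js * norm (\<eta> - \<eta>0)"
proof (induct js)
  case (Cons j js)
  let ?n = "length js"
  have "mon (j # js) \<eta> - mon (j # js) \<eta>0
      = - \<i> * complex_of_real (\<eta> $ j) * (mon js \<eta> - mon js \<eta>0) + - \<i> * complex_of_real ((\<eta> - \<eta>0) $ j) * mon js \<eta>0"
    by (simp add: mon_Cons algebra_simps)
  then have "cmod (mon (j # js) \<eta> - mon (j # js) \<eta>0)
      \<le> cmod (- \<i> * complex_of_real (\<eta> $ j) * (mon js \<eta> - mon js \<eta>0)) + cmod (- \<i> * complex_of_real ((\<eta> - \<eta>0) $ j) * mon js \<eta>0)"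
    using norm_triangle_ineq by metis
  also have "\<dots> = \<bar>\<eta> $ j\<bar> * cmod (mon js \<eta> - mon js \<eta>0) + \<bar>(\<eta> - \<eta>0) $ j\<bar> * cmod (mon js \<eta>0)"
    by (simp only: norm_mult norm_minus_cancel norm_ii norm_of_real mult_1)
  also have "\<dots> \<le> R * (real ?n * R ^ ?n * norm (\<eta> - \<eta>0)) + norm (\<eta> - \<eta>0) * R ^ ?n"
  proof (intro add_mono mult_mono Cons component_le_norm_cart)
    show "\<bar>\<eta> $ j\<bar> \<le> R" using component_le_norm_cart[of \<eta> j] assms(1) by linarith
    have "norm \<eta>0 ^ ?n \<le> R ^ ?n" using assms by (intro power_mono) auto
    then show "cmod (mon js \<eta>0) \<le> R ^ ?n" using cmod_mon_le[of js \<eta>0] by linarith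
  qed (use assms in auto)
  also have "norm (\<eta> - \<eta>0) * R ^ ?n \<le> norm (\<eta> - \<eta>0) * R ^ Suc ?n"
    using assms(3) by (intro mult_left_mono power_increasing) auto
  finally show ?case by (simp add: algebra_simps)
qed simp

text \<open>The Lipschitz constant in \<eta> has to be geometric in the order n, to be absorbed by
  M_n; the factor n from the monomial therefore goes into 2^n. The factor 1 + |x| is left to the
  decay of the quotient.\<close>

lemma cmod_monE_diff_le:
  assumes "norm \<eta> \<le> R" "norm \<eta>0 \<le> R" "R \<ge> 1" "dist \<eta> \<eta>0 \<le> \<delta>"
  shows "cmod (mon js \<eta> * expm (ivec \<eta>) x - mon js \<eta>0 * expm (ivec \<eta>0) x) \<le> (2 * R) ^ length js * (1 + norm x) * \<delta>"
proof -
  let ?n = "length js"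
  have d: "norm (\<eta> - \<eta>0) \<le> \<delta>" using assms(4) by (simp add: dist_norm)
  \<comment> \<open>e^(-ix\<eta>) is symmetric in x and \<eta>, so the remainder estimate in x
    serves with the roles exchanged.\<close>
  have "expm (ivec \<eta>) x - expm (ivec \<eta>0) x = expm (ivec x) (\<eta>0 + (\<eta> - \<eta>0)) - expm (ivec x) \<eta>0"
    unfolding expm_def cdot_ivec by (simp add: inner_commute)
  then have "cmod (expm (ivec \<eta>) x - expm (ivec \<eta>0) x) \<le> \<bar>(\<eta> - \<eta>0) \<bullet> x\<bar>"
    using norm_expm_ivec_remainders(1)[of x \<eta>0 "\<eta> - \<eta>0"] by simp
  also have "\<dots> \<le> norm (\<eta> - \<eta>0) * norm x" by (rule Cauchy_Schwarz_ineq2)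
  also have "\<dots> \<le> \<delta> * norm x" using d by (intro mult_right_mono) auto
  finally have e: "cmod (expm (ivec \<eta>) x - expm (ivec \<eta>0) x) \<le> \<delta> * norm x" .
  have "norm \<eta>0 ^ ?n \<le> R ^ ?n" using assms by (intro power_mono) auto
  then have m0: "cmod (mon js \<eta>0) \<le> R ^ ?n" using cmod_mon_le[of js \<eta>0] by linarith
  have "real ?n * R ^ ?n * norm (\<eta> - \<eta>0) \<le> real ?n * R ^ ?n * \<delta>" using d assms(3) by (intro mult_left_mono) auto
  then have m: "cmod (mon js \<eta> - mon js \<eta>0) \<le> real ?n * R ^ ?n * \<delta>"
    using cmod_mon_diff_le[OF assms(1-3), of js] by linarith
  have "mon js \<eta> * expm (ivec \<eta>) x - mon js \<eta>0 * expm (ivec \<eta>0) x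
      = (mon js \<eta> - mon js \<eta>0) * expm (ivec \<eta>) x + mon js \<eta>0 * (expm (ivec \<eta>) x - expm (ivec \<eta>0) x)"
    by (simp add: algebra_simps)
  then have "cmod (mon js \<eta> * expm (ivec \<eta>) x - mon js \<eta>0 * expm (ivec \<eta>0) x)
      \<le> cmod (mon js \<eta> - mon js \<eta>0) + cmod (mon js \<eta>0) * cmod (expm (ivec \<eta>) x - expm (ivec \<eta>0) x)"
    using norm_triangle_ineq[of "(mon js \<eta> - mon js \<eta>0) * expm (ivec \<eta>) x" "mon js \<eta>0 * (expm (ivec \<eta>) x - expm (ivec \<eta>0) x)"]
    by (simp add: norm_mult)
  also have "\<dots> \<le> real ?n * R ^ ?n * \<delta> + R ^ ?n * (\<delta> * norm x)"
    using assms(3) by (intro add_mono mult_mono m m0 e) auto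
  also have "\<dots> = (R ^ ?n * \<delta>) * (real ?n + norm x)" by (simp add: algebra_simps)
  also have "\<dots> \<le> (R ^ ?n * \<delta>) * (2 ^ ?n * (1 + norm x))"
  proof (intro mult_left_mono)
    have 1: "real ?n \<le> 2 ^ ?n" using of_nat_less_two_power[of ?n, where 'a=real] by simp
    have "1 * norm x \<le> 2 ^ ?n * norm x" by (intro mult_right_mono) auto
    then show "real ?n + norm x \<le> 2 ^ ?n * (1 + norm x)" using 1 unfolding distrib_left by linarith
    have "\<delta> \<ge> 0" using d norm_ge_zero[of "\<eta> - \<eta>0"] by linarith
    then show "0 \<le> R ^ ?n * \<delta>" using assms(3) by simp
  qed
  finally show ?thesis by (simp only: power_mult_distrib mult_ac)
qed

section \<open>The Fourier transform of the regularised functional\<close>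

lemma moments_bounded_support:
  assumes "integrable lborel \<psi>" "\<And>\<eta>. \<psi> \<eta> \<noteq> 0 \<Longrightarrow> norm \<eta> \<le> R"
  shows "moments \<psi>"
  unfolding moments_def
proof (intro conjI allI)
  show m: "\<psi> \<in> borel_measurable lborel" using assms(1) by (rule borel_measurable_integrable)
  then have [measurable]: "\<psi> \<in> borel_measurable borel" by simp
  fix n
  have "integrable lborel (\<lambda>\<eta>. \<bar>R\<bar> ^ n * cmod (\<psi> \<eta>))" using assms(1) by (intro integrable_mult_right integrable_norm)
  then show "integrable lborel (\<lambda>\<eta>. norm \<eta> ^ n * cmod (\<psi> \<eta>))"
  proof (rule Bochner_Integration.integrable_bound)
    show "(\<lambda>\<eta>. norm \<eta> ^ n * cmod (\<psi> \<eta>)) \<in> borel_measurable lborel" by measurable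
    have "norm \<eta> ^ n * cmod (\<psi> \<eta>) \<le> \<bar>R\<bar> ^ n * cmod (\<psi> \<eta>)" for \<eta>
    proof (cases "\<psi> \<eta> = 0")
      case False
      then have "norm \<eta> \<le> \<bar>R\<bar>" using assms(2)[OF False] by linarith
      then show ?thesis by (intro mult_right_mono power_mono) auto
    qed simp
    then show "AE \<eta> in lborel. norm (norm \<eta> ^ n * cmod (\<psi> \<eta>)) \<le> norm (\<bar>R\<bar> ^ n * cmod (\<psi> \<eta>))" by simp
  qed
qed

lemma fourier_add:
  assumes "moments \<psi>" "moments \<phi>"
  shows "fourier (\<lambda>\<eta>. \<psi> \<eta> + \<phi> \<eta>) = (\<lambda>x. fourier \<psi> x + fourier \<phi> x)"
proof
  fix x
  show "fourier (\<lambda>\<eta>. \<psi> \<eta> + \<phi> \<eta>) x = fourier \<psi> x + fourier \<phi> x"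
    unfolding fourier_eq distrib_left
    using moments_integrable[OF moments_expm] assms by (intro Bochner_Integration.integral_add) auto
qed

lemma Dl_fourier_minus_exponential:
  assumes "moments \<psi>"
  shows "Dl js (\<lambda>x. fourier \<psi> x - (LINT \<eta>|lborel. \<psi> \<eta>) * expm (ivec \<eta>0) x) x
    = (LINT \<eta>|lborel. (mon js \<eta> * expm (ivec \<eta>) x - mon js \<eta>0 * expm (ivec \<eta>0) x) * \<psi> \<eta>)"
proof -
  have i1: "integrable lborel (\<lambda>\<eta>. expm (ivec \<eta>) x * (mon js \<eta> * \<psi> \<eta>))"
    using moments_integrable moments_expm moments_mon assms by blast
  have i2: "integrable lborel (\<lambda>\<eta>. (mon js \<eta>0 * expm (ivec \<eta>0) x) * \<psi> \<eta>)"
    using moments_integrable[OF assms] by simp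
  have "Dl js (\<lambda>x. fourier \<psi> x - (LINT \<eta>|lborel. \<psi> \<eta>) * expm (ivec \<eta>0) x) x
      = fourier (\<lambda>\<eta>. mon js \<eta> * \<psi> \<eta>) x - (LINT \<eta>|lborel. \<psi> \<eta>) * (mon js \<eta>0 * expm (ivec \<eta>0) x)"
    by (simp only: Dl_diff[OF smooth_fourier[OF assms] smooth_cmult[OF smooth_expm]] Dl_cmult[OF smooth_expm]
        Dl_fourier[OF assms] Dl_expm_ivec)
  also have "\<dots> = (LINT \<eta>|lborel. expm (ivec \<eta>) x * (mon js \<eta> * \<psi> \<eta>) - (mon js \<eta>0 * expm (ivec \<eta>0) x) * \<psi> \<eta>)"
    unfolding fourier_eq using i1 i2 by (subst Bochner_Integration.integral_diff) auto
  also have "\<dots> = (LINT \<eta>|lborel. (mon js \<eta> * expm (ivec \<eta>) x - mon js \<eta>0 * expm (ivec \<eta>0) x) * \<psi> \<eta>)"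
    by (intro Bochner_Integration.integral_cong) (auto simp: algebra_simps)
  finally show ?thesis .
qed

lemma one_plus_norm_le_exp:
  assumes "\<delta> > 0" shows "1 + norm x \<le> (1 + 1 / \<delta>) * exp (\<delta> * norm x)"
proof -
  have "\<delta> * norm x \<le> exp (\<delta> * norm x)" using power_div_fact_le_exp[of "\<delta> * norm x" 1] assms by simp
  then have "norm x \<le> 1 / \<delta> * exp (\<delta> * norm x)" using assms by (simp add: field_simps)
  moreover have "1 \<le> exp (\<delta> * norm x)" using assms by simp
  ultimately show ?thesis unfolding distrib_right by linarith
qed

context exp_patch
begin

definition SX :: "(real^'n \<Rightarrow> complex) \<Rightarrow> complex" where
  "SX \<phi> = SF (\<lambda>x. Ediv F (cvec \<xi>0) x * \<phi> x)"

text \<open>The domain of e^(-x\<xi>0) T, enlarged by the decay of the quotient: it contains the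
  characters e^(-ix\<eta>), which are not test functions. The values on them are the values of
  f.\<close>

definition XS :: "(real^'n \<Rightarrow> complex) set" where
  "XS = {\<phi>. (\<lambda>x. Ediv F (cvec \<xi>0) x * \<phi> x) \<in> Stest s M}"

lemma SX_lin: "lin_on XS SX" and XS_lin: "lin_closed XS"
proof -
  have e: "(\<lambda>x. Ediv F (cvec \<xi>0) x * (a * \<phi> x + b * \<psi> x))
      = (\<lambda>x. a * (Ediv F (cvec \<xi>0) x * \<phi> x) + b * (Ediv F (cvec \<xi>0) x * \<psi> x))" for a b \<phi> \<psi>
    by (simp add: algebra_simps)
  show "lin_on XS SX"
    using lin_on_SF unfolding lin_on_def SX_def XS_def e by simp
  have "lin_closed (Stest s M :: (real^'n \<Rightarrow> complex) set)" by (rule lin_closed_Stest)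
  then show "lin_closed XS"
    unfolding lin_closed_def XS_def mem_Collect_eq e by simp
qed

lemma SX_family:
  assumes "\<And>i. i \<in> I \<Longrightarrow> smooth_fun (g i)"
    "class_quant s (\<lambda>h. \<exists>C. \<forall>i\<in>I. \<forall>x. pbound M (g i) x (C * A i * exp (e / 2 * norm x)) h)"
  shows "i \<in> I \<Longrightarrow> g i \<in> XS" "\<exists>C. \<forall>i\<in>I. cmod (SX (g i)) \<le> C * A i"
proof -
  have z: "dist (Rev (cvec \<xi>0)) \<xi>0 \<le> e" "cmod (cvec \<xi>0 $ j) \<le> norm (cvec \<xi>0)" for j
    using e by (auto intro: Finite_Cartesian_Product.norm_nth_le)
  show "i \<in> I \<Longrightarrow> g i \<in> XS"
    using Ediv_family(1)[of I "\<lambda>_. cvec \<xi>0" "norm (cvec \<xi>0)" g A, OF z assms] unfolding XS_def by simp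
  show "\<exists>C. \<forall>i\<in>I. cmod (SX (g i)) \<le> C * A i"
    using Ediv_family(2)[of I "\<lambda>_. cvec \<xi>0" "norm (cvec \<xi>0)" g A, OF z assms] unfolding SX_def by simp
qed

lemma Ediv_cpt: "Ediv F (cpt \<xi>0 \<eta>) = (\<lambda>x. Ediv F (cvec \<xi>0) x * expm (ivec \<eta>) x)"
  unfolding cpt_eq Ediv_add[abs_def] ..

lemma expm_ivec_XS: "expm (ivec \<eta>) \<in> XS"
  using Ediv_mem[of "cpt \<xi>0 \<eta>"] e unfolding XS_def Ediv_cpt by (simp add: cpt_eq Rev_add)

context
  fixes \<kappa> :: "nat \<Rightarrow> real^'n \<Rightarrow> complex"
  assumes \<kappa>: "cutoffs \<kappa>"
begin

lemma SX_E: "SX (expm (ivec \<eta>)) = laplace T \<kappa> (cpt \<xi>0 \<eta>)"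
  using laplace_eq[OF \<kappa>, of "cpt \<xi>0 \<eta>"] e unfolding SX_def Ediv_cpt by (simp add: cpt_eq Rev_add)

lemma continuous_on_laplace: "continuous_on S' (\<lambda>\<eta>. laplace T \<kappa> (cpt \<xi>0 \<eta>))"
proof -
  have c: "continuous_on UNIV (cpt \<xi>0)"
    unfolding cpt_eq[abs_def] ivec_def by (intro continuous_intros continuous_on_vec_lambda)
  have "isCont (laplace T \<kappa>) (cpt \<xi>0 \<eta>)" for \<eta>
    using laplace_holomorphic[OF \<kappa>, of "cpt \<xi>0 \<eta>"] has_derivative_continuous
    by (auto simp: cpt_eq Rev_add)
  then have "continuous_on (range (cpt \<xi>0)) (laplace T \<kappa>)" by (auto intro: continuous_at_imp_continuous_on)
  then have "continuous_on UNIV (\<lambda>\<eta>. laplace T \<kappa> (cpt \<xi>0 \<eta>))"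
    by (rule continuous_on_compose2[OF _ c]) simp
  then show ?thesis by (rule continuous_on_subset) simp
qed

lemma laplace_measurable [measurable]: "(\<lambda>\<eta>. laplace T \<kappa> (cpt \<xi>0 \<eta>)) \<in> borel_measurable borel"
  by (rule borel_measurable_continuous_onI[OF continuous_on_laplace])

text \<open>If \<psi> lives within \<delta> of \<eta>0, its Fourier transform is close to the
  integral of \<psi> times the character at \<eta>0. \<open>C\<close> must not depend on \<psi>,
  \<eta>0 or \<delta>, because the pieces are chosen after it.\<close>

lemma swap_local:
  assumes R: "R \<ge> 1"
  shows "\<exists>C\<ge>0. \<forall>\<psi> \<eta>0 \<delta>. integrable lborel \<psi> \<longrightarrow> (\<forall>\<eta>. \<psi> \<eta> \<noteq> 0 \<longrightarrow> norm \<eta> \<le> R \<and> dist \<eta> \<eta>0 \<le> \<delta>) \<longrightarrow> norm \<eta>0 \<le> R \<longrightarrow>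
    fourier \<psi> \<in> XS \<and> cmod (SX (fourier \<psi>) - (LINT \<eta>|lborel. \<psi> \<eta>) * laplace T \<kappa> (cpt \<xi>0 \<eta>0)) \<le> C * (\<delta> * (LINT \<eta>|lborel. cmod (\<psi> \<eta>)))"
proof -
  \<comment> \<open>All admissible triples form one index set, so that \<open>SX_family\<close>
    returns a single constant.\<close>
  define I where "I = {(\<psi> :: real^'n \<Rightarrow> complex, \<eta>0, \<delta>). integrable lborel \<psi> \<and>
    (\<forall>\<eta>. \<psi> \<eta> \<noteq> 0 \<longrightarrow> norm \<eta> \<le> R \<and> dist \<eta> \<eta>0 \<le> \<delta>) \<and> norm \<eta>0 \<le> R}"
  define g where "g i = (case i of (\<psi>, \<eta>0, \<delta>) \<Rightarrow> (\<lambda>x. fourier \<psi> x - (LINT \<eta>|lborel. \<psi> \<eta>) * expm (ivec \<eta>0) x))"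
    for i :: "(real^'n \<Rightarrow> complex) \<times> (real^'n) \<times> real"
  define A where "A i = (case i of (\<psi>, \<eta>0, \<delta>) \<Rightarrow> \<delta> * (LINT \<eta>|lborel. cmod (\<psi> \<eta>)))"
    for i :: "(real^'n \<Rightarrow> complex) \<times> (real^'n) \<times> real"
  have mo: "moments \<psi>" if "(\<psi>, \<eta>0, \<delta>) \<in> I" for \<psi> \<eta>0 \<delta>
    using that unfolding I_def by (intro moments_bounded_support[of \<psi> R]) auto
  have sm: "smooth_fun (g i)" if "i \<in> I" for i
  proof (cases i)
    case (fields \<psi> \<eta>0 \<delta>)
    then show ?thesis using mo that unfolding g_def by (auto intro!: smooth_diff smooth_fourier smooth_cmult smooth_expm)
  qed
  have e2: "e / 2 > 0" using e by simp
  have pb: "\<exists>C. \<forall>i\<in>I. \<forall>x. pbound M (g i) x (C * A i * exp (e / 2 * norm x)) h" if h: "h > 0" for h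
  proof -
    obtain C where C: "C > 0" "\<And>n. (2 * R / h) ^ n \<le> C * M n" using power_le[of "2 * R / h"] h R by auto
    have "pbound M (g i) x (C * (1 + 1 / (e / 2)) * A i * exp (e / 2 * norm x)) h" if i: "i \<in> I" for i x
    proof (cases i)
      case (fields \<psi> \<eta>0 \<delta>)
      have i': "(\<psi>, \<eta>0, \<delta>) \<in> I" using i fields by simp
      have \<psi>: "integrable lborel \<psi>" "\<And>\<eta>. \<psi> \<eta> \<noteq> 0 \<Longrightarrow> norm \<eta> \<le> R \<and> dist \<eta> \<eta>0 \<le> \<delta>" "norm \<eta>0 \<le> R"
        using i' unfolding I_def by auto
      note m = mo[OF i']
      have A: "A i = \<delta> * (LINT \<eta>|lborel. cmod (\<psi> \<eta>))" unfolding A_def fields by simp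
      show ?thesis
        unfolding pbound_def
      proof
        fix js :: "'n list"
        let ?n = "length js"
        let ?D = "\<lambda>\<eta>. (mon js \<eta> * expm (ivec \<eta>) x - mon js \<eta>0 * expm (ivec \<eta>0) x) * \<psi> \<eta>"
        let ?b = "(2 * R) ^ ?n * (1 + norm x) * \<delta>"
        have Db: "cmod (?D \<eta>) \<le> ?b * cmod (\<psi> \<eta>)" for \<eta>
        proof (cases "\<psi> \<eta> = 0")
          case False
          then show ?thesis
            using cmod_monE_diff_le[of \<eta> R \<eta>0 \<delta> js x] \<psi>(2)[OF False] \<psi>(3) R
            unfolding norm_mult[of _ "\<psi> \<eta>"] by (intro mult_right_mono) auto
        qed simp
        have [measurable]: "\<psi> \<in> borel_measurable borel" using borel_measurable_integrable[OF \<psi>(1)] by simp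
        have bi: "integrable lborel (\<lambda>\<eta>. ?b * cmod (\<psi> \<eta>))" using \<psi>(1) by (intro integrable_mult_right integrable_norm)
        have Di: "integrable lborel ?D"
        proof (rule Bochner_Integration.integrable_bound[OF bi])
          show "?D \<in> borel_measurable lborel" by measurable
          show "AE \<eta> in lborel. norm (?D \<eta>) \<le> norm (?b * cmod (\<psi> \<eta>))"
            using Db abs_ge_self order_trans unfolding real_norm_def by (intro AE_I2) blast
        qed
        have "cmod (Dl js (g i) x) = cmod (LINT \<eta>|lborel. ?D \<eta>)"
          unfolding g_def fields using Dl_fourier_minus_exponential[OF m, of js \<eta>0 x] by simp
        also have "\<dots> \<le> (LINT \<eta>|lborel. ?b * cmod (\<psi> \<eta>))"
          by (rule Bochner_Integration.integral_norm_bound_integral[OF Di bi Db])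
        also have "\<dots> = (2 * R) ^ ?n * (1 + norm x) * A i" unfolding A by simp
        finally have 1: "cmod (Dl js (g i) x) \<le> (2 * R) ^ ?n * (1 + norm x) * A i" .
        \<comment> \<open>If \<psi> is identically 0, \<delta> may be negative, but then the
          integral is 0.\<close>
        have A0: "A i \<ge> 0"
        proof (cases "\<exists>\<eta>. \<psi> \<eta> \<noteq> 0")
          case True
          then have "\<delta> \<ge> 0" using \<psi>(2) zero_le_dist order_trans by metis
          then show ?thesis unfolding A by (intro mult_nonneg_nonneg integral_nonneg_AE) auto
        qed (simp add: A)
        have "(2 * R) ^ ?n \<le> C * h ^ ?n * M ?n" using C(2)[of ?n] h by (simp add: power_divide field_simps)
        then have "(2 * R) ^ ?n * (1 + norm x) * A i
            \<le> (C * h ^ ?n * M ?n) * ((1 + 1 / (e / 2)) * exp (e / 2 * norm x)) * A i"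
          using one_plus_norm_le_exp[OF e2, of x] A0 C(1) h R by (intro mult_right_mono mult_mono) auto
        then show "cmod (Dl js (g i) x) \<le> C * (1 + 1 / (e / 2)) * A i * exp (e / 2 * norm x) * h ^ ?n * M ?n"
          using 1 by (simp only: mult_ac)
      qed
    qed
    then show ?thesis by blast
  qed
  obtain C where C: "\<forall>i\<in>I. cmod (SX (g i)) \<le> C * A i"
    using SX_family(2)[of I g A, OF sm class_quant_all[OF pb]] by blast
  have mem: "g i \<in> XS" if "i \<in> I" for i
    using SX_family(1)[of I g A, OF sm class_quant_all[OF pb] that] .
  have "fourier \<psi> \<in> XS \<and> cmod (SX (fourier \<psi>) - (LINT \<eta>|lborel. \<psi> \<eta>) * laplace T \<kappa> (cpt \<xi>0 \<eta>0)) \<le> \<bar>C\<bar> * (\<delta> * (LINT \<eta>|lborel. cmod (\<psi> \<eta>)))"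
    if i: "(\<psi>, \<eta>0, \<delta>) \<in> I" for \<psi> \<eta>0 \<delta>
  proof -
    let ?c = "LINT \<eta>|lborel. \<psi> \<eta>"
    have gi: "g (\<psi>, \<eta>0, \<delta>) = (\<lambda>x. fourier \<psi> x - ?c * expm (ivec \<eta>0) x)" unfolding g_def by simp
    note cE = lin_on_cmult[OF SX_lin XS_lin expm_ivec_XS[of \<eta>0], of ?c]
    note add = lin_on_add[OF SX_lin XS_lin mem[OF i] cE(2)]
    have f: "(\<lambda>x. g (\<psi>, \<eta>0, \<delta>) x + ?c * expm (ivec \<eta>0) x) = fourier \<psi>" unfolding gi by simp
    have "SX (fourier \<psi>) = SX (g (\<psi>, \<eta>0, \<delta>)) + ?c * laplace T \<kappa> (cpt \<xi>0 \<eta>0)"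
      using add(1) cE(1) unfolding f SX_E by simp
    moreover have "cmod (SX (g (\<psi>, \<eta>0, \<delta>))) \<le> \<bar>C\<bar> * A (\<psi>, \<eta>0, \<delta>)"
    proof -
      have "0 \<le> A (\<psi>, \<eta>0, \<delta>)"
      proof (cases "\<exists>\<eta>. \<psi> \<eta> \<noteq> 0")
        case True
        then have "\<delta> \<ge> 0" using i zero_le_dist order_trans unfolding I_def by blast
        then show ?thesis unfolding A_def by (auto intro!: mult_nonneg_nonneg integral_nonneg_AE)
      qed (simp add: A_def)
      then have "C * A (\<psi>, \<eta>0, \<delta>) \<le> \<bar>C\<bar> * A (\<psi>, \<eta>0, \<delta>)" by (intro mult_right_mono) auto
      then show ?thesis using C i by (meson order_trans)
    qed
    ultimately show ?thesis using add(2) unfolding f A_def by simp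
  qed
  then show ?thesis unfolding I_def by (intro exI[of _ "\<bar>C\<bar>"]) auto
qed

text \<open>The pieces have disjoint supports, so their L1 norms add up to that of \<psi>, and the
  total error is \<epsilon> times this norm whatever the number of pieces.\<close>

lemma swap_bounded_support:
  assumes \<psi>: "integrable lborel \<psi>" "\<And>\<eta>. \<psi> \<eta> \<noteq> 0 \<Longrightarrow> norm \<eta> \<le> R"
  shows "fourier \<psi> \<in> XS" "SX (fourier \<psi>) = (LINT \<eta>|lborel. laplace T \<kappa> (cpt \<xi>0 \<eta>) * \<psi> \<eta>)"
proof -
  define R' where "R' = max 1 R"
  have R': "R' \<ge> 1" "\<And>\<eta>. \<psi> \<eta> \<noteq> 0 \<Longrightarrow> norm \<eta> \<le> R'" unfolding R'_def using \<psi>(2) by (auto simp: max.coboundedI2)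
  let ?u = "\<lambda>\<eta>. laplace T \<kappa> (cpt \<xi>0 \<eta>)"
  obtain C where C: "C \<ge> 0" "\<forall>\<psi> \<eta>0 \<delta>. integrable lborel \<psi> \<longrightarrow> (\<forall>\<eta>. \<psi> \<eta> \<noteq> 0 \<longrightarrow> norm \<eta> \<le> R' \<and> dist \<eta> \<eta>0 \<le> \<delta>) \<longrightarrow> norm \<eta>0 \<le> R' \<longrightarrow>
    fourier \<psi> \<in> XS \<and> cmod (SX (fourier \<psi>) - (LINT \<eta>|lborel. \<psi> \<eta>) * ?u \<eta>0) \<le> C * (\<delta> * (LINT \<eta>|lborel. cmod (\<psi> \<eta>)))"
    using swap_local[OF R'(1)] by blast
  have "compact (?u ` cball 0 R')" by (intro compact_continuous_image continuous_on_laplace compact_cball)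
  then have "bounded (?u ` cball 0 R')" by (rule compact_imp_bounded)
  then obtain b where "\<forall>y\<in>?u ` cball 0 R'. cmod y \<le> b" unfolding bounded_iff by blast
  then have b: "cmod (?u \<eta>) \<le> b" if "norm \<eta> \<le> R'" for \<eta> using that by simp
  have ui: "integrable lborel (\<lambda>\<eta>. ?u \<eta> * \<phi> \<eta>)"
    if \<phi>: "integrable lborel \<phi>" "\<And>\<eta>. \<phi> \<eta> \<noteq> 0 \<Longrightarrow> norm \<eta> \<le> R'" for \<phi>
  proof (rule Bochner_Integration.integrable_bound)
    show "integrable lborel (\<lambda>\<eta>. b * cmod (\<phi> \<eta>))" using \<phi>(1) by (intro integrable_mult_right integrable_norm)
    have [measurable]: "\<phi> \<in> borel_measurable borel" using borel_measurable_integrable[OF \<phi>(1)] by simp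
    show "(\<lambda>\<eta>. ?u \<eta> * \<phi> \<eta>) \<in> borel_measurable lborel" by measurable
    have "norm (?u \<eta> * \<phi> \<eta>) \<le> norm (b * cmod (\<phi> \<eta>))" for \<eta>
    proof (cases "\<phi> \<eta> = 0")
      case False
      then have "cmod (?u \<eta>) \<le> \<bar>b\<bar>" using b[OF \<phi>(2)[OF False]] by linarith
      then show ?thesis by (simp add: norm_mult abs_mult mult_right_mono)
    qed simp
    then show "AE \<eta> in lborel. norm (?u \<eta> * \<phi> \<eta>) \<le> norm (b * cmod (\<phi> \<eta>))" by simp
  qed
  have uc: "uniformly_continuous_on (cball 0 R') ?u"
    by (intro compact_uniformly_continuous continuous_on_laplace compact_cball)
  have err: "fourier \<psi> \<in> XS \<and> cmod (SX (fourier \<psi>) - (LINT \<eta>|lborel. ?u \<eta> * \<psi> \<eta>)) \<le> \<epsilon> * (LINT \<eta>|lborel. cmod (\<psi> \<eta>))"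
    if \<epsilon>: "\<epsilon> > 0" for \<epsilon>
  proof -
    obtain d where d: "d > 0" "\<forall>x\<in>cball 0 R'. \<forall>x'\<in>cball 0 R'. dist x' x < d \<longrightarrow> dist (?u x') (?u x) < \<epsilon> / 2"
      using uc \<epsilon> unfolding uniformly_continuous_on_def by (meson half_gt_zero)
    \<comment> \<open>d/2 makes f vary by less than \<epsilon>/2 between a piece and its centre, the
      second entry makes C \<delta> at most \<epsilon>/2; each piece then contributes \<epsilon>
      times its L1 norm.\<close>
    define \<delta> where "\<delta> = min (d / 2) (\<epsilon> / (2 * (C + 1)))"
    have \<delta>: "\<delta> > 0" "\<delta> < d" "C * \<delta> \<le> \<epsilon> / 2"
    proof -
      show "\<delta> > 0" "\<delta> < d" unfolding \<delta>_def using d(1) \<epsilon> C(1) by auto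
      have "C * \<delta> \<le> C * (\<epsilon> / (2 * (C + 1)))" unfolding \<delta>_def using C(1) by (intro mult_left_mono) auto
      also have "\<dots> \<le> \<epsilon> / 2" using C(1) \<epsilon> by (simp add: field_simps)
      finally show "C * \<delta> \<le> \<epsilon> / 2" .
    qed
    obtain K where K: "finite K" "K \<subseteq> cball 0 R'" "cball (0 :: real^'n) R' \<subseteq> (\<Union>k\<in>K. ball k \<delta>)"
    proof (rule compactE_image[OF compact_cball, of "cball 0 R'" "\<lambda>k. ball k \<delta>" 0 R'])
      show "cball 0 R' \<subseteq> (\<Union>k\<in>cball (0 :: real^'n) R'. ball k \<delta>)" using \<delta>(1) by force
    qed auto
    \<comment> \<open>Generalised to all functions supported in the union of the balls, so that one
      ball can be removed at a time.\<close>
    have "fourier \<phi> \<in> XS \<and> cmod (SX (fourier \<phi>) - (LINT \<eta>|lborel. ?u \<eta> * \<phi> \<eta>)) \<le> \<epsilon> * (LINT \<eta>|lborel. cmod (\<phi> \<eta>))"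
      if "integrable lborel \<phi>" "\<And>\<eta>. \<phi> \<eta> \<noteq> 0 \<Longrightarrow> norm \<eta> \<le> R' \<and> \<eta> \<in> (\<Union>k\<in>K. ball k \<delta>)" for \<phi>
      using K(1,2) that
    proof (induct K arbitrary: \<phi> rule: finite_induct)
      case empty
      then have z: "\<phi> = (\<lambda>\<eta>. 0)" by auto
      have fz: "fourier \<phi> = (\<lambda>x. 0)" unfolding z fourier_eq[abs_def] by simp
      have "(\<lambda>x. 0) \<in> XS" using XS_lin unfolding lin_closed_def by blast
      then show ?case unfolding fz using lin_on_zero[OF SX_lin XS_lin] by (simp add: z)
    next
      case (insert k K)
      have [measurable]: "\<phi> \<in> borel_measurable borel" using borel_measurable_integrable[OF insert.prems(2)] by simp
      define \<phi>1 where "\<phi>1 \<eta> = indicator (ball k \<delta>) \<eta> * \<phi> \<eta>" for \<eta>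
      define \<phi>2 where "\<phi>2 \<eta> = indicator (- ball k \<delta>) \<eta> * \<phi> \<eta>" for \<eta>
      have \<phi>12: "\<phi> = (\<lambda>\<eta>. \<phi>1 \<eta> + \<phi>2 \<eta>)" unfolding \<phi>1_def \<phi>2_def by (auto simp: indicator_def)
      have i1: "integrable lborel \<phi>1"
        by (rule Bochner_Integration.integrable_bound[OF insert.prems(2)]) (auto simp: \<phi>1_def[abs_def] indicator_def)
      have i2: "integrable lborel \<phi>2"
        by (rule Bochner_Integration.integrable_bound[OF insert.prems(2)]) (auto simp: \<phi>2_def[abs_def] indicator_def)
      have s1: "norm \<eta> \<le> R' \<and> dist \<eta> k \<le> \<delta>" if "\<phi>1 \<eta> \<noteq> 0" for \<eta>
        using that insert.prems(3)[of \<eta>] unfolding \<phi>1_def by (auto simp: indicator_def dist_commute split: if_splits)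
      have s2: "norm \<eta> \<le> R' \<and> \<eta> \<in> (\<Union>k\<in>K. ball k \<delta>)" if "\<phi>2 \<eta> \<noteq> 0" for \<eta>
        using that insert.prems(3)[of \<eta>] unfolding \<phi>2_def by (auto simp: indicator_def split: if_splits)
      have k: "norm k \<le> R'" using insert.prems(1) by simp
      have IH: "fourier \<phi>2 \<in> XS" "cmod (SX (fourier \<phi>2) - (LINT \<eta>|lborel. ?u \<eta> * \<phi>2 \<eta>)) \<le> \<epsilon> * (LINT \<eta>|lborel. cmod (\<phi>2 \<eta>))"
        using insert.hyps(3)[of \<phi>2] insert.prems(1) i2 s2 by auto
      have L: "fourier \<phi>1 \<in> XS" "cmod (SX (fourier \<phi>1) - (LINT \<eta>|lborel. \<phi>1 \<eta>) * ?u k) \<le> C * (\<delta> * (LINT \<eta>|lborel. cmod (\<phi>1 \<eta>)))"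
        using C(2)[rule_format, of \<phi>1 k \<delta>] i1 s1 k by auto
      have u1: "integrable lborel (\<lambda>\<eta>. ?u \<eta> * \<phi>1 \<eta>)" "integrable lborel (\<lambda>\<eta>. ?u \<eta> * \<phi>2 \<eta>)"
        using ui[OF i1] ui[OF i2] s1 s2 by auto
      have "cmod ((LINT \<eta>|lborel. \<phi>1 \<eta>) * ?u k - (LINT \<eta>|lborel. ?u \<eta> * \<phi>1 \<eta>)) \<le> \<epsilon> / 2 * (LINT \<eta>|lborel. cmod (\<phi>1 \<eta>))"
      proof -
        have ku: "integrable lborel (\<lambda>\<eta>. \<phi>1 \<eta> * ?u k)" using i1 by simp
        have di: "integrable lborel (\<lambda>\<eta>. \<phi>1 \<eta> * ?u k - ?u \<eta> * \<phi>1 \<eta>)" using ku u1(1) by simp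
        have "(LINT \<eta>|lborel. \<phi>1 \<eta>) * ?u k - (LINT \<eta>|lborel. ?u \<eta> * \<phi>1 \<eta>) = (LINT \<eta>|lborel. \<phi>1 \<eta> * ?u k - ?u \<eta> * \<phi>1 \<eta>)"
          using ku u1(1) by simp
        also have "cmod \<dots> \<le> (LINT \<eta>|lborel. \<epsilon> / 2 * cmod (\<phi>1 \<eta>))"
        proof (rule Bochner_Integration.integral_norm_bound_integral[OF di])
          show "integrable lborel (\<lambda>\<eta>. \<epsilon> / 2 * cmod (\<phi>1 \<eta>))" using i1 by (intro integrable_mult_right integrable_norm)
          show "cmod (\<phi>1 \<eta> * ?u k - ?u \<eta> * \<phi>1 \<eta>) \<le> \<epsilon> / 2 * cmod (\<phi>1 \<eta>)" for \<eta>
          proof (cases "\<phi>1 \<eta> = 0")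
            case False
            then have "dist (?u k) (?u \<eta>) < \<epsilon> / 2"
              using d(2) s1[OF False] k \<delta>(2) by (auto simp: dist_commute)
            then have "cmod (?u k - ?u \<eta>) * cmod (\<phi>1 \<eta>) \<le> \<epsilon> / 2 * cmod (\<phi>1 \<eta>)"
              unfolding dist_norm by (intro mult_right_mono) auto
            moreover have "\<phi>1 \<eta> * ?u k - ?u \<eta> * \<phi>1 \<eta> = (?u k - ?u \<eta>) * \<phi>1 \<eta>" by (simp add: algebra_simps)
            ultimately show ?thesis by (simp only: norm_mult)
          qed simp
        qed
        finally show ?thesis by simp
      qed
      moreover have "C * (\<delta> * (LINT \<eta>|lborel. cmod (\<phi>1 \<eta>))) \<le> \<epsilon> / 2 * (LINT \<eta>|lborel. cmod (\<phi>1 \<eta>))"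
        unfolding mult.assoc[symmetric] using \<delta>(3) by (intro mult_right_mono integral_nonneg_AE) auto
      ultimately have E1: "cmod (SX (fourier \<phi>1) - (LINT \<eta>|lborel. ?u \<eta> * \<phi>1 \<eta>)) \<le> \<epsilon> * (LINT \<eta>|lborel. cmod (\<phi>1 \<eta>))"
        using L(2) norm_triangle_ineq[of "SX (fourier \<phi>1) - (LINT \<eta>|lborel. \<phi>1 \<eta>) * ?u k" "(LINT \<eta>|lborel. \<phi>1 \<eta>) * ?u k - (LINT \<eta>|lborel. ?u \<eta> * \<phi>1 \<eta>)"]
        by simp
      have m12: "moments \<phi>1" "moments \<phi>2" using moments_bounded_support[of _ R'] i1 i2 s1 s2 by blast+
      have f: "fourier \<phi> = (\<lambda>x. fourier \<phi>1 x + fourier \<phi>2 x)"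
        by (subst \<phi>12) (rule fourier_add[OF m12])
      have Sf: "SX (fourier \<phi>) = SX (fourier \<phi>1) + SX (fourier \<phi>2)" "fourier \<phi> \<in> XS"
        unfolding f using lin_on_add[OF SX_lin XS_lin L(1) IH(1)] by auto
      have If: "(LINT \<eta>|lborel. ?u \<eta> * \<phi> \<eta>) = (LINT \<eta>|lborel. ?u \<eta> * \<phi>1 \<eta>) + (LINT \<eta>|lborel. ?u \<eta> * \<phi>2 \<eta>)"
        by (subst \<phi>12) (use u1 in \<open>simp add: distrib_left\<close>)
      have "cmod (\<phi> \<eta>) = cmod (\<phi>1 \<eta>) + cmod (\<phi>2 \<eta>)" for \<eta>
        unfolding \<phi>1_def \<phi>2_def by (auto simp: indicator_def)
      then have In: "(LINT \<eta>|lborel. cmod (\<phi> \<eta>)) = (LINT \<eta>|lborel. cmod (\<phi>1 \<eta>)) + (LINT \<eta>|lborel. cmod (\<phi>2 \<eta>))"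
        using i1 i2 by simp
      have split: "SX (fourier \<phi>) - (LINT \<eta>|lborel. ?u \<eta> * \<phi> \<eta>) = (SX (fourier \<phi>1) - (LINT \<eta>|lborel. ?u \<eta> * \<phi>1 \<eta>)) + (SX (fourier \<phi>2) - (LINT \<eta>|lborel. ?u \<eta> * \<phi>2 \<eta>))"
        unfolding Sf If by simp
      have "cmod (SX (fourier \<phi>) - (LINT \<eta>|lborel. ?u \<eta> * \<phi> \<eta>)) \<le> \<epsilon> * (LINT \<eta>|lborel. cmod (\<phi> \<eta>))"
        unfolding split In distrib_left by (rule order_trans[OF norm_triangle_ineq add_mono[OF E1 IH(2)]])
      then show ?case using Sf(2) by blast
    qed
    from this[OF \<psi>(1)] show ?thesis using R'(2) K(3) by (metis (no_types, lifting) mem_cball_0 subsetD)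
  qed
  show "fourier \<psi> \<in> XS" using err[of 1] by simp
  have "cmod (SX (fourier \<psi>) - (LINT \<eta>|lborel. ?u \<eta> * \<psi> \<eta>)) \<le> 0"
  proof (rule field_le_epsilon)
    fix t :: real assume t: "t > 0"
    define J where "J = (LINT \<eta>|lborel. cmod (\<psi> \<eta>))"
    have J: "J \<ge> 0" unfolding J_def by (intro integral_nonneg_AE) auto
    have "t / (J + 1) * J \<le> t" using t J by (simp add: field_simps)
    then show "cmod (SX (fourier \<psi>) - (LINT \<eta>|lborel. ?u \<eta> * \<psi> \<eta>)) \<le> 0 + t"
      using err[of "t / (J + 1)"] t J unfolding J_def[symmetric] by simp
  qed
  then show "SX (fourier \<psi>) = (LINT \<eta>|lborel. ?u \<eta> * \<psi> \<eta>)" by simp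
qed

text \<open>The functions \<psi>(\<eta>) e^(-ix\<eta>) of x, indexed by \<eta> with amplitude
  \<open>jdec \<eta>\<close>, are estimated as one family. This avoids weighing the growth of f
  against the decay of \<psi>.\<close>

lemma integrable_laplace_mult:
  assumes \<psi>: "\<psi> \<in> Stest s M"
  shows "integrable lborel (\<lambda>\<eta>. laplace T \<kappa> (cpt \<xi>0 \<eta>) * \<psi> \<eta>)"
proof -
  have sm: "smooth_fun \<psi>" and cq: "class_quant s (\<lambda>h. \<exists>A. SB M h A \<psi>)" using \<psi> unfolding Stest_iff by auto
  have [measurable]: "\<psi> \<in> borel_measurable borel" using smooth_measurable[OF sm] by simp
  have smg: "smooth_fun (\<lambda>x. \<psi> \<eta> * expm (ivec \<eta>) x)" for \<eta> by (intro smooth_cmult smooth_expm)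
  have cqg: "class_quant s (\<lambda>h. \<exists>C. \<forall>\<eta>\<in>UNIV. \<forall>x. pbound M (\<lambda>x. \<psi> \<eta> * expm (ivec \<eta>) x) x (C * jdec \<eta> * exp (e / 2 * norm x)) h)"
    using cq
  proof (rule class_quant_scale[where c=H])
    fix h :: real assume h: "h > 0" "\<exists>A. SB M h A \<psi>"
    obtain A where "SB M h A \<psi>" using h(2) by blast
    from SB_power_jdec[OF this h(1), of 0]
    obtain K where K: "K \<ge> 0" "\<forall>p \<eta>. jb \<eta> ^ (p + 0) * cmod (\<psi> \<eta>) \<le> K * (H * h) ^ p * M p * jdec \<eta>" by blast
    have "pbound M (\<lambda>x. \<psi> \<eta> * expm (ivec \<eta>) x) x (K * jdec \<eta> * exp (e / 2 * norm x)) (H * h)" for \<eta> x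
      unfolding pbound_def
    proof
      fix js :: "'n list"
      let ?n = "length js"
      have "cmod (Dl js (\<lambda>x. \<psi> \<eta> * expm (ivec \<eta>) x) x) = cmod (mon js \<eta>) * cmod (\<psi> \<eta>)"
        by (simp add: Dl_cmult[OF smooth_expm] Dl_expm_ivec norm_mult)
      also have "\<dots> \<le> jb \<eta> ^ ?n * cmod (\<psi> \<eta>)"
      proof (intro mult_right_mono)
        have "norm \<eta> ^ ?n \<le> jb \<eta> ^ ?n" using norm_le_jb[of \<eta>] by (intro power_mono) auto
        then show "cmod (mon js \<eta>) \<le> jb \<eta> ^ ?n" using cmod_mon_le[of js \<eta>] by linarith
      qed simp
      also have "\<dots> \<le> (K * (H * h) ^ ?n * M ?n * jdec \<eta>) * 1" using K(2)[rule_format, of \<eta> ?n] by simp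
      also have "\<dots> \<le> (K * (H * h) ^ ?n * M ?n * jdec \<eta>) * exp (e / 2 * norm x)"
        using K(1) h(1) H e by (intro mult_left_mono) auto
      finally show "cmod (Dl js (\<lambda>x. \<psi> \<eta> * expm (ivec \<eta>) x) x) \<le> K * jdec \<eta> * exp (e / 2 * norm x) * (H * h) ^ ?n * M ?n"
        by (simp only: mult_ac)
    qed
    then show "\<exists>C. \<forall>\<eta>\<in>UNIV. \<forall>x. pbound M (\<lambda>x. \<psi> \<eta> * expm (ivec \<eta>) x) x (C * jdec \<eta> * exp (e / 2 * norm x)) (H * h)" by blast
  qed (use H in simp)
  obtain C where C: "\<And>\<eta>. cmod (SX (\<lambda>x. \<psi> \<eta> * expm (ivec \<eta>) x)) \<le> C * jdec \<eta>"
    using SX_family(2)[of UNIV "\<lambda>\<eta> x. \<psi> \<eta> * expm (ivec \<eta>) x" jdec, OF smg cqg] by blast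
  show ?thesis
  proof (rule integrable_of_jdec_bound(1))
    show "(\<lambda>\<eta>. laplace T \<kappa> (cpt \<xi>0 \<eta>) * \<psi> \<eta>) \<in> borel_measurable lborel" by measurable
    show "cmod (laplace T \<kappa> (cpt \<xi>0 \<eta>) * \<psi> \<eta>) \<le> C * jdec \<eta>" for \<eta>
      using C[of \<eta>] lin_on_cmult(1)[OF SX_lin XS_lin expm_ivec_XS[of \<eta>], of "\<psi> \<eta>"] unfolding SX_E by (simp add: mult.commute)
  qed
qed

text \<open>The part of \<psi> beyond radius n + 1 contributes O(1/(n+1)) under \<open>SX\<close>;
  the part inside has bounded support, and its integrals converge by domination.\<close>

lemma swap_Stest:
  assumes \<psi>: "\<psi> \<in> Stest s M"
  shows "SX (fourier \<psi>) = (LINT \<eta>|lborel. laplace T \<kappa> (cpt \<xi>0 \<eta>) * \<psi> \<eta>)"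
proof -
  have sm: "smooth_fun \<psi>" and cq: "class_quant s (\<lambda>h. \<exists>A. SB M h A \<psi>)" using \<psi> unfolding Stest_iff by auto
  have [measurable]: "\<psi> \<in> borel_measurable borel" using smooth_measurable[OF sm] by simp
  obtain h0 A0 where "h0 > 0" "SB M h0 A0 \<psi>" using class_quant_ex[OF cq] by blast
  then have m\<psi>: "moments \<psi>" using moments_SB sm by blast
  define B where "B n = cball (0 :: real^'n) (real (Suc n))" for n
  have [measurable]: "B n \<in> sets borel" for n unfolding B_def by simp
  define \<psi>1 where "\<psi>1 n \<eta> = indicator (B n) \<eta> * \<psi> \<eta>" for n \<eta>
  define \<psi>2 where "\<psi>2 n \<eta> = indicator (- B n) \<eta> * \<psi> \<eta>" for n \<eta>
  have \<psi>12: "\<psi> = (\<lambda>\<eta>. \<psi>1 n \<eta> + \<psi>2 n \<eta>)" for n unfolding \<psi>1_def \<psi>2_def by (auto simp: indicator_def)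
  have m1: "moments (\<psi>1 n)" for n
    by (rule moments_dominated[OF m\<psi>, of _ 1 0]) (auto simp: \<psi>1_def[abs_def] indicator_def)
  have m2: "moments (\<psi>2 n)" for n
    by (rule moments_dominated[OF m\<psi>, of _ 1 0]) (auto simp: \<psi>2_def[abs_def] indicator_def)
  define J where "J = (LINT \<eta>|lborel. jdec (\<eta> :: real^'n))"
  have J: "J \<ge> 0" unfolding J_def by simp
  have cqg: "class_quant s (\<lambda>h. \<exists>C. \<forall>n\<in>UNIV. \<forall>x. pbound M (fourier (\<psi>2 n)) x (C * (1 / real (Suc n)) * exp (e / 2 * norm x)) h)"
    using cq
  proof (rule class_quant_scale[where c=H])
    fix h :: real assume h: "h > 0" "\<exists>A. SB M h A \<psi>"
    obtain A where "SB M h A \<psi>" using h(2) by blast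
    \<comment> \<open>One spare power of the bracket: outside the ball it is at least n + 1, which
      produces the factor 1/(n+1).\<close>
    from SB_power_jdec[OF this h(1), of 1]
    obtain K where K: "K \<ge> 0" "\<forall>p \<eta>. jb \<eta> ^ (p + 1) * cmod (\<psi> \<eta>) \<le> K * (H * h) ^ p * M p * jdec \<eta>" by blast
    have "pbound M (fourier (\<psi>2 n)) x (K * J * (1 / real (Suc n)) * exp (e / 2 * norm x)) (H * h)" for n x
      unfolding pbound_def
    proof
      fix js :: "'n list"
      let ?n = "length js"
      have [measurable]: "\<psi>2 n \<in> borel_measurable borel" using m2 unfolding moments_def by simp
      have "cmod (Dl js (fourier (\<psi>2 n)) x) = cmod (LINT \<eta>|lborel. expm (ivec \<eta>) x * (mon js \<eta> * \<psi>2 n \<eta>))"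
        unfolding Dl_fourier[OF m2] fourier_eq ..
      also have "\<dots> \<le> (K * (H * h) ^ ?n * M ?n * (1 / real (Suc n))) * (LINT \<eta>|lborel. jdec (\<eta> :: real^'n))"
      proof (rule integrable_of_jdec_bound(2))
        show "(\<lambda>\<eta>. expm (ivec \<eta>) x * (mon js \<eta> * \<psi>2 n \<eta>)) \<in> borel_measurable lborel" by measurable
        show "cmod (expm (ivec \<eta>) x * (mon js \<eta> * \<psi>2 n \<eta>)) \<le> (K * (H * h) ^ ?n * M ?n * (1 / real (Suc n))) * jdec \<eta>" for \<eta>
        proof (cases "\<eta> \<in> B n")
          case False
          then have "real (Suc n) \<le> norm \<eta>" unfolding B_def by simp
          then have j: "real (Suc n) \<le> jb \<eta>" using norm_le_jb[of \<eta>] by linarith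
          have "norm \<eta> ^ ?n \<le> jb \<eta> ^ ?n" using norm_le_jb[of \<eta>] by (intro power_mono) auto
          then have "cmod (mon js \<eta>) \<le> jb \<eta> ^ ?n" using cmod_mon_le[of js \<eta>] by linarith
          then have "cmod (mon js \<eta> * \<psi> \<eta>) * real (Suc n) \<le> jb \<eta> ^ ?n * cmod (\<psi> \<eta>) * jb \<eta>"
            unfolding norm_mult using j by (intro mult_mono mult_right_mono) (auto simp: less_imp_le)
          also have "\<dots> = jb \<eta> ^ (?n + 1) * cmod (\<psi> \<eta>)" by simp
          also have "\<dots> \<le> K * (H * h) ^ ?n * M ?n * jdec \<eta>" using K(2) by blast
          finally have "cmod (mon js \<eta> * \<psi> \<eta>) \<le> K * (H * h) ^ ?n * M ?n * jdec \<eta> / real (Suc n)"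
            by (subst pos_le_divide_eq) auto
          then show ?thesis using False unfolding \<psi>2_def by (simp add: norm_mult)
        next
          case True
          then show ?thesis using K(1) H h(1) unfolding \<psi>2_def by simp
        qed
      qed
      also have "\<dots> = (K * J * (1 / real (Suc n)) * (H * h) ^ ?n * M ?n) * 1" unfolding J_def by simp
      also have "\<dots> \<le> (K * J * (1 / real (Suc n)) * (H * h) ^ ?n * M ?n) * exp (e / 2 * norm x)"
        using K(1) J H h(1) e by (intro mult_left_mono) auto
      finally show "cmod (Dl js (fourier (\<psi>2 n)) x) \<le> K * J * (1 / real (Suc n)) * exp (e / 2 * norm x) * (H * h) ^ ?n * M ?n"
        by (simp only: mult_ac)
    qed
    then show "\<exists>C. \<forall>n\<in>UNIV. \<forall>x. pbound M (fourier (\<psi>2 n)) x (C * (1 / real (Suc n)) * exp (e / 2 * norm x)) (H * h)" by blast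
  qed (use H in simp)
  note fam = SX_family[of UNIV "\<lambda>n. fourier (\<psi>2 n)" "\<lambda>n. 1 / real (Suc n)", OF smooth_fourier[OF m2] cqg]
  obtain C where C: "\<And>n. cmod (SX (fourier (\<psi>2 n))) \<le> C * (1 / real (Suc n))" using fam(2) by blast
  have l: "(\<lambda>n. C * (1 / real (Suc n))) \<longlonglongrightarrow> 0"
    using tendsto_mult[OF tendsto_const LIMSEQ_inverse_real_of_nat, of C] by (simp add: divide_inverse)
  have t2: "(\<lambda>n. SX (fourier (\<psi>2 n))) \<longlonglongrightarrow> 0"
    by (rule Lim_null_comparison[OF _ l]) (use C in auto)
  have i1: "integrable lborel (\<psi>1 n)" for n using moments_integrable[OF m1] .
  have s1: "\<psi>1 n \<eta> \<noteq> 0 \<Longrightarrow> norm \<eta> \<le> real (Suc n)" for n \<eta>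
    unfolding \<psi>1_def B_def by (auto simp: indicator_def split: if_splits)
  note sw = swap_bounded_support[OF i1 s1]
  have eq: "SX (fourier \<psi>) = (LINT \<eta>|lborel. laplace T \<kappa> (cpt \<xi>0 \<eta>) * \<psi>1 n \<eta>) + SX (fourier (\<psi>2 n))" for n
  proof -
    have "fourier \<psi> = (\<lambda>x. fourier (\<psi>1 n) x + fourier (\<psi>2 n) x)"
      by (subst \<psi>12[of n]) (rule fourier_add[OF m1 m2])
    then show ?thesis using lin_on_add(1)[OF SX_lin XS_lin sw(1) fam(1)] sw(2) by simp
  qed
  have "(\<lambda>n. (LINT \<eta>|lborel. laplace T \<kappa> (cpt \<xi>0 \<eta>) * \<psi>1 n \<eta>)) = (\<lambda>n. SX (fourier \<psi>) - SX (fourier (\<psi>2 n)))"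
  proof
    fix n
    show "(LINT \<eta>|lborel. laplace T \<kappa> (cpt \<xi>0 \<eta>) * \<psi>1 n \<eta>) = SX (fourier \<psi>) - SX (fourier (\<psi>2 n))"
      by (simp only: eq[of n] add_diff_cancel_right')
  qed
  then have lim1: "(\<lambda>n. (LINT \<eta>|lborel. laplace T \<kappa> (cpt \<xi>0 \<eta>) * \<psi>1 n \<eta>)) \<longlonglongrightarrow> SX (fourier \<psi>)"
    using tendsto_diff[OF tendsto_const t2, of "SX (fourier \<psi>)"] by simp
  have lim2: "(\<lambda>n. (LINT \<eta>|lborel. laplace T \<kappa> (cpt \<xi>0 \<eta>) * \<psi>1 n \<eta>)) \<longlonglongrightarrow> (LINT \<eta>|lborel. laplace T \<kappa> (cpt \<xi>0 \<eta>) * \<psi> \<eta>)"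
  proof (rule integral_dominated_convergence)
    show "integrable lborel (\<lambda>\<eta>. cmod (laplace T \<kappa> (cpt \<xi>0 \<eta>) * \<psi> \<eta>))"
      by (intro integrable_norm integrable_laplace_mult \<psi>)
    show "(\<lambda>\<eta>. laplace T \<kappa> (cpt \<xi>0 \<eta>) * \<psi> \<eta>) \<in> borel_measurable lborel" by measurable
    show "(\<lambda>\<eta>. laplace T \<kappa> (cpt \<xi>0 \<eta>) * \<psi>1 n \<eta>) \<in> borel_measurable lborel" for n
      unfolding \<psi>1_def by measurable
    show "AE \<eta> in lborel. (\<lambda>n. laplace T \<kappa> (cpt \<xi>0 \<eta>) * \<psi>1 n \<eta>) \<longlonglongrightarrow> laplace T \<kappa> (cpt \<xi>0 \<eta>) * \<psi> \<eta>"
    proof (intro AE_I2 tendsto_intros)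
      fix \<eta> :: "real^'n"
      obtain N where N: "norm \<eta> \<le> real N" using real_arch_simple by blast
      have "\<forall>\<^sub>F n in sequentially. \<psi>1 n \<eta> = \<psi> \<eta>"
        using eventually_ge_at_top[of N]
      proof eventually_elim
        case (elim n)
        then have "\<eta> \<in> B n" using N unfolding B_def by simp
        then show ?case unfolding \<psi>1_def by simp
      qed
      then show "(\<lambda>n. \<psi>1 n \<eta>) \<longlonglongrightarrow> \<psi> \<eta>" by (rule tendsto_eventually)
    qed
    show "AE \<eta> in lborel. norm (laplace T \<kappa> (cpt \<xi>0 \<eta>) * \<psi>1 n \<eta>) \<le> cmod (laplace T \<kappa> (cpt \<xi>0 \<eta>) * \<psi> \<eta>)" for n
      unfolding \<psi>1_def by (intro AE_I2) (auto simp: indicator_def norm_mult)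
  qed
  show ?thesis by (rule LIMSEQ_unique[OF lim1 lim2])
qed

end

end

section \<open>Uniform bounds on compact sets\<close>

lemma dual_quant_ball:
  assumes "finite D" "\<And>d. d \<in> D \<Longrightarrow> dual_quant s (P d)"
    "\<And>d h k. 0 < h \<Longrightarrow> h \<le> k \<Longrightarrow> P d k \<Longrightarrow> P d h"
  shows "dual_quant s (\<lambda>h. \<forall>d\<in>D. P d h)"
  using assms(1,2)
proof (induct D rule: finite_induct)
  case empty
  show ?case by (cases s) (auto simp: dual_quant_def intro: exI[of _ 1])
next
  case (insert d D)
  have "dual_quant s (\<lambda>h. P d h \<and> (\<forall>d\<in>D. P d h))"
    by (rule dual_quant_conj) (use insert assms(3) in blast)+
  then show ?case by simp
qed

context weights
begin

text \<open>Indexed by h with rate k = 2/h, as delivered by \<open>laplace_growth\<close>, so that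
  the bound is inherited by smaller h and fits \<open>dual_quant\<close>.\<close>

definition patch_bound :: "(complex^'n::finite \<Rightarrow> complex) \<Rightarrow> (real^'n) set \<Rightarrow> real \<Rightarrow> bool" where
  "patch_bound f K h \<longleftrightarrow> (\<exists>C. \<forall>\<xi>\<in>K. \<forall>\<eta>. cmod (f (cpt \<xi> \<eta>)) \<le> C * exp (assoc_fun M (2 / h * norm \<eta>)))"

lemma patch_bound_antimono:
  assumes "0 < h" "h \<le> k" "patch_bound f K k" shows "patch_bound f K h"
proof -
  obtain C where C: "\<forall>\<xi>\<in>K. \<forall>\<eta>. cmod (f (cpt \<xi> \<eta>)) \<le> C * exp (assoc_fun M (2 / k * norm \<eta>))"
    using assms(3) unfolding patch_bound_def by blast
  have "cmod (f (cpt \<xi> \<eta>)) \<le> \<bar>C\<bar> * exp (assoc_fun M (2 / h * norm \<eta>))" if "\<xi> \<in> K" for \<xi> \<eta>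
  proof -
    have "2 / k \<le> 2 / h" using assms(1,2) by (intro divide_left_mono) auto
    then have "assoc_fun M (2 / k * norm \<eta>) \<le> assoc_fun M (2 / h * norm \<eta>)"
      using assms by (intro assoc_fun_mono mult_right_mono) auto
    then have "C * exp (assoc_fun M (2 / k * norm \<eta>)) \<le> \<bar>C\<bar> * exp (assoc_fun M (2 / h * norm \<eta>))"
      by (intro mult_mono) auto
    then show ?thesis using C that by (meson order_trans)
  qed
  then show ?thesis unfolding patch_bound_def by blast
qed

lemma patch_bound_Union:
  assumes "finite D" "\<forall>d\<in>D. patch_bound f (K d) h"
  shows "patch_bound f (\<Union>d\<in>D. K d) h"
proof -
  have "\<forall>d. \<exists>C. d \<in> D \<longrightarrow> (\<forall>\<xi>\<in>K d. \<forall>\<eta>. cmod (f (cpt \<xi> \<eta>)) \<le> C * exp (assoc_fun M (2 / h * norm \<eta>)))"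
    using assms(2) unfolding patch_bound_def by blast
  then obtain C where C: "\<And>d. d \<in> D \<Longrightarrow> \<forall>\<xi>\<in>K d. \<forall>\<eta>. cmod (f (cpt \<xi> \<eta>)) \<le> C d * exp (assoc_fun M (2 / h * norm \<eta>))"
    by metis
  have "cmod (f (cpt \<xi> \<eta>)) \<le> (\<Sum>d\<in>D. \<bar>C d\<bar>) * exp (assoc_fun M (2 / h * norm \<eta>))" if "d \<in> D" "\<xi> \<in> K d" for d \<xi> \<eta>
  proof -
    have "C d \<le> (\<Sum>d\<in>D. \<bar>C d\<bar>)" using member_le_sum[of d D "\<lambda>d. \<bar>C d\<bar>"] that(1) assms(1) by simp
    then have "C d * exp (assoc_fun M (2 / h * norm \<eta>)) \<le> (\<Sum>d\<in>D. \<bar>C d\<bar>) * exp (assoc_fun M (2 / h * norm \<eta>))"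
      by (intro mult_right_mono) auto
    then show ?thesis using C that by (meson order_trans)
  qed
  then show ?thesis unfolding patch_bound_def by blast
qed

end

theorem theorem1:
  fixes M :: "nat \<Rightarrow> real" and c0 H :: real and s :: utype
    and B :: "(real^'n::finite) set"
    and T :: "(real^'n \<Rightarrow> complex) \<Rightarrow> complex"
  assumes "weight_seq M c0 H"
    and "open B" and "connected B"
    and "ultradist s M T"
    and "\<forall>\<xi>\<in>B. \<exists>S. represents_exp_mult s M T \<xi> S"
  shows "(\<forall>\<xi>\<in>convex hull B. \<exists>S. represents_exp_mult s M T \<xi> S) \<and>
    (\<exists>f :: complex^'n \<Rightarrow> complex.
       holo_on f {z. (\<chi> j. Re (z $ j)) \<in> convex hull B} \<and>
       (\<forall>\<xi>\<in>convex hull B. \<forall>S. represents_exp_mult s M T \<xi> S \<longrightarrow>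
          (\<forall>\<psi>\<in>Stest s M. S (fourier \<psi>) = (LINT \<eta>|lborel. f (cpt \<xi> \<eta>) * \<psi> \<eta>))) \<and>
       (\<forall>K. compact K \<and> K \<subseteq> convex hull B \<longrightarrow>
          (let bnd = (\<lambda>k C. \<forall>\<xi>\<in>K. \<forall>\<eta>. cmod (f (cpt \<xi> \<eta>)) \<le> C * exp (assoc_fun M (k * norm \<eta>)))
           in case s of
                Beurling \<Rightarrow> (\<exists>k>0. \<exists>C. bnd k C)
              | Roumieu \<Rightarrow> (\<forall>k>0. \<exists>C. bnd k C))))"
proof -
  interpret weights M c0 H using assms(1) by unfold_locales
  have T: "ultradist s M T" by (rule assms(4))
  obtain \<kappa> :: "nat \<Rightarrow> real^'n \<Rightarrow> complex" where \<kappa>: "cutoffs \<kappa>" using exists_cutoffs by blast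
  obtain S where S: "\<And>i. i \<in> B \<Longrightarrow> represents_exp_mult s M T i (S i)" using assms(5) by metis
  have patch: "\<exists>F e. exp_patch M c0 H s T F \<xi> e S" if \<xi>: "\<xi> \<in> convex hull B" for \<xi>
  proof -
    obtain F e where "finite F" "F \<noteq> {}" "F \<subseteq> B" "e > 0" "cball \<xi> (2 * e) \<subseteq> convex hull F"
      using convex_hull_finite_cball[OF assms(2) \<xi>] by blast
    then have "exp_patch M c0 H s T F \<xi> e S" using S T by unfold_locales auto
    then show ?thesis by blast
  qed
  have rep: "\<exists>F e. exp_patch M c0 H s T F \<xi> e S \<and> represents_exp_mult s M T \<xi> (exp_patch.SX F \<xi> S)"
    if \<xi>: "\<xi> \<in> convex hull B" for \<xi>
  proof -
    obtain F e where p: "exp_patch M c0 H s T F \<xi> e S" using patch[OF \<xi>] by blast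
    interpret p: exp_patch M c0 H s T F \<xi> e S by (rule p)
    have "\<xi> \<in> convex hull F" using p.mem_hull[of \<xi>] p.e by simp
    from represents_convex_hull[OF T p.F p.S this]
    have "represents_exp_mult s M T \<xi> p.SX" unfolding p.SX_def[abs_def] p.SF_def .
    then show ?thesis using p by blast
  qed
  show ?thesis
  proof (intro conjI exI[of _ "laplace T \<kappa>"] ballI allI impI)
    fix \<xi> assume "\<xi> \<in> convex hull B"
    then show "\<exists>S. represents_exp_mult s M T \<xi> S" using rep by blast
  next
    show "holo_on (laplace T \<kappa>) {z. (\<chi> j. Re (z $ j)) \<in> convex hull B}"
      unfolding holo_on_def
    proof
      fix z :: "complex^'n" assume "z \<in> {z. (\<chi> j. Re (z $ j)) \<in> convex hull B}"
      then have "Rev z \<in> convex hull B" unfolding Rev_def by simp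
      then obtain F e where p: "exp_patch M c0 H s T F (Rev z) e S" using patch by blast
      show "\<exists>L. (laplace T \<kappa> has_derivative L) (at z) \<and> (\<forall>v. L (\<chi> j. \<i> * v $ j) = \<i> * L v)"
        by (rule exp_patch.laplace_holomorphic[OF p \<kappa> refl])
    qed
  next
    fix \<xi> S' and \<psi> :: "real^'n \<Rightarrow> complex"
    assume \<xi>: "\<xi> \<in> convex hull B" and S': "represents_exp_mult s M T \<xi> S'" and \<psi>: "\<psi> \<in> Stest s M"
    obtain F e where p: "exp_patch M c0 H s T F \<xi> e S" and r: "represents_exp_mult s M T \<xi> (exp_patch.SX F \<xi> S)"
      using rep[OF \<xi>] by blast
    \<comment> \<open>The claim is about every representing functional; by density each of them
      agrees with \<open>SX\<close> on the Fourier transform of \<psi>.\<close>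
    have "S' (fourier \<psi>) = exp_patch.SX F \<xi> S (fourier \<psi>)"
      by (rule tempered_determined_by_Dtest[OF _ _ _ fourier_Stest[OF \<psi>]])
        (use S' r in \<open>auto simp: represents_exp_mult_def\<close>)
    also have "\<dots> = (LINT \<eta>|lborel. laplace T \<kappa> (cpt \<xi> \<eta>) * \<psi> \<eta>)"
      by (rule exp_patch.swap_Stest[OF p \<kappa> \<psi>])
    finally show "S' (fourier \<psi>) = (LINT \<eta>|lborel. laplace T \<kappa> (cpt \<xi> \<eta>) * \<psi> \<eta>)" .
  next
    fix K assume K: "compact K \<and> K \<subseteq> convex hull B"
    have "\<exists>e>0. dual_quant s (patch_bound (laplace T \<kappa>) (cball \<xi> e))" if "\<xi> \<in> K" for \<xi>
    proof -
      have "\<xi> \<in> convex hull B" using that K by blast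
      then obtain F e where p: "exp_patch M c0 H s T F \<xi> e S" using patch by blast
      interpret p: exp_patch M c0 H s T F \<xi> e S by (rule p)
      have "dual_quant s (est s M p.SF)" using p.tempered_SF unfolding tempered_iff by simp
      then have "dual_quant s (patch_bound (laplace T \<kappa>) (cball \<xi> e))"
      proof (rule dual_quant_scale[where c=1])
        fix h :: real assume "h > 0" "est s M p.SF (1 * h)"
        then show "patch_bound (laplace T \<kappa>) (cball \<xi> e) h"
          using p.laplace_growth[OF \<kappa>, of h] unfolding patch_bound_def by simp
      qed simp
      then show ?thesis using p.e by blast
    qed
    then obtain e where e: "\<And>\<xi>. \<xi> \<in> K \<Longrightarrow> e \<xi> > 0 \<and> dual_quant s (patch_bound (laplace T \<kappa>) (cball \<xi> (e \<xi>)))"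
      by metis
    have "K \<subseteq> (\<Union>\<xi>\<in>K. ball \<xi> (e \<xi>))" using e by force
    then obtain D where D: "D \<subseteq> K" "finite D" "K \<subseteq> (\<Union>\<xi>\<in>D. ball \<xi> (e \<xi>))"
      using compactE_image[of K K "\<lambda>\<xi>. ball \<xi> (e \<xi>)"] K by (metis open_ball)
    \<comment> \<open>In the Beurling case each patch brings its own scale; finiteness of the
      subcover allows a common one.\<close>
    have "dual_quant s (\<lambda>h. \<forall>\<xi>\<in>D. patch_bound (laplace T \<kappa>) (cball \<xi> (e \<xi>)) h)"
    proof (rule dual_quant_ball[OF D(2)])
      show "dual_quant s (patch_bound (laplace T \<kappa>) (cball \<xi> (e \<xi>)))" if "\<xi> \<in> D" for \<xi>
        using e that D(1) by blast
    qed (rule patch_bound_antimono)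
    then have main: "dual_quant s (patch_bound (laplace T \<kappa>) K)"
    proof (rule dual_quant_scale[where c=1])
      fix h :: real assume "\<forall>\<xi>\<in>D. patch_bound (laplace T \<kappa>) (cball \<xi> (e \<xi>)) (1 * h)"
      then have "patch_bound (laplace T \<kappa>) (\<Union>\<xi>\<in>D. cball \<xi> (e \<xi>)) h" using patch_bound_Union[OF D(2)] by simp
      moreover have "K \<subseteq> (\<Union>\<xi>\<in>D. cball \<xi> (e \<xi>))" 
        by (rule subset_trans[OF D(3)]) (intro UN_mono order_refl ball_subset_cball)
      ultimately show "patch_bound (laplace T \<kappa>) K h" unfolding patch_bound_def by (meson subsetD)
    qed simp
    show "let bnd = (\<lambda>k C. \<forall>\<xi>\<in>K. \<forall>\<eta>. cmod (laplace T \<kappa> (cpt \<xi> \<eta>)) \<le> C * exp (assoc_fun M (k * norm \<eta>)))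
           in case s of
                Beurling \<Rightarrow> (\<exists>k>0. \<exists>C. bnd k C)
              | Roumieu \<Rightarrow> (\<forall>k>0. \<exists>C. bnd k C)"
    proof (cases s)
      case Beurling
      then obtain h where h: "h > 0" "patch_bound (laplace T \<kappa>) K h"
        using main unfolding dual_quant_def by auto
      then have "2 / h > 0" by simp
      then show ?thesis using h(2) unfolding Beurling Let_def utype.case patch_bound_def by blast
    next
      case Roumieu
      have "\<exists>C. \<forall>\<xi>\<in>K. \<forall>\<eta>. cmod (laplace T \<kappa> (cpt \<xi> \<eta>)) \<le> C * exp (assoc_fun M (k * norm \<eta>))" if k: "k > 0" for k
      proof -
        \<comment> \<open>The scale h = 2/k turns the rate 2/h into the prescribed k.\<close>
        have "patch_bound (laplace T \<kappa>) K (2 / k)" using main k unfolding dual_quant_def Roumieu by simp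
        then show ?thesis unfolding patch_bound_def by simp
      qed
      then show ?thesis unfolding Roumieu Let_def utype.case by blast
    qed
  qed
qed

end
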